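(* There is a continuous curve $\Gamma(\beta)$ defined on $[1,+\infty)$ such that (1) $\Gamma(1)=1$; (2) $1<\Gamma(\beta)<\beta$ for all $\beta>1$; and (3) $\lim_{\beta\to+\infty}\frac{\Gamma(\beta)}{\beta}=1$, and such that there is an FPTAS for the two-state spin system with local interaction matrix $\begin{bmatrix}\beta & 1 \\ 1 & \gamma\end{bmatrix}$ and external field $\mu\le 1$ whenever $\beta\gamma>1$ and $\gamma\le\Gamma(\beta)$.
   Context: For $\beta,\gamma\ge 0$ (with $\beta\ge 1$ so that $\Gamma(\beta)$ is defined) and $\mu\geq 0$, the two-state spin system with local interaction matrix $A=\begin{bmatrix} A_{0,0} & A_{0,1} \\ A_{1,0} & A_{1,1} \end{bmatrix}=\begin{bmatrix} \beta & 1 \\ 1 & \gamma \end{bmatrix}$ and external field $\mu$ takes as input a graph $G(V,E)$ and asks for the partition function $$Z(G)=\sum_{\sigma:V\to\{0,1\}}\ \prod_{(u,v)\in E}A_{\sigma(u),\sigma(v)}\prod_{v\in V}\mu^{\sigma(v)},$$ i.e. a vertex in state $1$ contributes a factor $\mu$ and a vertex in state $0$ a factor $1$. An FPTAS is a deterministic algorithm which, given an input of size $n$ and $\varepsilon>0$, outputs $Z'$ with $(1-\varepsilon)Z<Z'<(1+\varepsilon)Z$, where $Z$ is the correct value, in time polynomial in $n$ and $1/\varepsilon$. *)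

theory Defs
  imports Complex_Main "HOL-Library.FuncSet" "HOL-Library.Log_Nat"
begin

section \<open>Two-state spin systems\<close>

text \<open>A finite simple graph on the vertex set \<open>{..<n}\<close>. Every undirected edge is listed once, smaller
  endpoint first; the orientation is immaterial below because the interaction matrix is symmetric.\<close>

definition simple_graph :: "nat \<Rightarrow> (nat \<times> nat) set \<Rightarrow> bool" where
  "simple_graph n E \<longleftrightarrow> E \<subseteq> {(u, v). u < v \<and> v < n}"

definition interaction :: "real \<Rightarrow> real \<Rightarrow> nat \<Rightarrow> nat \<Rightarrow> real" where
  "interaction \<beta> \<gamma> i j = (if i = 0 \<and> j = 0 then \<beta> else if i = 1 \<and> j = 1 then \<gamma> else 1)"

definition partition_function ::
    "(nat \<Rightarrow> nat \<Rightarrow> real) \<Rightarrow> real \<Rightarrow> 'v set \<Rightarrow> ('v \<times> 'v) set \<Rightarrow> real" where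
  "partition_function A \<mu> V E =
     (\<Sum>\<sigma>\<in>V \<rightarrow>\<^sub>E {0, 1}. (\<Prod>(u, v)\<in>E. A (\<sigma> u) (\<sigma> v)) * (\<Prod>v\<in>V. \<mu> ^ \<sigma> v))"

section \<open>Deterministic algorithms and their running time\<close>

text \<open>The machine is a random access machine over the integers, with registers (addressed by the
  program text, hence finitely many are used by a program) and an indirectly addressed memory.
  Time is bit cost, so polynomial time has its usual Turing-machine meaning.

  The parameters \<open>\<beta>\<close>, \<open>\<gamma>\<close>, \<open>\<mu>\<close> and the accuracy \<open>\<epsilon>\<close> are arbitrary (possibly non-computable) real
  numbers. A program accesses them only through their binary expansions: it may ask for
  \<open>\<lfloor>2 ^ k * x\<rfloor>\<close>, at cost \<open>k + 1\<close>.\<close>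

datatype real_input = Beta | Gamma | Mu | Eps

type_synonym reg = nat

datatype instr =
    Const reg int
  | Add reg reg reg
  | Sub reg reg reg
  | Mul reg reg reg
  | Div reg reg reg
  | Load reg reg
  | Store reg reg
  | Query reg real_input reg
  | JumpPos reg nat

type_synonym program = "instr list"

record config =
  pc :: nat
  regs :: "reg \<Rightarrow> int"
  mem :: "nat \<Rightarrow> int"

text \<open>The destination register comes first; \<open>Store r s\<close> writes register \<open>s\<close> to the memory cell whose
  address is in register \<open>r\<close>. Negative addresses and precisions are read as 0.\<close>

fun exec_instr :: "(real_input \<Rightarrow> real) \<Rightarrow> instr \<Rightarrow> config \<Rightarrow> config" where
  "exec_instr x (Const r c) s = s\<lparr>pc := pc s + 1, regs := (regs s)(r := c)\<rparr>"
| "exec_instr x (Add r a b) s = s\<lparr>pc := pc s + 1, regs := (regs s)(r := regs s a + regs s b)\<rparr>"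
| "exec_instr x (Sub r a b) s = s\<lparr>pc := pc s + 1, regs := (regs s)(r := regs s a - regs s b)\<rparr>"
| "exec_instr x (Mul r a b) s = s\<lparr>pc := pc s + 1, regs := (regs s)(r := regs s a * regs s b)\<rparr>"
| "exec_instr x (Div r a b) s = s\<lparr>pc := pc s + 1, regs := (regs s)(r := regs s a div regs s b)\<rparr>"
| "exec_instr x (Load r a) s = s\<lparr>pc := pc s + 1, regs := (regs s)(r := mem s (nat (regs s a)))\<rparr>"
| "exec_instr x (Store a b) s = s\<lparr>pc := pc s + 1, mem := (mem s)(nat (regs s a) := regs s b)\<rparr>"
| "exec_instr x (Query r p a) s =
     s\<lparr>pc := pc s + 1, regs := (regs s)(r := \<lfloor>2 ^ nat (regs s a) * x p\<rfloor>)\<rparr>"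
| "exec_instr x (JumpPos a l) s = s\<lparr>pc := (if regs s a > 0 then l else pc s + 1)\<rparr>"

definition bits :: "int \<Rightarrow> nat" where
  "bits z = floorlog 2 (nat \<bar>z\<bar>)"

text \<open>A jump only inspects a sign, so it has unit cost. A query is charged for the requested precision
  and not for the integer part of the answer: the running time must be polynomial in \<open>1 / \<epsilon>\<close> also
  when \<open>\<epsilon>\<close> is huge.\<close>

fun instr_cost :: "instr \<Rightarrow> config \<Rightarrow> nat" where
  "instr_cost (Const r c) s = 1"
| "instr_cost (Add r a b) s = 1 + bits (regs s a) + bits (regs s b)"
| "instr_cost (Sub r a b) s = 1 + bits (regs s a) + bits (regs s b)"
| "instr_cost (Mul r a b) s = 1 + bits (regs s a) + bits (regs s b)"
| "instr_cost (Div r a b) s = 1 + bits (regs s a) + bits (regs s b)"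
| "instr_cost (Load r a) s = 1 + bits (regs s a) + bits (mem s (nat (regs s a)))"
| "instr_cost (Store a b) s = 1 + bits (regs s a) + bits (regs s b)"
| "instr_cost (Query r p a) s = 1 + nat (regs s a)"
| "instr_cost (JumpPos a l) s = 1"

definition halted :: "program \<Rightarrow> config \<Rightarrow> bool" where
  "halted P s \<longleftrightarrow> pc s \<ge> length P"

definition step :: "(real_input \<Rightarrow> real) \<Rightarrow> program \<Rightarrow> config \<Rightarrow> config" where
  "step x P s = (if halted P s then s else exec_instr x (P ! pc s) s)"

definition step_cost :: "program \<Rightarrow> config \<Rightarrow> nat" where
  "step_cost P s = (if halted P s then 0 else instr_cost (P ! pc s) s)"

definition run :: "(real_input \<Rightarrow> real) \<Rightarrow> program \<Rightarrow> config \<Rightarrow> nat \<Rightarrow> config" where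
  "run x P s k = (step x P ^^ k) s"

definition run_time :: "(real_input \<Rightarrow> real) \<Rightarrow> program \<Rightarrow> config \<Rightarrow> nat \<Rightarrow> nat" where
  "run_time x P s k = (\<Sum>i<k. step_cost P (run x P s i))"

text \<open>Started on \<open>s\<close>, the program halts within time \<open>T\<close> and outputs the rational number \<open>z\<close>, as
  numerator and positive denominator in registers 0 and 1.\<close>

definition outputs_within ::
    "(real_input \<Rightarrow> real) \<Rightarrow> program \<Rightarrow> config \<Rightarrow> real \<Rightarrow> real \<Rightarrow> bool" where
  "outputs_within x P s T z \<longleftrightarrow>
     (\<exists>k. halted P (run x P s k) \<and> real (run_time x P s k) \<le> T \<and>
          regs (run x P s k) 1 > 0 \<and>
          z = real_of_int (regs (run x P s k) 0) / real_of_int (regs (run x P s k) 1))"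

section \<open>Fully polynomial-time approximation schemes\<close>

text \<open>The number of vertices is in register 0, the adjacency matrix is in memory, row by row.\<close>

definition graph_input :: "nat \<Rightarrow> (nat \<times> nat) set \<Rightarrow> config" where
  "graph_input n E = \<lparr>pc = 0, regs = (\<lambda>_. 0)(0 := int n),
     mem = (\<lambda>a. if \<exists>i<n. \<exists>j<n. a = i * n + j \<and> ((i, j) \<in> E \<or> (j, i) \<in> E) then 1 else 0)\<rparr>"

fun real_inputs :: "real \<Rightarrow> real \<Rightarrow> real \<Rightarrow> real \<Rightarrow> real_input \<Rightarrow> real" where
  "real_inputs \<beta> \<gamma> \<mu> \<epsilon> Beta = \<beta>"
| "real_inputs \<beta> \<gamma> \<mu> \<epsilon> Gamma = \<gamma>"
| "real_inputs \<beta> \<gamma> \<mu> \<epsilon> Mu = \<mu>"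
| "real_inputs \<beta> \<gamma> \<mu> \<epsilon> Eps = \<epsilon>"

text \<open>\<open>C * (1 + n + 1 / \<epsilon>) ^ d\<close> dominates every polynomial in \<open>n\<close> and \<open>1 / \<epsilon>\<close> for suitable \<open>C\<close> and \<open>d\<close>.\<close>

definition is_fptas :: "program \<Rightarrow> real \<Rightarrow> real \<Rightarrow> real \<Rightarrow> bool" where
  "is_fptas P \<beta> \<gamma> \<mu> \<longleftrightarrow>
     (\<exists>(C::real) (d::nat). \<forall>n E (\<epsilon>::real). simple_graph n E \<longrightarrow> \<epsilon> > 0 \<longrightarrow>
        (\<exists>Z'. outputs_within (real_inputs \<beta> \<gamma> \<mu> \<epsilon>) P (graph_input n E)
                (C * (1 + real n + 1 / \<epsilon>) ^ d) Z' \<and>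
              (1 - \<epsilon>) * partition_function (interaction \<beta> \<gamma>) \<mu> {..<n} E < Z' \<and>
              Z' < (1 + \<epsilon>) * partition_function (interaction \<beta> \<gamma>) \<mu> {..<n} E))"

definition has_fptas :: "real \<Rightarrow> real \<Rightarrow> real \<Rightarrow> bool" where
  "has_fptas \<beta> \<gamma> \<mu> \<longleftrightarrow> (\<exists>P. is_fptas P \<beta> \<gamma> \<mu>)"

end

(* Dividing by beta ^ |E| and putting z in front of the interactions (a = z / beta, g = gamma * z) gives
   a polynomial in z that, by a Lee-Yang argument, has no zero for |z| <= R, where R > 1 because
   gamma < beta. Pinning the vertices one after the other, the partition function is a product of
   ratios that are analytic and bounded in that disc. For small z, the self-avoiding-walk recursion
   for a ratio contracts so strongly that truncating it at logarithmic depth is accurate; Lagrange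
   extrapolation from the nodes j / N, j <= m, with m / N small, then gives the ratio at z = 1 up to an
   error that is exponentially small in m. With m logarithmic in n and 1 / eps everything takes
   polynomial time. No correlation decay at z = 1 is needed, so every gamma < beta is covered and
   beta - 1 + 1 / beta serves as the curve. *)

theory Submission
  imports Defs "HOL-Complex_Analysis.Complex_Analysis"
begin

text \<open>The parameter z multiplies a configuration by z for every incidence of an edge with a
  spin-1 vertex: it turns the field \<mu> of v into \<mu> z^deg(v).

  The obstacle to the search is the unbounded degree: cut off at a fixed depth it would visit
  n^depth walks. Instead, every neighbour already treated, the predecessor aside, costs the later
  ones a unit of the depth budget, so that a budget b leads to about 2^b vertices. Nothing is lost,
  because a later factor is multiplied by the earlier ones, and the charged ones are all at most
  1/4.

  Extrapolation amplifies errors at the nodes by up to 2^(m + 2 N); the budget M = 2 (m + N) and the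
  K = M + m fractional bits beat this. As m is a constant times L and 2^L is polynomial in n and
  1/\<epsilon>, so is 2^M.

  Zero-freeness needs fields strictly inside the unit disc, but \<mu> = 1 is allowed, and the
  weights are reals known only up to rounding. The program works with a system of rational weights,
  rounded down and with a field below 1, and zero-freeness is applied to that system.\<close>

definition edge_wt :: "'a::field \<Rightarrow> 'a \<Rightarrow> bool \<Rightarrow> bool \<Rightarrow> 'a" where
  "edge_wt a g p q = (if p \<and> q then a * g else if p \<or> q then a else 1)"

text \<open>The fields vary with the vertex, because pinning a neighbour changes the field of a
  vertex. With \<open>a = 1 / \<beta>\<close> and \<open>g = \<gamma>\<close> the edge weights are
  the interactions divided by \<beta>.\<close>

definition spin_sum :: "'a::field \<Rightarrow> 'a \<Rightarrow> nat set \<Rightarrow> (nat \<times> nat) set \<Rightarrow> (nat \<Rightarrow> 'a) \<Rightarrow> 'a" where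
  "spin_sum a g I E \<Lambda> =
     (\<Sum>S\<in>Pow I. (\<Prod>v\<in>S. \<Lambda> v) * (\<Prod>(p, q)\<in>E. edge_wt a g (p \<in> S) (q \<in> S)))"

definition edges_on :: "(nat \<times> nat) set \<Rightarrow> nat set \<Rightarrow> (nat \<times> nat) set" where
  "edges_on E I = E \<inter> I \<times> I"

definition adj :: "(nat \<times> nat) set \<Rightarrow> nat \<Rightarrow> nat \<Rightarrow> bool" where
  "adj E v w \<longleftrightarrow> (v, w) \<in> E \<or> (w, v) \<in> E"

lemma adj_commute: "adj E v w \<longleftrightarrow> adj E w v"
  by (auto simp: adj_def)

lemma spin_sum_no_edges:
  assumes "finite I"
  shows "spin_sum a g I {} \<Lambda> = (\<Prod>v\<in>I. 1 + \<Lambda> v)"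
proof -
  have "(\<Prod>v\<in>I. \<Lambda> v + 1) = (\<Sum>S\<in>Pow I. (\<Prod>v\<in>S. \<Lambda> v) * (\<Prod>v\<in>I - S. 1))"
    by (rule prod_add[OF assms])
  then show ?thesis by (simp add: spin_sum_def add.commute)
qed

lemma spin_sum_field_cong:
  assumes "\<And>v. v \<in> I \<Longrightarrow> \<Lambda> v = \<Lambda>' v"
  shows "spin_sum a g I E \<Lambda> = spin_sum a g I E \<Lambda>'"
  unfolding spin_sum_def
proof (rule sum.cong[OF refl])
  fix S assume "S \<in> Pow I"
  then have "(\<Prod>v\<in>S. \<Lambda> v) = (\<Prod>v\<in>S. \<Lambda>' v)" using assms by (intro prod.cong) auto
  then show "(\<Prod>v\<in>S. \<Lambda> v) * (\<Prod>(p, q)\<in>E. edge_wt a g (p \<in> S) (q \<in> S)) =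
     (\<Prod>v\<in>S. \<Lambda>' v) * (\<Prod>(p, q)\<in>E. edge_wt a g (p \<in> S) (q \<in> S))" by simp
qed

text \<open>Conditioning on the spin of u. If u has spin 0, an edge to v weighs \<open>a\<close>
  when v has spin 1 and 1 otherwise; if u has spin 1, it weighs \<open>a * g\<close> or
  \<open>a\<close>. With one common \<open>a\<close> per edge pulled out, both cases only rescale
  the fields of the neighbours, by \<open>a\<close> or by \<open>g\<close>.\<close>

lemma spin_sum_split:
  assumes I: "finite I" "u \<in> I" and E: "finite E" "\<And>p q. (p, q) \<in> E \<Longrightarrow> p < q"
  shows "spin_sum a g I (edges_on E I) \<Lambda> =
    spin_sum a g (I - {u}) (edges_on E (I - {u})) (\<lambda>v. if adj E u v then a * \<Lambda> v else \<Lambda> v)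
    + \<Lambda> u * a ^ card {w \<in> I - {u}. adj E u w} *
      spin_sum a g (I - {u}) (edges_on E (I - {u})) (\<lambda>v. if adj E u v then g * \<Lambda> v else \<Lambda> v)"
proof -
  define J where "J = I - {u}"
  define N where "N = {w \<in> J. adj E u w}"
  \<comment> \<open>An edge at u is listed smaller endpoint first, so \<open>e\<close> recovers the
    pair from the other end.\<close>
  define e where "e w = (min u w, max u w)" for w
  have fin: "finite J" "finite N" using I by (auto simp: J_def N_def)
  have uJ: "u \<notin> J" "I = insert u J" using I by (auto simp: J_def)
  have eN: "e ` N \<inter> edges_on E J = {}" "inj_on e N"
    using uJ by (auto simp: e_def edges_on_def N_def inj_on_def min_def max_def split: if_splits)
  have EI: "edges_on E I = edges_on E J \<union> e ` N"
  proof (intro equalityI subsetI)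
    fix x assume x: "x \<in> edges_on E I"
    obtain p q where pq: "x = (p, q)" by fastforce
    with x E(2) have h: "p < q" "(p, q) \<in> E" "p \<in> I" "q \<in> I" by (auto simp: edges_on_def)
    show "x \<in> edges_on E J \<union> e ` N"
    proof (cases "p = u")
      case True
      then have "q \<in> N" "x = e q" using h pq by (auto simp: N_def J_def adj_def e_def)
      then show ?thesis by auto
    next
      case False
      show ?thesis
      proof (cases "q = u")
        case True
        then have "p \<in> N" "x = e p" using h pq False by (auto simp: N_def J_def adj_def e_def)
        then show ?thesis by auto
      next
        case False
        then show ?thesis using h pq \<open>p \<noteq> u\<close> by (auto simp: edges_on_def J_def)
      qed
    qed
  next
    fix x assume "x \<in> edges_on E J \<union> e ` N"
    then show "x \<in> edges_on E I"
      using I(2) by (auto simp: edges_on_def J_def N_def adj_def e_def min_def max_def dest: E(2) less_imp_le)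
        (use E(2) in force)+
  qed
  have prodI: "(\<Prod>(p, q)\<in>edges_on E I. edge_wt a g (p \<in> S) (q \<in> S)) =
      (\<Prod>(p, q)\<in>edges_on E J. edge_wt a g (p \<in> S) (q \<in> S)) *
      (\<Prod>w\<in>N. edge_wt a g (u \<in> S) (w \<in> S))" for S
  proof -
    have "(\<Prod>(p, q)\<in>e ` N. edge_wt a g (p \<in> S) (q \<in> S)) = (\<Prod>w\<in>N. edge_wt a g (u \<in> S) (w \<in> S))"
      by (subst prod.reindex[OF eN(2)])
         (auto simp: e_def edge_wt_def min_def max_def intro!: prod.cong)
    moreover have "finite (edges_on E J)" using E(1) by (simp add: edges_on_def)
    ultimately show ?thesis
      unfolding EI using eN fin by (subst prod.union_disjoint) auto
  qed
  have restr: "(\<Prod>v\<in>S. \<Lambda> v) * (\<Prod>w\<in>N. if w \<in> S then c else 1) =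
      (\<Prod>v\<in>S. if adj E u v then c * \<Lambda> v else \<Lambda> v)" if "S \<subseteq> J" for S and c
  proof -
    have fS: "finite S" using that fin finite_subset by auto
    have "(\<Prod>w\<in>N. if w \<in> S then c else 1) = (\<Prod>w\<in>S. if adj E u w then c else 1)"
      using fin fS that by (intro prod.mono_neutral_cong) (auto simp: N_def)
    then show ?thesis by (simp add: prod.distrib[symmetric]) (auto intro!: prod.cong)
  qed
  have "spin_sum a g I (edges_on E I) \<Lambda> =
     (\<Sum>S\<in>Pow J. (\<Prod>v\<in>S. \<Lambda> v) * (\<Prod>(p, q)\<in>edges_on E I. edge_wt a g (p \<in> S) (q \<in> S))) +
     (\<Sum>S\<in>Pow J. (\<Prod>v\<in>insert u S. \<Lambda> v) * (\<Prod>(p, q)\<in>edges_on E I. edge_wt a g (p \<in> insert u S) (q \<in> insert u S)))"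
  proof -
    have "inj_on (insert u) (Pow J)" using uJ by (auto simp: inj_on_def)
    moreover have "Pow J \<inter> insert u ` Pow J = {}" using uJ by auto
    ultimately show ?thesis
      unfolding spin_sum_def uJ(2) Pow_insert using fin
      by (subst sum.union_disjoint) (auto simp: sum.reindex)
  qed
  also have "(\<Sum>S\<in>Pow J. (\<Prod>v\<in>S. \<Lambda> v) * (\<Prod>(p, q)\<in>edges_on E I. edge_wt a g (p \<in> S) (q \<in> S))) =
     spin_sum a g J (edges_on E J) (\<lambda>v. if adj E u v then a * \<Lambda> v else \<Lambda> v)"
    unfolding spin_sum_def
  proof (intro sum.cong refl)
    fix S assume S: "S \<in> Pow J"
    then have "u \<notin> S" using uJ by auto
    then have "(\<Prod>w\<in>N. edge_wt a g (u \<in> S) (w \<in> S)) = (\<Prod>w\<in>N. if w \<in> S then a else 1)"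
      by (auto simp: edge_wt_def intro!: prod.cong)
    then show "(\<Prod>v\<in>S. \<Lambda> v) * (\<Prod>(p, q)\<in>edges_on E I. edge_wt a g (p \<in> S) (q \<in> S)) =
      (\<Prod>v\<in>S. if adj E u v then a * \<Lambda> v else \<Lambda> v) * (\<Prod>(p, q)\<in>edges_on E J. edge_wt a g (p \<in> S) (q \<in> S))"
      unfolding prodI using restr[of S a] S by (simp add: algebra_simps)
  qed
  also have "(\<Sum>S\<in>Pow J. (\<Prod>v\<in>insert u S. \<Lambda> v) * (\<Prod>(p, q)\<in>edges_on E I. edge_wt a g (p \<in> insert u S) (q \<in> insert u S))) =
     \<Lambda> u * a ^ card N * spin_sum a g J (edges_on E J) (\<lambda>v. if adj E u v then g * \<Lambda> v else \<Lambda> v)"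
    unfolding spin_sum_def sum_distrib_left
  proof (intro sum.cong refl)
    fix S assume S: "S \<in> Pow J"
    then have uS: "u \<notin> S" "finite S" using uJ fin finite_subset by auto
    have "(\<Prod>w\<in>N. edge_wt a g (u \<in> insert u S) (w \<in> insert u S)) = (\<Prod>w\<in>N. a * (if w \<in> S then g else 1))"
      by (intro prod.cong) (auto simp: edge_wt_def N_def J_def)
    also have "\<dots> = a ^ card N * (\<Prod>w\<in>N. if w \<in> S then g else 1)"
      by (simp add: prod.distrib)
    finally have 1: "(\<Prod>w\<in>N. edge_wt a g (u \<in> insert u S) (w \<in> insert u S)) = a ^ card N * (\<Prod>w\<in>N. if w \<in> S then g else 1)" .
    have 2: "(\<Prod>(p, q)\<in>edges_on E J. edge_wt a g (p \<in> insert u S) (q \<in> insert u S)) = (\<Prod>(p, q)\<in>edges_on E J. edge_wt a g (p \<in> S) (q \<in> S))"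
    proof (rule prod.cong[OF refl])
      fix x assume "x \<in> edges_on E J"
      then have "fst x \<noteq> u" "snd x \<noteq> u" by (auto simp: edges_on_def J_def)
      then show "(case x of (p, q) \<Rightarrow> edge_wt a g (p \<in> insert u S) (q \<in> insert u S)) =
          (case x of (p, q) \<Rightarrow> edge_wt a g (p \<in> S) (q \<in> S))"
        by (simp add: case_prod_unfold)
    qed
    show "(\<Prod>v\<in>insert u S. \<Lambda> v) * (\<Prod>(p, q)\<in>edges_on E I. edge_wt a g (p \<in> insert u S) (q \<in> insert u S)) =
      \<Lambda> u * a ^ card N * ((\<Prod>v\<in>S. if adj E u v then g * \<Lambda> v else \<Lambda> v) * (\<Prod>(p, q)\<in>edges_on E J. edge_wt a g (p \<in> S) (q \<in> S)))"
      unfolding prodI 1 2 using restr[of S g] S uS by (simp add: algebra_simps)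
  qed
  finally show ?thesis by (simp add: J_def N_def)
qed

lemma edge_wt_nonneg: "a \<ge> 0 \<Longrightarrow> g \<ge> 0 \<Longrightarrow> edge_wt a g p q \<ge> (0::real)"
  by (simp add: edge_wt_def)

text \<open>The empty set of spin-1 vertices contributes 1 by itself, so the bound is strict even
  for vanishing fields. This keeps the denominators of real ratios nonzero.\<close>

lemma spin_sum_pos:
  fixes a g :: real
  assumes "finite I" "a \<ge> 0" "g \<ge> 0" "\<And>v. v \<in> I \<Longrightarrow> \<Lambda> v \<ge> 0"
  shows "spin_sum a g I E \<Lambda> > 0"
proof -
  have "1 = (\<Sum>S\<in>{{}}. (\<Prod>v\<in>S. \<Lambda> v) * (\<Prod>(p, q)\<in>E. edge_wt a g (p \<in> S) (q \<in> S)))"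
    by (simp add: edge_wt_def case_prod_unfold)
  also have "\<dots> \<le> spin_sum a g I E \<Lambda>"
    unfolding spin_sum_def using assms
    by (intro sum_mono2) (auto intro!: mult_nonneg_nonneg prod_nonneg simp: edge_wt_nonneg)
  finally show ?thesis by simp
qed

lemma spin_sum_of_real:
  "spin_sum (complex_of_real a) (of_real g) I E (\<lambda>v. of_real (\<Lambda> v)) = of_real (spin_sum a g I E \<Lambda>)"
proof -
  have "edge_wt (complex_of_real a) (of_real g) p q = of_real (edge_wt a g p q)" for p q
    by (simp add: edge_wt_def)
  then show ?thesis by (simp add: spin_sum_def case_prod_unfold)
qed

section \<open>Zero-freeness\<close>

text \<open>\<open>s1\<close> and \<open>s2\<close> are the reciprocals of the roots of p + q t + r
  t^2, so a vanishing leading coefficient, even q = r = 0, needs no separate case.\<close>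

lemma quadratic_factorization:
  fixes p q r :: complex
  assumes "p \<noteq> 0"
  obtains s1 s2 where "q = - p * (s1 + s2)" "r = p * (s1 * s2)"
proof -
  define d where "d = csqrt ((q / p)\<^sup>2 - 4 * (r / p))"
  have d: "d\<^sup>2 = (q / p)\<^sup>2 - 4 * (r / p)" by (simp add: d_def)
  define s1 s2 where "s1 = (- q / p + d) / 2" and "s2 = (- q / p - d) / 2"
  have "s1 * s2 = ((q / p)\<^sup>2 - d\<^sup>2) / 4" by (simp add: s1_def s2_def algebra_simps power2_eq_square)
  also have "\<dots> = r / p" by (simp add: d)
  finally have "r = p * (s1 * s2)" using assms by simp
  moreover have "q = - p * (s1 + s2)" using assms by (simp add: s1_def s2_def field_simps)
  ultimately show ?thesis using that by blast
qed

text \<open>A contraction in the manner of Asano: an edge replaces 1, t, t^2 by its weights 1, a, a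
  g. By \<open>nz\<close> the reciprocal roots satisfy |s1| < 1 and |s2| < 1, and the new value is p
  ((1 - a s2) - s1 a (1 - g s2)). It vanishes only if s1 times the value of the Moebius map a (1 + g
  x) / (1 + a x) at x = - s2 is 1, and \<open>ly\<close> says that this map sends the open unit disc
  into the closed one.\<close>

lemma contracted_quadratic_nonzero:
  fixes p q r a g :: complex
  assumes nz: "\<And>t. norm t \<le> 1 \<Longrightarrow> p + q * t + r * t\<^sup>2 \<noteq> 0"
    and ly: "\<And>x. norm x < 1 \<Longrightarrow> 1 + a * x \<noteq> 0 \<and> norm (a * (1 + g * x)) \<le> norm (1 + a * x)"
  shows "p + a * q + a * g * r \<noteq> 0"
proof -
  have p: "p \<noteq> 0" using nz[of 0] by simp
  obtain s1 s2 where s: "q = - p * (s1 + s2)" "r = p * (s1 * s2)"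
    using quadratic_factorization[OF p] by blast
  have f: "p + q * t + r * t\<^sup>2 = p * ((1 - s1 * t) * (1 - s2 * t))" for t
    by (simp add: s algebra_simps power2_eq_square)
  have s1: "norm s1 < 1"
  proof (rule ccontr)
    assume "\<not> norm s1 < 1"
    then have "norm (1 / s1) \<le> 1" "s1 \<noteq> 0" by (auto simp: norm_divide divide_simps)
    then show False using nz[of "1 / s1"] unfolding f by auto
  qed
  have s2: "norm s2 < 1"
  proof (rule ccontr)
    assume "\<not> norm s2 < 1"
    then have "norm (1 / s2) \<le> 1" "s2 \<noteq> 0" by (auto simp: norm_divide divide_simps)
    then show False using nz[of "1 / s2"] unfolding f by auto
  qed
  have l: "1 + a * (- s2) \<noteq> 0" "norm (a * (1 + g * (- s2))) \<le> norm (1 + a * (- s2))"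
    using ly[of "- s2"] s2 by auto
  show ?thesis
  proof
    assume "p + a * q + a * g * r = 0"
    then have "p * (1 + a * (- s2) - s1 * (a * (1 + g * (- s2)))) = 0"
      by (simp add: s algebra_simps)
    then have "1 + a * (- s2) = s1 * (a * (1 + g * (- s2)))" using p by simp
    then have "norm (1 + a * (- s2)) = norm s1 * norm (a * (1 + g * (- s2)))"
      by (metis norm_mult)
    also have "\<dots> \<le> norm s1 * norm (1 + a * (- s2))" using l by (intro mult_left_mono) auto
    also have "\<dots> < 1 * norm (1 + a * (- s2))" using s1 l by (intro mult_strict_right_mono) auto
    finally show False by simp
  qed
qed

text \<open>Edges are added one at a time. Multiplying the fields of both ends of the new edge by t
  makes the sum without that edge a quadratic in t, whose coefficients p, q, r collect the
  configurations with 0, 1, 2 of the ends in spin 1. As |t| \<le> 1 keeps the fields inside the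
  disc, the induction hypothesis excludes zeros, and the contraction inserts the edge. Without edges
  the sum is a product of factors 1 + \<Lambda> v, whence the strict bound on the fields.\<close>

theorem spin_sum_nonzero:
  fixes a g :: complex
  assumes ly: "\<And>x. norm x < 1 \<Longrightarrow> 1 + a * x \<noteq> 0 \<and> norm (a * (1 + g * x)) \<le> norm (1 + a * x)"
    and I: "finite I" and E: "finite E" "E \<subseteq> I \<times> I" "\<And>p q. (p, q) \<in> E \<Longrightarrow> p \<noteq> q"
    and \<Lambda>: "\<And>v. v \<in> I \<Longrightarrow> norm (\<Lambda> v) < 1"
  shows "spin_sum a g I E \<Lambda> \<noteq> 0"
  using E \<Lambda>
proof (induction E arbitrary: \<Lambda> rule: finite_induct)
  case empty
  have "1 + \<Lambda> v \<noteq> 0" if "v \<in> I" for v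
    using empty(3)[OF that] by (metis add_eq_0_iff less_irrefl norm_minus_cancel norm_one)
  then show ?case using I by (simp add: spin_sum_no_edges)
next
  case (insert e E)
  obtain u v where e: "e = (u, v)" by fastforce
  have uv: "u \<in> I" "v \<in> I" "u \<noteq> v" using insert.prems e by auto
  define T where "T S = (\<Prod>v\<in>S. \<Lambda> v) * (\<Prod>(p, q)\<in>E. edge_wt a g (p \<in> S) (q \<in> S))" for S
  define p q r where "p = sum T {S \<in> Pow I. u \<notin> S \<and> v \<notin> S}"
    and "q = sum T {S \<in> Pow I. (u \<in> S) \<noteq> (v \<in> S)}"
    and "r = sum T {S \<in> Pow I. u \<in> S \<and> v \<in> S}"
  have split: "sum f (Pow I) = sum f {S \<in> Pow I. u \<notin> S \<and> v \<notin> S}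
      + sum f {S \<in> Pow I. (u \<in> S) \<noteq> (v \<in> S)} + sum f {S \<in> Pow I. u \<in> S \<and> v \<in> S}" for f :: "nat set \<Rightarrow> complex"
  proof -
    define A B C where "A = {S \<in> Pow I. u \<notin> S \<and> v \<notin> S}"
      and "B = {S \<in> Pow I. (u \<in> S) \<noteq> (v \<in> S)}" and "C = {S \<in> Pow I. u \<in> S \<and> v \<in> S}"
    have "Pow I = A \<union> B \<union> C" "(A \<union> B) \<inter> C = {}" "A \<inter> B = {}" by (auto simp: A_def B_def C_def)
    moreover have "finite A" "finite B" "finite C" using I by (auto simp: A_def B_def C_def)
    ultimately have "sum f (Pow I) = sum f A + sum f B + sum f C"
      by (simp add: sum.union_disjoint)
    then show ?thesis by (simp only: A_def B_def C_def)
  qed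
  have ins: "spin_sum a g I (insert e E) \<Lambda> = p + a * q + a * g * r"
  proof -
    have "spin_sum a g I (insert e E) \<Lambda> = (\<Sum>S\<in>Pow I. edge_wt a g (u \<in> S) (v \<in> S) * T S)"
      unfolding spin_sum_def T_def using insert.hyps
      by (intro sum.cong refl) (simp add: e mult.left_commute)
    also have "\<dots> = (\<Sum>S | S \<in> Pow I \<and> u \<notin> S \<and> v \<notin> S. T S) + (\<Sum>S | S \<in> Pow I \<and> (u \<in> S) \<noteq> (v \<in> S). a * T S)
        + (\<Sum>S | S \<in> Pow I \<and> u \<in> S \<and> v \<in> S. a * g * T S)"
      by (subst split, intro arg_cong2[where f="(+)"] sum.cong refl) (auto simp: edge_wt_def)
    finally show ?thesis unfolding p_def q_def r_def sum_distrib_left .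
  qed
  have del: "spin_sum a g I E (\<lambda>w. if w = u \<or> w = v then t * \<Lambda> w else \<Lambda> w) = p + q * t + r * t\<^sup>2" for t
  proof -
    define m where "m S = (if u \<in> S then t else 1) * (if v \<in> S then t else 1)" for S
    have prod: "(\<Prod>w\<in>S. if w = u \<or> w = v then t * \<Lambda> w else \<Lambda> w) = m S * (\<Prod>v\<in>S. \<Lambda> v)"
      if "S \<subseteq> I" for S
    proof -
      have fS: "finite S" using that I finite_subset by auto
      have "(\<Prod>w\<in>S. if w = u \<or> w = v then t * \<Lambda> w else \<Lambda> w) =
        (\<Prod>w\<in>S. (if w = u then t else 1) * ((if w = v then t else 1) * \<Lambda> w))"
        using uv by (intro prod.cong) auto
      also have "\<dots> = m S * (\<Prod>v\<in>S. \<Lambda> v)"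
        using fS by (simp add: prod.distrib m_def prod.delta)
      finally show ?thesis .
    qed
    have "spin_sum a g I E (\<lambda>w. if w = u \<or> w = v then t * \<Lambda> w else \<Lambda> w) = (\<Sum>S\<in>Pow I. m S * T S)"
      unfolding spin_sum_def T_def
      by (intro sum.cong refl) (simp add: prod mult.assoc)
    also have "\<dots> = (\<Sum>S | S \<in> Pow I \<and> u \<notin> S \<and> v \<notin> S. T S) + (\<Sum>S | S \<in> Pow I \<and> (u \<in> S) \<noteq> (v \<in> S). T S * t)
        + (\<Sum>S | S \<in> Pow I \<and> u \<in> S \<and> v \<in> S. T S * t\<^sup>2)"
      by (subst split, intro arg_cong2[where f="(+)"] sum.cong refl) (auto simp: m_def power2_eq_square)
    finally show ?thesis unfolding p_def q_def r_def sum_distrib_right .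
  qed
  have "p + q * t + r * t\<^sup>2 \<noteq> 0" if "norm t \<le> 1" for t
  proof -
    have "norm (t * \<Lambda> w) < 1" if "w \<in> I" for w
    proof -
      have "norm t * norm (\<Lambda> w) \<le> norm (\<Lambda> w)" using \<open>norm t \<le> 1\<close> by (intro mult_left_le_one_le) auto
      then show ?thesis using insert.prems(3)[OF that] by (simp add: norm_mult)
    qed
    then show ?thesis
      unfolding del[symmetric] using insert.prems by (intro insert.IH) auto
  qed
  from contracted_quadratic_nonzero[OF this ly] show ?case unfolding ins by blast
qed

text \<open>With y = z x and s = |y| \<le> t = |z|, the claim is t |1 + \<gamma> y| \<le> |\<beta> +
  y|. The difference of the squares is affine in Re y with slope 2 (\<beta> - \<gamma> t^2) > 0, so
  the worst case is Re y = - s, where the claim becomes |t (1 - \<gamma> s)| \<le> \<beta> -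
  s.\<close>

lemma lee_yang_condition:
  fixes z x :: complex and \<beta> \<gamma> :: real
  assumes "\<beta> > 0" "\<gamma> > 0" "\<beta> * \<gamma> > 1" "(norm z)\<^sup>2 * \<gamma> < \<beta>" "norm x < 1"
  shows "1 + z / \<beta> * x \<noteq> 0 \<and> norm (z / \<beta> * (1 + \<gamma> * z * x)) \<le> norm (1 + z / \<beta> * x)"
proof -
  define t y where "t = norm z" and "y = z * x"
  define s where "s = norm y"
  have t0: "t \<ge> 0" "s \<ge> 0" by (auto simp: t_def s_def)
  have st: "s \<le> t" using assms(5) by (simp add: s_def y_def t_def norm_mult mult_left_le)
  have t2: "t\<^sup>2 * \<gamma> < \<beta>" using assms t_def by simp
  have tb: "t < \<beta>"
  proof (rule ccontr)
    assume "\<not> t < \<beta>"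
    then have "\<beta>\<^sup>2 \<le> t\<^sup>2" using assms by (intro power_mono) auto
    then have "\<beta>\<^sup>2 * \<gamma> \<le> t\<^sup>2 * \<gamma>" using assms by (intro mult_right_mono) auto
    moreover have "\<beta> * 1 < \<beta> * (\<beta> * \<gamma>)" using assms by (intro mult_strict_left_mono) auto
    ultimately show False using t2 by (simp add: power2_eq_square mult_ac)
  qed
  \<comment> \<open>\<open>k1\<close> and \<open>k2\<close> are the two signs of the worst
    case.\<close>
  have k1: "t * (\<gamma> * s - 1) \<le> \<beta> - s"
  proof -
    have "(\<gamma> * t + 1) * s \<le> (\<gamma> * t + 1) * t" using st t0 assms by (intro mult_left_mono) auto
    then show ?thesis using t2 by (simp add: algebra_simps power2_eq_square)
  qed
  have k2: "t * (1 - \<gamma> * s) \<le> \<beta> - s"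
  proof (cases "\<gamma> * t \<le> 1")
    case True
    \<comment> \<open>Here t + s (1 - \<gamma> t) \<le> 2 t - \<gamma> t^2 \<le> 1 / \<gamma>, and
      this is below \<beta> as \<beta> \<gamma> > 1.\<close>
    have "s * (1 - \<gamma> * t) \<le> t * (1 - \<gamma> * t)" using st True by (intro mult_right_mono) auto
    moreover have "0 \<le> (\<gamma> * t - 1)\<^sup>2" by simp
    then have "\<gamma> * (2 * t - \<gamma> * t\<^sup>2) \<le> 1" by (simp add: algebra_simps power2_eq_square)
    then have "\<gamma> * (2 * t - \<gamma> * t\<^sup>2) \<le> \<gamma> * \<beta>" using assms(3) by (simp add: mult.commute)
    then have "2 * t - \<gamma> * t\<^sup>2 \<le> \<beta>" using assms by simp
    ultimately show ?thesis by (simp add: algebra_simps power2_eq_square)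
  next
    case False
    then have "s * (1 - \<gamma> * t) \<le> 0" using t0 by (intro mult_nonneg_nonpos) auto
    then show ?thesis using tb by (simp add: algebra_simps)
  qed
  have "\<bar>t * (1 - \<gamma> * s)\<bar> \<le> \<beta> - s" using k1 k2 by (simp add: abs_le_iff algebra_simps)
  then have k3: "(t * (1 - \<gamma> * s))\<^sup>2 \<le> (\<beta> - s)\<^sup>2" by (rule power2_le_iff_abs_le[THEN iffD2, rotated]) (use st tb in auto)
  have re: "Re y \<ge> - s" "(Re y)\<^sup>2 + (Im y)\<^sup>2 = s\<^sup>2"
    using abs_Re_le_cmod[of y] by (auto simp: s_def cmod_power2)
  have n1: "(norm (1 + \<gamma> * y))\<^sup>2 = 1 + 2 * \<gamma> * Re y + \<gamma>\<^sup>2 * s\<^sup>2"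
    unfolding re(2)[symmetric] cmod_power2 by (simp add: algebra_simps power2_eq_square)
  have n2: "(norm (\<beta> + y))\<^sup>2 = \<beta>\<^sup>2 + 2 * \<beta> * Re y + s\<^sup>2"
    unfolding re(2)[symmetric] cmod_power2 by (simp add: algebra_simps power2_eq_square)
  \<comment> \<open>The slope is positive, so Re y may be replaced by its minimum - s.\<close>
  have "(\<beta> - \<gamma> * t\<^sup>2) * (- s) \<le> (\<beta> - \<gamma> * t\<^sup>2) * Re y"
    using re t2 by (intro mult_left_mono) (auto simp: mult.commute)
  then have "t\<^sup>2 * (norm (1 + \<gamma> * y))\<^sup>2 \<le> (norm (\<beta> + y))\<^sup>2"
    unfolding n1 n2 using k3 by (simp add: algebra_simps power2_eq_square)
  then have "(t * norm (1 + \<gamma> * y))\<^sup>2 \<le> (norm (\<beta> + y))\<^sup>2" by (simp add: power_mult_distrib)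
  then have le: "t * norm (1 + \<gamma> * y) \<le> norm (\<beta> + y)" by (rule power2_le_imp_le) auto
  have e1: "1 + z / \<beta> * x = (\<beta> + y) / \<beta>" using assms by (simp add: y_def field_simps)
  have e2: "z / \<beta> * (1 + \<gamma> * z * x) = z * (1 + \<gamma> * y) / \<beta>" by (simp add: y_def mult_ac)
  have "norm y < norm (complex_of_real \<beta>)" using st tb assms by (simp add: s_def)
  then have "\<beta> + y \<noteq> 0" by (metis add_eq_0_iff less_irrefl norm_minus_cancel)
  then show ?thesis
    unfolding e1 e2 using assms le by (simp add: norm_divide norm_mult t_def divide_right_mono)
qed

section \<open>Marginal ratios\<close>

text \<open>The two terms of \<open>spin_sum_split\<close>, spin 1 over spin 0 at u. Only the sum in
  the denominator has to be nonzero, not the one over all of I.\<close>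

definition ratio :: "'a::field \<Rightarrow> 'a \<Rightarrow> nat set \<Rightarrow> (nat \<times> nat) set \<Rightarrow> (nat \<Rightarrow> 'a) \<Rightarrow> nat \<Rightarrow> 'a" where
  "ratio a g I E \<Lambda> u = \<Lambda> u * a ^ card {w \<in> I - {u}. adj E u w} *
     spin_sum a g (I - {u}) (edges_on E (I - {u})) (\<lambda>v. if adj E u v then g * \<Lambda> v else \<Lambda> v) /
     spin_sum a g (I - {u}) (edges_on E (I - {u})) (\<lambda>v. if adj E u v then a * \<Lambda> v else \<Lambda> v)"

text \<open>The factor that a neighbour with ratio x contributes to the ratio of a vertex: a (1 + g
  x) and 1 + a x are the weights of the neighbour for spin 1 and for spin 0 at the vertex. It is the
  Moebius map of the zero-freeness condition.\<close>

definition msg :: "'a::field \<Rightarrow> 'a \<Rightarrow> 'a \<Rightarrow> 'a" where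
  "msg a g x = a * (1 + g * x) / (1 + a * x)"

text \<open>The sum is affine in the field at u. This gives the effect of changing a single field,
  in particular of exchanging a factor \<open>a\<close> for a factor \<open>g\<close>.\<close>

lemma spin_sum_scale_field:
  assumes "finite I" "u \<in> I" "finite E" "\<And>p q. (p, q) \<in> E \<Longrightarrow> p < q"
    and nz: "spin_sum a g (I - {u}) (edges_on E (I - {u})) (\<lambda>v. if adj E u v then a * \<Lambda> v else \<Lambda> v) \<noteq> 0"
  shows "spin_sum a g I (edges_on E I) (\<Lambda>(u := c * \<Lambda> u)) =
    spin_sum a g (I - {u}) (edges_on E (I - {u})) (\<lambda>v. if adj E u v then a * \<Lambda> v else \<Lambda> v) *
    (1 + c * ratio a g I E \<Lambda> u)"
proof -
  have *: "spin_sum a g (I - {u}) (edges_on E (I - {u})) (\<lambda>v. if adj E u v then k * (\<Lambda>(u := c * \<Lambda> u)) v else (\<Lambda>(u := c * \<Lambda> u)) v)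
    = spin_sum a g (I - {u}) (edges_on E (I - {u})) (\<lambda>v. if adj E u v then k * \<Lambda> v else \<Lambda> v)" for k
    by (rule spin_sum_field_cong) auto
  show ?thesis
    by (subst spin_sum_split[OF assms(1-4)], assumption, unfold * ratio_def)
      (use nz in \<open>simp add: distrib_left\<close>)
qed

lemma ratio_nonneg:
  fixes a g :: real
  assumes "finite I" "u \<in> I" "a \<ge> 0" "g \<ge> 0" "\<And>v. v \<in> I \<Longrightarrow> \<Lambda> v \<ge> 0"
  shows "ratio a g I E \<Lambda> u \<ge> 0"
  unfolding ratio_def using assms
  by (intro divide_nonneg_nonneg mult_nonneg_nonneg less_imp_le[OF spin_sum_pos]) auto

text \<open>The neighbours of \<open>u\<close> are switched one at a time from the state that \<open>u\<close> induces when it has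
  spin 0 to the state it induces when it has spin 1.\<close>

lemma ratio_recursion:
  fixes a g :: real
  assumes I: "finite I" "u \<in> I" and E: "finite E" "\<And>p q. (p, q) \<in> E \<Longrightarrow> p < q"
    and nn: "a \<ge> 0" "g \<ge> 0" "\<And>v. v \<in> I \<Longrightarrow> \<Lambda> v \<ge> 0"
  shows "ratio a g I E \<Lambda> u = \<Lambda> u * (\<Prod>w\<in>{w \<in> I - {u}. adj E u w}.
    msg a g (ratio a g (I - {u}) E
      (\<lambda>v. if adj E u v \<and> v \<noteq> w then (if v < w then g else a) * \<Lambda> v else \<Lambda> v) w))"
proof -
  define J where "J = I - {u}"
  define N where "N = {w \<in> J. adj E u w}"
  \<comment> \<open>\<open>T k\<close> is the field after the neighbours below k have been switched.
    \<open>M w\<close> leaves the neighbour w itself unscaled, so both \<open>T w\<close> and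
    \<open>T (Suc w)\<close> arise from \<open>M w\<close> by scaling at w only.\<close>
  define M where "M w v = (if adj E u v \<and> v \<noteq> w then (if v < w then g else a) * \<Lambda> v else \<Lambda> v)" for w v
  define T where "T k v = (if adj E u v then (if v < k then g else a) * \<Lambda> v else \<Lambda> v)" for k v
  have J: "finite J" using I by (simp add: J_def)
  have nnT: "T k v \<ge> 0" "M k v \<ge> 0" if "v \<in> J" for k v
    using that nn by (auto simp: T_def M_def J_def)
  let ?Z = "\<lambda>\<Lambda>. spin_sum a g J (edges_on E J) \<Lambda>"
  define F where "F w = (1 + g * ratio a g J E (M w) w) / (1 + a * ratio a g J E (M w) w)" for w
  have step: "?Z (T (Suc k)) = ?Z (T k) * (if k \<in> N then F k else 1)" for k
  proof (cases "k \<in> N")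
    case False
    have "?Z (T (Suc k)) = ?Z (T k)"
      using False by (intro spin_sum_field_cong) (auto simp: T_def N_def less_Suc_eq)
    then show ?thesis using False by simp
  next
    case True
    then have k: "k \<in> J" "adj E u k" by (auto simp: N_def)
    define D where "D = spin_sum a g (J - {k}) (edges_on E (J - {k})) (\<lambda>v. if adj E k v then a * M k v else M k v)"
    have D: "D > 0" unfolding D_def using J nn nnT by (intro spin_sum_pos) auto
    then have Dn: "D \<noteq> 0" by simp
    have r: "ratio a g J E (M k) k \<ge> 0" using J k nn nnT by (intro ratio_nonneg) auto
    have "?Z ((M k)(k := c * M k k)) = D * (1 + c * ratio a g J E (M k) k)" for c
      unfolding D_def
      by (rule spin_sum_scale_field[OF J k(1) E]) (use Dn in \<open>simp_all add: D_def\<close>)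
    moreover have "T (Suc k) = (M k)(k := g * M k k)" "T k = (M k)(k := a * M k k)"
      using k by (auto simp: T_def M_def fun_eq_iff less_Suc_eq)
    ultimately have "?Z (T (Suc k)) = D * (1 + g * ratio a g J E (M k) k)"
      "?Z (T k) = D * (1 + a * ratio a g J E (M k) k)" by simp_all
    moreover have "0 \<le> a * ratio a g J E (M k) k" using r nn by simp
    then have "1 + a * ratio a g J E (M k) k \<noteq> 0" by linarith
    ultimately show ?thesis using True by (simp add: F_def)
  qed
  have tele: "?Z (T k) = ?Z (T 0) * (\<Prod>w\<in>{w \<in> N. w < k}. F w)" for k
  proof (induction k)
    case (Suc k)
    have "{w \<in> N. w < Suc k} = (if k \<in> N then insert k {w \<in> N. w < k} else {w \<in> N. w < k})"
      by (auto simp: less_Suc_eq)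
    moreover have "finite {w \<in> N. w < k}" by simp
    ultimately show ?case by (simp add: step Suc)
  qed simp
  obtain k where k: "\<And>w. w \<in> J \<Longrightarrow> w < k" using J unfolding finite_nat_set_iff_bounded by blast
  have "{w \<in> N. w < k} = N" using k by (auto simp: N_def)
  then have "?Z (T k) = ?Z (T 0) * (\<Prod>w\<in>N. F w)" using tele[of k] by simp
  moreover have "?Z (T k) = ?Z (\<lambda>v. if adj E u v then g * \<Lambda> v else \<Lambda> v)"
    using k by (intro spin_sum_field_cong) (auto simp: T_def)
  moreover have "?Z (T 0) = ?Z (\<lambda>v. if adj E u v then a * \<Lambda> v else \<Lambda> v)"
    by (intro spin_sum_field_cong) (auto simp: T_def)
  moreover have "?Z (T 0) > 0" using J nn nnT by (intro spin_sum_pos) auto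
  ultimately have "ratio a g I E \<Lambda> u = \<Lambda> u * (a ^ card N * (\<Prod>w\<in>N. F w))"
    unfolding ratio_def J_def[symmetric] N_def[symmetric] by simp
  also have "a ^ card N * (\<Prod>w\<in>N. F w) = (\<Prod>w\<in>N. msg a g (ratio a g J E (M w) w))"
    unfolding msg_def F_def by (simp add: prod.distrib[of "\<lambda>_. a", simplified, symmetric])
  finally show ?thesis unfolding J_def N_def M_def .
qed

text \<open>A state of the search for the ratio: \<open>\<sigma> w\<close> is 0 for a free vertex, and one more than the
  successor for a vertex on the current path. The value 1 also encodes that a vertex is pinned to spin 0.\<close>

definition pin :: "'a::field \<Rightarrow> 'a \<Rightarrow> nat \<Rightarrow> nat \<Rightarrow> 'a" where
  "pin a g s v = (if s = Suc v then 1 else if s > Suc v then g else a)"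

definition pinned_field :: "'a::field \<Rightarrow> 'a \<Rightarrow> 'a \<Rightarrow> nat \<Rightarrow> (nat \<times> nat) set \<Rightarrow> (nat \<Rightarrow> nat) \<Rightarrow> nat \<Rightarrow> 'a" where
  "pinned_field a g \<mu> n E \<sigma> v = \<mu> * (\<Prod>w\<in>{w. w < n \<and> adj E v w \<and> \<sigma> w > 0}. pin a g (\<sigma> w) v)"

definition path_ratio :: "'a::field \<Rightarrow> 'a \<Rightarrow> 'a \<Rightarrow> nat \<Rightarrow> (nat \<times> nat) set \<Rightarrow> (nat \<Rightarrow> nat) \<Rightarrow> nat \<Rightarrow> 'a" where
  "path_ratio a g \<mu> n E \<sigma> u = ratio a g {v. v < n \<and> \<sigma> v = 0} E (pinned_field a g \<mu> n E \<sigma>) u"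

lemma ratio_field_cong:
  assumes "\<And>v. v \<in> I \<Longrightarrow> \<Lambda> v = \<Lambda>' v" "u \<in> I"
  shows "ratio a g I E \<Lambda> u = ratio a g I E \<Lambda>' u"
proof -
  have "spin_sum a g (I - {u}) (edges_on E (I - {u})) (\<lambda>v. if adj E u v then k * \<Lambda> v else \<Lambda> v) =
    spin_sum a g (I - {u}) (edges_on E (I - {u})) (\<lambda>v. if adj E u v then k * \<Lambda>' v else \<Lambda>' v)" for k
    using assms by (intro spin_sum_field_cong) auto
  then show ?thesis using assms by (simp add: ratio_def)
qed

lemma pinned_field_nonneg:
  "a \<ge> 0 \<Longrightarrow> g \<ge> 0 \<Longrightarrow> \<mu> \<ge> 0 \<Longrightarrow> pinned_field a g \<mu> n E \<sigma> v \<ge> (0::real)"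
  unfolding pinned_field_def by (intro mult_nonneg_nonneg prod_nonneg) (auto simp: pin_def)

lemma path_ratio_nonneg:
  "a \<ge> 0 \<Longrightarrow> g \<ge> 0 \<Longrightarrow> \<mu> \<ge> 0 \<Longrightarrow> u < n \<Longrightarrow> \<sigma> u = 0 \<Longrightarrow> path_ratio a g \<mu> n E \<sigma> u \<ge> (0::real)"
  unfolding path_ratio_def by (intro ratio_nonneg) (auto intro: pinned_field_nonneg)

text \<open>The self-avoiding walk tree. Going from u to w records only \<sigma> u = Suc w: that u
  then acts on a neighbour v with \<open>g\<close> for v < w, with \<open>a\<close> for v > w and
  not at all on w is read off by \<open>pin\<close>. A neighbour of u on the path thus contributes a
  constant; for the predecessor of u that constant is 1.\<close>

lemma path_ratio_recursion:
  fixes a g \<mu> :: real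
  assumes E: "finite E" "\<And>p q. (p, q) \<in> E \<Longrightarrow> p < q" and nn: "a \<ge> 0" "g \<ge> 0" "\<mu> \<ge> 0"
    and u: "u < n" "\<sigma> u = 0"
  shows "path_ratio a g \<mu> n E \<sigma> u = \<mu> * (\<Prod>w\<in>{w. w < n \<and> adj E u w}.
    if \<sigma> w > 0 then pin a g (\<sigma> w) u else msg a g (path_ratio a g \<mu> n E (\<sigma>(u := Suc w)) w))"
proof -
  have nl: "\<not> adj E v v" for v using E(2) by (auto simp: adj_def)
  define I where "I = {v. v < n \<and> \<sigma> v = 0}"
  define \<Lambda> where "\<Lambda> = pinned_field a g \<mu> n E \<sigma>"
  have I: "finite I" "u \<in> I" using u by (auto simp: I_def)
  have "msg a g (ratio a g (I - {u}) E (\<lambda>v. if adj E u v \<and> v \<noteq> w then (if v < w then g else a) * \<Lambda> v else \<Lambda> v) w)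
     = msg a g (path_ratio a g \<mu> n E (\<sigma>(u := Suc w)) w)" if w: "w \<in> {w \<in> I - {u}. adj E u w}" for w
  proof -
    have "{v. v < n \<and> (\<sigma>(u := Suc w)) v = 0} = I - {u}" by (auto simp: I_def)
    moreover have "pinned_field a g \<mu> n E (\<sigma>(u := Suc w)) v =
      (if adj E u v \<and> v \<noteq> w then (if v < w then g else a) * \<Lambda> v else \<Lambda> v)" if v: "v \<in> I - {u}" for v
    proof -
      define W where "W = {w. w < n \<and> adj E v w \<and> \<sigma> w > 0}"
      have W: "finite W" "u \<notin> W" using u by (auto simp: W_def)
      have eq: "{w'. w' < n \<and> adj E v w' \<and> (\<sigma>(u := Suc w)) w' > 0} = (if adj E u v then insert u W else W)"
        using u adj_commute[of E u v] by (auto simp: W_def)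
      have *: "(\<Prod>w'\<in>W. pin a g ((\<sigma>(u := Suc w)) w') v) = (\<Prod>w'\<in>W. pin a g (\<sigma> w') v)"
        using W by (intro prod.cong) auto
      have "(\<Prod>w'\<in>insert u W. pin a g ((\<sigma>(u := Suc w)) w') v) = pin a g (Suc w) v * (\<Prod>w'\<in>W. pin a g (\<sigma> w') v)"
        by (simp only: prod.insert[OF W] * fun_upd_same)
      with * show ?thesis
        unfolding pinned_field_def eq \<Lambda>_def W_def[symmetric]
        by (cases "adj E u v"; simp only: if_True if_False) (auto simp: pin_def)
    qed
    ultimately show ?thesis
      unfolding path_ratio_def using w by (simp only:) (intro arg_cong[where f="msg a g"] ratio_field_cong, auto)
  qed
  moreover have "\<Lambda> v \<ge> 0" for v using nn by (simp add: \<Lambda>_def pinned_field_nonneg)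
  ultimately have "ratio a g I E \<Lambda> u =
     \<Lambda> u * (\<Prod>w\<in>{w \<in> I - {u}. adj E u w}. msg a g (path_ratio a g \<mu> n E (\<sigma>(u := Suc w)) w))"
    using ratio_recursion[OF I E nn(1,2), of \<Lambda>] by (simp only: cong: prod.cong)
  moreover have "(\<Prod>w\<in>{w. w < n \<and> adj E u w}.
      if \<sigma> w > 0 then pin a g (\<sigma> w) u else msg a g (path_ratio a g \<mu> n E (\<sigma>(u := Suc w)) w)) =
     (\<Prod>w\<in>{w. w < n \<and> adj E u w \<and> \<sigma> w > 0}. pin a g (\<sigma> w) u) *
     (\<Prod>w\<in>{w \<in> I - {u}. adj E u w}. msg a g (path_ratio a g \<mu> n E (\<sigma>(u := Suc w)) w))"
  proof -
    have "{w. w < n \<and> adj E u w} = {w. w < n \<and> adj E u w \<and> \<sigma> w > 0} \<union> {w \<in> I - {u}. adj E u w}"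
      using nl by (auto simp: I_def)
    moreover have "{w. w < n \<and> adj E u w \<and> \<sigma> w > 0} \<inter> {w \<in> I - {u}. adj E u w} = {}"
      by (auto simp: I_def)
    ultimately show ?thesis using I by (simp add: prod.union_disjoint I_def)
  qed
  ultimately show ?thesis
    by (simp add: path_ratio_def I_def[symmetric] \<Lambda>_def[symmetric]) (simp add: \<Lambda>_def pinned_field_def)
qed

section \<open>Pinning the vertices one by one\<close>

text \<open>The sum conditioned on spin 0 at all vertices below r, each of which leaves a factor
  \<open>a\<close> in the fields of its later neighbours.\<close>

definition tail_sum :: "'a::field \<Rightarrow> 'a \<Rightarrow> 'a \<Rightarrow> nat \<Rightarrow> (nat \<times> nat) set \<Rightarrow> nat \<Rightarrow> 'a" where
  "tail_sum a g \<mu> n E r = spin_sum a g {r..<n} (edges_on E {r..<n})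
     (\<lambda>v. \<mu> * a ^ card {w. w < r \<and> adj E v w})"

lemma tail_sum_next:
  assumes "r < n"
  shows "tail_sum a g \<mu> n E (Suc r) = spin_sum a g ({r..<n} - {r}) (edges_on E ({r..<n} - {r}))
    (\<lambda>v. if adj E r v then a * (\<mu> * a ^ card {w. w < r \<and> adj E v w}) else \<mu> * a ^ card {w. w < r \<and> adj E v w})"
proof -
  have s: "{r..<n} - {r} = {Suc r..<n}" using assms by auto
  have c: "card {w. w < Suc r \<and> adj E v w} = card {w. w < r \<and> adj E v w} + (if adj E r v then 1 else 0)" for v
  proof -
    have "{w. w < Suc r \<and> adj E v w} = (if adj E r v then insert r {w. w < r \<and> adj E v w} else {w. w < r \<and> adj E v w})"
      using adj_commute[of E r v] by (auto simp: less_Suc_eq)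
    then show ?thesis by simp
  qed
  show ?thesis unfolding tail_sum_def s
    by (intro spin_sum_field_cong) (auto simp: c)
qed

lemma tail_sum_end: "tail_sum a g \<mu> n E n = 1"
  by (simp add: tail_sum_def spin_sum_def edges_on_def)

lemma tail_sum_pos: "a \<ge> 0 \<Longrightarrow> g \<ge> 0 \<Longrightarrow> \<mu> \<ge> 0 \<Longrightarrow> tail_sum a g \<mu> n E r > (0::real)"
  unfolding tail_sum_def by (intro spin_sum_pos) auto

lemma tail_sum_path_ratio:
  fixes a g \<mu> :: real
  assumes E: "finite E" "\<And>p q. (p, q) \<in> E \<Longrightarrow> p < q" and nn: "a \<ge> 0" "g \<ge> 0" "\<mu> \<ge> 0" and r: "r < n"
  shows "tail_sum a g \<mu> n E r = tail_sum a g \<mu> n E (Suc r) *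
    (1 + path_ratio a g \<mu> n E (\<lambda>w. if w < r then 1 else 0) r)"
proof -
  define \<Lambda> where "\<Lambda> v = \<mu> * a ^ card {w. w < r \<and> adj E v w}" for v
  have t: "tail_sum a g \<mu> n E r = spin_sum a g {r..<n} (edges_on E {r..<n}) \<Lambda>"
    "tail_sum a g \<mu> n E (Suc r) = spin_sum a g ({r..<n} - {r}) (edges_on E ({r..<n} - {r}))
      (\<lambda>v. if adj E r v then a * \<Lambda> v else \<Lambda> v)"
    unfolding tail_sum_next[OF r] \<Lambda>_def by (rule tail_sum_def, rule refl)
  have "\<Lambda>(r := 1 * \<Lambda> r) = \<Lambda>" by simp
  then have "tail_sum a g \<mu> n E r = tail_sum a g \<mu> n E (Suc r) * (1 + 1 * ratio a g {r..<n} E \<Lambda> r)"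
    using spin_sum_scale_field[of "{r..<n}" r E a g \<Lambda> 1] E r tail_sum_pos[OF nn, of n E "Suc r"]
    unfolding t by simp
  moreover have "{v. v < n \<and> (if v < r then 1 else 0) = (0::nat)} = {r..<n}" by auto
  moreover have "pinned_field a g \<mu> n E (\<lambda>w. if w < r then 1 else 0) v = \<Lambda> v" if "v \<in> {r..<n}" for v
  proof -
    have "{w. w < n \<and> adj E v w \<and> (if w < r then 1 else 0) > (0::nat)} = {w. w < r \<and> adj E v w}"
      using r by auto
    \<comment> \<open>Here v \<ge> r > w, so v is not 0 and state 1 cannot mean that v is the
      successor of w; \<open>pin\<close> yields \<open>a\<close>.\<close>
    moreover have "(\<Prod>w\<in>{w. w < r \<and> adj E v w}. pin a g (if w < r then 1 else 0) v) = (\<Prod>w\<in>{w. w < r \<and> adj E v w}. a)"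
      using that by (intro prod.cong) (auto simp: pin_def)
    ultimately show ?thesis by (simp add: pinned_field_def \<Lambda>_def)
  qed
  ultimately show ?thesis
    using r ratio_field_cong[of "{r..<n}" "pinned_field a g \<mu> n E (\<lambda>w. if w < r then 1 else 0)" \<Lambda> r a g E]
    unfolding path_ratio_def by simp
qed

lemma tail_sum_prod:
  fixes a g \<mu> :: real
  assumes "a \<ge> 0" "g \<ge> 0" "\<mu> \<ge> 0"
  shows "tail_sum a g \<mu> n E 0 = (\<Prod>r<n. tail_sum a g \<mu> n E r / tail_sum a g \<mu> n E (Suc r))"
proof -
  have "tail_sum a g \<mu> n E 0 = (\<Prod>r<k. tail_sum a g \<mu> n E r / tail_sum a g \<mu> n E (Suc r)) * tail_sum a g \<mu> n E k" for k
    using tail_sum_pos[OF assms, of n E] by (induction k) (auto simp: less_imp_neq[symmetric])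
  from this[of n] show ?thesis by (simp add: tail_sum_end)
qed

text \<open>Pinning to spin 0 multiplies fields by z / \<beta>; this keeps them inside the unit
  disc.\<close>

lemma norm_less_of_square:
  fixes z :: complex
  assumes "\<beta> > 0" "\<gamma> > 0" "\<beta> * \<gamma> > 1" "(norm z)\<^sup>2 * \<gamma> < \<beta>"
  shows "norm (z / complex_of_real \<beta>) < 1"
proof -
  have "norm z < \<beta>"
  proof (rule ccontr)
    assume "\<not> norm z < \<beta>"
    then have "\<beta>\<^sup>2 * \<gamma> \<le> (norm z)\<^sup>2 * \<gamma>" using assms by (intro mult_right_mono power_mono) auto
    moreover have "\<beta> * 1 < \<beta> * (\<beta> * \<gamma>)" using assms by (intro mult_strict_left_mono) auto
    then have "\<beta> < \<beta>\<^sup>2 * \<gamma>" by (simp add: power2_eq_square)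
    ultimately show False using assms(4) by linarith
  qed
  then show ?thesis using assms by (simp add: norm_divide)
qed

lemma tail_sum_nonzero:
  fixes z :: complex
  assumes c: "\<beta> > 0" "\<gamma> > 0" "\<beta> * \<gamma> > 1" "(norm z)\<^sup>2 * \<gamma> < \<beta>" and \<mu>: "0 \<le> \<mu>" "\<mu> < 1"
    and E: "finite E" "\<And>p q. (p, q) \<in> E \<Longrightarrow> p < q"
  shows "tail_sum (z / of_real \<beta>) (of_real \<gamma> * z) (of_real \<mu>) n E r \<noteq> 0"
  unfolding tail_sum_def
proof (rule spin_sum_nonzero)
  show "1 + z / of_real \<beta> * x \<noteq> 0 \<and>
    norm (z / of_real \<beta> * (1 + of_real \<gamma> * z * x)) \<le> norm (1 + z / of_real \<beta> * x)" if "norm x < 1" for x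
    using lee_yang_condition[OF c that] .
  show "norm (of_real \<mu> * (z / of_real \<beta>) ^ card {w. w < r \<and> adj E v w}) < 1" for v
  proof -
    have "norm (z / of_real \<beta>) ^ card {w. w < r \<and> adj E v w} \<le> 1"
      using norm_less_of_square[OF c] by (intro power_le_one) auto
    then have "\<mu> * norm (z / of_real \<beta>) ^ card {w. w < r \<and> adj E v w} \<le> \<mu> * 1"
      using \<mu> by (intro mult_left_mono) auto
    then show ?thesis using \<mu> by (simp add: norm_mult norm_power)
  qed
qed (use E in \<open>auto simp: edges_on_def\<close>)

text \<open>As a function of the field t at r the numerator is D + t Y, and zero-freeness excludes a
  root in the open unit disc, so |Y| \<le> |D|. The quantity in question is \<Lambda> r (Y / D) with
  |\<Lambda> r| < 1, hence bounded uniformly in the graph.\<close>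

lemma tail_ratio_bound:
  fixes z :: complex
  assumes c: "\<beta> > 0" "\<gamma> > 0" "\<beta> * \<gamma> > 1" "(norm z)\<^sup>2 * \<gamma> < \<beta>" and \<mu>: "0 \<le> \<mu>" "\<mu> < 1"
    and E: "finite E" "\<And>p q. (p, q) \<in> E \<Longrightarrow> p < q" and r: "r < n"
  shows "norm (tail_sum (z / of_real \<beta>) (of_real \<gamma> * z) (of_real \<mu>) n E r /
    tail_sum (z / of_real \<beta>) (of_real \<gamma> * z) (of_real \<mu>) n E (Suc r) - 1) \<le> 1"
proof -
  define a g where "a = z / of_real \<beta>" and "g = of_real \<gamma> * z"
  define \<Lambda> :: "nat \<Rightarrow> complex" where "\<Lambda> v = of_real \<mu> * a ^ card {w. w < r \<and> adj E v w}" for v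
  have a1: "norm a < 1" using norm_less_of_square[OF c] by (simp add: a_def)
  have \<Lambda>: "norm (\<Lambda> v) < 1" for v
  proof -
    have "norm a ^ card {w. w < r \<and> adj E v w} \<le> 1" using a1 by (intro power_le_one) auto
    then have "\<mu> * norm a ^ card {w. w < r \<and> adj E v w} \<le> \<mu> * 1" using \<mu> by (intro mult_left_mono) auto
    then show ?thesis using \<mu> by (simp add: norm_mult norm_power \<Lambda>_def)
  qed
  define D where "D = tail_sum a g (of_real \<mu>) n E (Suc r)"
  define Y where "Y = a ^ card {w \<in> {r..<n} - {r}. adj E r w} *
    spin_sum a g ({r..<n} - {r}) (edges_on E ({r..<n} - {r})) (\<lambda>v. if adj E r v then g * \<Lambda> v else \<Lambda> v)"
  have split: "spin_sum a g {r..<n} (edges_on E {r..<n}) (\<Lambda>(r := t)) = D + t * Y" for t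
  proof -
    have *: "spin_sum a g ({r..<n} - {r}) (edges_on E ({r..<n} - {r})) (\<lambda>v. if adj E r v then k * (\<Lambda>(r := t)) v else (\<Lambda>(r := t)) v)
      = spin_sum a g ({r..<n} - {r}) (edges_on E ({r..<n} - {r})) (\<lambda>v. if adj E r v then k * \<Lambda> v else \<Lambda> v)" for k
      by (rule spin_sum_field_cong) auto
    have "D = spin_sum a g ({r..<n} - {r}) (edges_on E ({r..<n} - {r})) (\<lambda>v. if adj E r v then a * \<Lambda> v else \<Lambda> v)"
      unfolding D_def tail_sum_next[OF r] \<Lambda>_def ..
    then show ?thesis
      using r E by (subst spin_sum_split) (auto simp: * Y_def mult.assoc)
  qed
  have nz: "D + t * Y \<noteq> 0" if "norm t < 1" for t
    unfolding split[symmetric]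
  proof (rule spin_sum_nonzero)
    show "1 + a * x \<noteq> 0 \<and> norm (a * (1 + g * x)) \<le> norm (1 + a * x)" if "norm x < 1" for x
      unfolding a_def g_def using lee_yang_condition[OF c that] .
  qed (use E that \<Lambda> in \<open>auto simp: edges_on_def\<close>)
  have "norm Y \<le> norm D"
  proof (rule ccontr)
    assume "\<not> norm Y \<le> norm D"
    then have "Y \<noteq> 0" "norm (- D / Y) < 1" by (auto simp: norm_divide not_le divide_less_eq_1)
    then show False using nz[of "- D / Y"] by simp
  qed
  moreover have D0: "D \<noteq> 0" using nz[of 0] by simp
  moreover have "tail_sum a g (of_real \<mu>) n E r = D + \<Lambda> r * Y"
    using split[of "\<Lambda> r", unfolded fun_upd_triv] unfolding tail_sum_def \<Lambda>_def .
  then have "tail_sum a g (of_real \<mu>) n E r / D - 1 = \<Lambda> r * (Y / D)" using D0 by (simp add: field_simps)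
  moreover have "norm (\<Lambda> r) * norm (Y / D) \<le> 1 * 1"
    using \<Lambda>[of r] \<open>norm Y \<le> norm D\<close> D0 by (intro mult_mono) (auto simp: norm_divide divide_simps)
  ultimately show ?thesis unfolding a_def[symmetric] g_def[symmetric] D_def[symmetric] by (simp add: norm_mult norm_divide)
qed

lemma tail_sum_holomorphic:
  "(\<lambda>z. tail_sum (z / of_real \<beta>) (of_real \<gamma> * z) (of_real \<mu>) n E r) holomorphic_on A"
proof -
  have "(\<lambda>z. edge_wt (z / of_real \<beta>) (of_real \<gamma> * z) p q) holomorphic_on A" for p q
    by (cases p; cases q) (auto simp: edge_wt_def divide_inverse intro!: holomorphic_intros)
  then show ?thesis
    unfolding tail_sum_def spin_sum_def case_prod_unfold divide_inverse
    by (intro holomorphic_intros) (auto simp: divide_inverse)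
qed

lemma tail_sum_of_real:
  "tail_sum (complex_of_real a) (of_real g) (of_real \<mu>) n E r = of_real (tail_sum a g \<mu> n E r)"
proof -
  have "(\<lambda>v. complex_of_real \<mu> * of_real a ^ card {w. w < r \<and> adj E v w}) =
      (\<lambda>v. of_real (\<mu> * a ^ card {w. w < r \<and> adj E v w}))" by simp
  then show ?thesis unfolding tail_sum_def by (simp only: spin_sum_of_real)
qed

section \<open>Extrapolation\<close>

text \<open>The value at 1 of the j-th Lagrange basis polynomial for the nodes x 0, ..., x m: the
  weight of the j-th sample in the extrapolation to 1.\<close>

definition lagrange_at_one :: "nat \<Rightarrow> (nat \<Rightarrow> 'a::field) \<Rightarrow> nat \<Rightarrow> 'a" where
  "lagrange_at_one m x j = (\<Prod>i\<in>{..m} - {j}. (1 - x i) / (x j - x i))"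

text \<open>The left side is a polynomial in \<zeta> of degree at most m + 1, and it takes the
  constant value on the right at the m + 1 nodes and at 1, which are m + 2 points.\<close>

lemma lagrange_kernel_poly:
  fixes x :: "nat \<Rightarrow> 'a::{field_char_0}"
  assumes inj: "inj_on x {..m}" and x1: "\<And>i. i \<le> m \<Longrightarrow> x i \<noteq> 1"
  shows "(\<Prod>i\<le>m. \<zeta> - x i) - (\<zeta> - 1) * (\<Sum>j\<le>m. lagrange_at_one m x j * (\<Prod>i\<in>{..m} - {j}. \<zeta> - x i)) = (\<Prod>i\<le>m. 1 - x i)"
proof -
  define P where "P = (\<Prod>i\<le>m. [:- x i, 1:]) - [:- 1, 1:] *
    (\<Sum>j\<le>m. smult (lagrange_at_one m x j) (\<Prod>i\<in>{..m} - {j}. [:- x i, 1:]))"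
  define Q where "Q = [:\<Prod>i\<le>m. 1 - x i:]"
  have polyP: "poly P \<zeta> = (\<Prod>i\<le>m. \<zeta> - x i) - (\<zeta> - 1) * (\<Sum>j\<le>m. lagrange_at_one m x j * (\<Prod>i\<in>{..m} - {j}. \<zeta> - x i))" for \<zeta>
    by (simp add: P_def poly_prod poly_sum algebra_simps)
  have degprod: "degree (\<Prod>i\<in>A. [:- x i, 1:]) \<le> card A" if "finite A" for A
    using degree_prod_sum_le[of A "\<lambda>i. [:- x i, 1:]"] that by simp
  have "degree P \<le> m + 1"
    unfolding P_def
  proof (rule degree_diff_le)
    show "degree (\<Prod>i\<le>m. [:- x i, 1:]) \<le> m + 1" using degprod[of "{..m}"] by simp
    have "degree (\<Sum>j\<le>m. smult (lagrange_at_one m x j) (\<Prod>i\<in>{..m} - {j}. [:- x i, 1:])) \<le> m"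
    proof (rule degree_sum_le)
      fix j assume "j \<in> {..m}"
      then have "card ({..m} - {j}) = m" by simp
      then show "degree (smult (lagrange_at_one m x j) (\<Prod>i\<in>{..m} - {j}. [:- x i, 1:])) \<le> m"
        using degprod[of "{..m} - {j}"] by (intro order_trans[OF degree_smult_le]) simp
    qed simp
    then show "degree ([:- 1, 1:] * (\<Sum>j\<le>m. smult (lagrange_at_one m x j) (\<Prod>i\<in>{..m} - {j}. [:- x i, 1:]))) \<le> m + 1"
      by (intro order_trans[OF degree_mult_le]) simp
  qed
  moreover have "card (insert 1 (x ` {..m})) = m + 2"
    using x1 card_image[OF inj] by (subst card_insert_disjoint) auto
  moreover have "poly P y = poly Q y" if "y \<in> insert 1 (x ` {..m})" for y
    using that
  proof
    assume "y = 1"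
    then show ?thesis by (simp add: polyP Q_def)
  next
    assume "y \<in> x ` {..m}"
    then obtain k where k: "k \<le> m" "y = x k" by auto
    have "(\<Sum>j\<le>m. lagrange_at_one m x j * (\<Prod>i\<in>{..m} - {j}. x k - x i)) =
        (\<Sum>j\<in>{k}. lagrange_at_one m x j * (\<Prod>i\<in>{..m} - {j}. x k - x i))"
    proof (rule sum.mono_neutral_right)
      show "\<forall>j\<in>{..m} - {k}. lagrange_at_one m x j * (\<Prod>i\<in>{..m} - {j}. x k - x i) = 0"
        using k by fastforce
    qed (use k in auto)
    also have "\<dots> = (\<Prod>i\<in>{..m} - {k}. 1 - x i)"
      using k inj unfolding lagrange_at_one_def
      by (simp only: sum.insert sum.empty finite.emptyI empty_iff not_False_eq_True add_0_right prod.distrib[symmetric])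
        (intro prod.cong refl, auto dest: inj_onD)
    finally have *: "(\<Sum>j\<le>m. lagrange_at_one m x j * (\<Prod>i\<in>{..m} - {j}. x k - x i)) = (\<Prod>i\<in>{..m} - {k}. 1 - x i)" .
    have pz: "(\<Prod>i\<le>m. x k - x i) = 0" using k by (intro prod_zero) auto
    have pr: "(\<Prod>i\<le>m. 1 - x i) = (1 - x k) * (\<Prod>i\<in>{..m} - {k}. 1 - x i)"
      using k by (subst prod.remove[of _ k]) auto
    have "poly P y = 0 - (x k - 1) * (\<Prod>i\<in>{..m} - {k}. 1 - x i)" by (simp only: polyP k(2) * pz)
    then show ?thesis by (simp add: Q_def pr algebra_simps)
  qed
  moreover have "degree Q < m + 2" by (simp add: Q_def)
  ultimately have "P = Q" by (intro poly_eqI_degree[of "insert 1 (x ` {..m})"]) auto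
  then have "poly P \<zeta> = poly Q \<zeta>" by simp
  then show ?thesis by (simp add: polyP Q_def)
qed

text \<open>The kernel of the interpolation error in partial fractions: integrated against f, the
  left side gives f at 1 minus its extrapolation, while the right side is visibly small far from the
  nodes.\<close>

lemma lagrange_kernel:
  fixes x :: "nat \<Rightarrow> 'a::{field_char_0}"
  assumes "inj_on x {..m}" "\<And>i. i \<le> m \<Longrightarrow> x i \<noteq> 1" "\<zeta> \<noteq> 1" "\<And>i. i \<le> m \<Longrightarrow> \<zeta> \<noteq> x i"
  shows "1 / (\<zeta> - 1) - (\<Sum>j\<le>m. lagrange_at_one m x j / (\<zeta> - x j)) =
    (\<Prod>i\<le>m. 1 - x i) / ((\<zeta> - 1) * (\<Prod>i\<le>m. \<zeta> - x i))"
proof -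
  define W where "W = (\<Prod>i\<le>m. \<zeta> - x i)"
  have W: "W \<noteq> 0" using assms by (simp add: W_def)
  have "(\<Sum>j\<le>m. lagrange_at_one m x j * (\<Prod>i\<in>{..m} - {j}. \<zeta> - x i)) = W * (\<Sum>j\<le>m. lagrange_at_one m x j / (\<zeta> - x j))"
    unfolding sum_distrib_left
  proof (intro sum.cong refl)
    fix j assume j: "j \<in> {..m}"
    have "W = (\<zeta> - x j) * (\<Prod>i\<in>{..m} - {j}. \<zeta> - x i)"
      using j unfolding W_def by (subst prod.remove[of _ j]) auto
    then show "lagrange_at_one m x j * (\<Prod>i\<in>{..m} - {j}. \<zeta> - x i) = W * (lagrange_at_one m x j / (\<zeta> - x j))"
      using assms j by simp
  qed
  then have "W - (\<zeta> - 1) * (W * (\<Sum>j\<le>m. lagrange_at_one m x j / (\<zeta> - x j))) = (\<Prod>i\<le>m. 1 - x i)"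
    using lagrange_kernel_poly[OF assms(1,2), of \<zeta>] by (simp add: W_def)
  then have *: "(\<Prod>i\<le>m. 1 - x i) = W * (1 - (\<zeta> - 1) * (\<Sum>j\<le>m. lagrange_at_one m x j / (\<zeta> - x j)))"
    by (simp add: algebra_simps)
  show ?thesis unfolding * W_def[symmetric] using W assms(3) by (simp add: divide_simps)
qed

text \<open>Hermite's error formula: by Cauchy's formula on the circle of radius R, the error is the
  integral of f times the kernel of \<open>lagrange_kernel\<close>, up to the constant 2 pi i. There
  |z - 1| \<ge> R - 1 and |z - x i| \<ge> R - \<eta>, while |1 - x i| \<le> 1; since R - \<eta> > 1,
  the error decays geometrically in m.\<close>

lemma lagrange_extrapolation:
  fixes f :: "complex \<Rightarrow> complex" and x :: "nat \<Rightarrow> real"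
  assumes f: "f holomorphic_on cball 0 R" "\<And>z. norm z \<le> R \<Longrightarrow> norm (f z) \<le> 1"
    and R: "R > 1 + \<eta>" and \<eta>: "\<eta> < 1"
    and x: "inj_on x {..m}" "\<And>i. i \<le> m \<Longrightarrow> 0 \<le> x i \<and> x i \<le> \<eta>"
  shows "norm (f 1 - (\<Sum>j\<le>m. of_real (lagrange_at_one m x j) * f (of_real (x j)))) \<le>
    R / ((R - 1) * (R - \<eta>) ^ Suc m)"
proof -
  define l where "l j = complex_of_real (lagrange_at_one m x j)" for j
  have l: "l j = lagrange_at_one m (\<lambda>i. complex_of_real (x i)) j" for j
    by (simp add: l_def lagrange_at_one_def)
  define B where "B = 1 / ((R - 1) * (R - \<eta>) ^ Suc m)"
  have "0 \<le> \<eta>" using x(2)[of 0] by auto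
  then have R1: "R > 1" "R > 0" "R - \<eta> > 0" using R by auto
  have B: "B \<ge> 0" using R1 by (simp add: B_def)
  define K where "K z = f z / (z - 1) - (\<Sum>j\<le>m. l j * (f z / (z - of_real (x j))))" for z
  have ci: "((\<lambda>z. f z / (z - w)) has_contour_integral (2 * of_real pi * \<i> * f w)) (circlepath 0 R)" if "norm w < R" for w
    using Cauchy_integral_circlepath_simple[OF f(1), of w] that by simp
  have xR: "norm (complex_of_real (x j)) < R" if "j \<le> m" for j using x(2)[OF that] R1 by auto
  have int: "(K has_contour_integral (2 * of_real pi * \<i> * f 1 - (\<Sum>j\<le>m. l j * (2 * of_real pi * \<i> * f (of_real (x j)))))) (circlepath 0 R)"
    unfolding K_def using R1 xR
    by (intro has_contour_integral_diff has_contour_integral_sum has_contour_integral_lmul ci) auto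
  have bound: "norm (K z) \<le> B" if z: "norm (z - 0) = R" for z
  proof -
    have zx: "z \<noteq> 1" "z \<noteq> of_real (x i)" if "i \<le> m" for i using z R1 xR[OF that] by auto
    have "K z = f z * (1 / (z - 1) - (\<Sum>j\<le>m. l j / (z - of_real (x j))))"
      by (simp add: K_def sum_distrib_left algebra_simps)
    also have "1 / (z - 1) - (\<Sum>j\<le>m. l j / (z - of_real (x j))) =
       (\<Prod>i\<le>m. 1 - of_real (x i)) / ((z - 1) * (\<Prod>i\<le>m. z - of_real (x i)))"
      unfolding l
    proof (rule lagrange_kernel)
      show "inj_on (\<lambda>i. complex_of_real (x i)) {..m}" using x(1) by (auto simp: inj_on_def)
      show "complex_of_real (x i) \<noteq> 1" if "i \<le> m" for i using x(2)[OF that] \<eta> by auto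
    qed (use zx[of 0] zx(2) in auto)
    finally have "norm (K z) = norm (f z) * (norm (\<Prod>i\<le>m. 1 - complex_of_real (x i)) / (norm (z - 1) * norm (\<Prod>i\<le>m. z - of_real (x i))))"
      by (simp add: norm_mult norm_divide)
    also have "\<dots> \<le> 1 * (1 / ((R - 1) * (R - \<eta>) ^ Suc m))"
    proof (intro mult_mono frac_le)
      show "norm (\<Prod>i\<le>m. 1 - complex_of_real (x i)) \<le> 1"
      proof -
        have "norm (1 - complex_of_real (x i)) \<le> 1" if "i \<le> m" for i
        proof -
          have "1 - complex_of_real (x i) = of_real (1 - x i)" by simp
          then show ?thesis using x(2)[OF that] \<eta> by (simp only: norm_of_real) auto
        qed
        then show ?thesis unfolding prod_norm[symmetric] by (intro prod_le_1) auto
      qed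
      show "R - 1 \<le> norm (z - 1)" using norm_triangle_ineq2[of z 1] z by simp
      have "(\<Prod>i\<le>m. R - \<eta>) \<le> (\<Prod>i\<le>m. norm (z - of_real (x i)))"
      proof (rule prod_mono)
        fix i assume "i \<in> {..m}"
        then show "0 \<le> R - \<eta> \<and> R - \<eta> \<le> norm (z - of_real (x i))"
          using norm_triangle_ineq2[of z "of_real (x i)"] z x(2)[of i] R1 by auto
      qed
      then show "(R - \<eta>) ^ Suc m \<le> norm (\<Prod>i\<le>m. z - of_real (x i))" by (simp add: prod_norm)
      show "norm (f z) \<le> 1" using f(2) z by auto
    qed (use R1 in auto)
    finally show ?thesis by (simp add: B_def)
  qed
  have "norm (2 * of_real pi * \<i> * f 1 - (\<Sum>j\<le>m. l j * (2 * of_real pi * \<i> * f (of_real (x j))))) \<le> B * (2 * pi * R)"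
    by (rule has_contour_integral_bound_circlepath[OF int B R1(2) bound])
  also have "2 * of_real pi * \<i> * f 1 - (\<Sum>j\<le>m. l j * (2 * of_real pi * \<i> * f (of_real (x j)))) =
      (2 * of_real pi * \<i>) * (f 1 - (\<Sum>j\<le>m. l j * f (of_real (x j))))"
    by (simp add: sum_distrib_left algebra_simps)
  finally have "2 * pi * norm (f 1 - (\<Sum>j\<le>m. l j * f (of_real (x j)))) \<le> B * (2 * pi * R)"
    by (simp only: norm_mult) simp
  then have "norm (f 1 - (\<Sum>j\<le>m. l j * f (of_real (x j)))) \<le> B * R" by simp
  then show ?thesis by (simp add: B_def l_def)
qed

text \<open>A single term of the exponential series is at most its sum.\<close>

lemma power_le_fact_exp: "(x::real) \<ge> 0 \<Longrightarrow> x ^ m \<le> fact m * exp x"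
proof -
  assume "x \<ge> 0"
  then have "(\<Sum>n\<in>{m}. x ^ n /\<^sub>R fact n) \<le> exp x"
    unfolding exp_def using summable_exp_generic[of x] by (intro sum_le_suminf) auto
  then have "x ^ m / fact m \<le> exp x" by (simp add: divide_inverse mult.commute)
  then show "x ^ m \<le> fact m * exp x" by (simp add: pos_divide_le_eq mult.commute)
qed

text \<open>The amplification of errors at the nodes. Scaling by N turns the j-th weight into the
  product of the N - i over i \<noteq> j, divided by j! (m - j)!. With N^m \<le> m! e^N the sum is
  at most 2^m e^N, and e < 4.\<close>

lemma lagrange_equidistant_sum:
  fixes N :: nat
  assumes "m < N"
  shows "(\<Sum>j\<le>m. \<bar>lagrange_at_one m (\<lambda>i. real i / real N) j\<bar>) \<le> 2 ^ (m + 2 * N)"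
proof -
  have eq: "\<bar>lagrange_at_one m (\<lambda>i. real i / real N) j\<bar> \<le> real (m choose j) * exp (real N)" if j: "j \<le> m" for j
  proof -
    have "\<bar>lagrange_at_one m (\<lambda>i. real i / real N) j\<bar> = (\<Prod>i\<in>{..m} - {j}. real (N - i) / \<bar>real j - real i\<bar>)"
      unfolding lagrange_at_one_def abs_prod using assms
      by (intro prod.cong refl) (auto simp: abs_divide divide_simps of_nat_diff)
    also have "\<dots> = (\<Prod>i\<in>{..m} - {j}. real (N - i)) / (\<Prod>i\<in>{..m} - {j}. \<bar>real j - real i\<bar>)"
      by (rule prod_dividef)
    also have "(\<Prod>i\<in>{..m} - {j}. \<bar>real j - real i\<bar>) = fact j * fact (m - j)"
    proof -
      have "{..m} - {j} = {..<j} \<union> {j<..m}" using j by auto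
      then have "(\<Prod>i\<in>{..m} - {j}. \<bar>real j - real i\<bar>) = (\<Prod>i<j. \<bar>real j - real i\<bar>) * (\<Prod>i\<in>{j<..m}. \<bar>real j - real i\<bar>)"
        by (simp add: prod.union_disjoint Int_def)
      also have "(\<Prod>i<j. \<bar>real j - real i\<bar>) = (\<Prod>i\<in>{1..j}. real i)"
        by (rule prod.reindex_bij_witness[of _ "\<lambda>i. j - i" "\<lambda>i. j - i"]) (auto simp: of_nat_diff)
      also have "(\<Prod>i\<in>{j<..m}. \<bar>real j - real i\<bar>) = (\<Prod>i\<in>{1..m - j}. real i)"
        using j by (intro prod.reindex_bij_witness[of _ "\<lambda>i. i + j" "\<lambda>i. i - j"]) (auto simp: of_nat_diff)
      finally show ?thesis by (simp add: fact_prod)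
    qed
    also have "(\<Prod>i\<in>{..m} - {j}. real (N - i)) \<le> (\<Prod>i\<in>{..m} - {j}. real N)"
      by (intro prod_mono) auto
    also have "\<dots> = real N ^ m" using j by simp
    also have "\<dots> \<le> fact m * exp (real N)" by (rule power_le_fact_exp) simp
    also have "fact m * exp (real N) / (fact j * fact (m - j)) = real (m choose j) * exp (real N)"
      using j by (simp add: binomial_fact)
    finally show ?thesis by (simp add: divide_right_mono)
  qed
  have "(\<Sum>j\<le>m. \<bar>lagrange_at_one m (\<lambda>i. real i / real N) j\<bar>) \<le> (\<Sum>j\<le>m. real (m choose j) * exp (real N))"
    using eq by (intro sum_mono) auto
  also have "\<dots> = real (\<Sum>j\<le>m. m choose j) * exp (real N)" by (simp add: sum_distrib_right)
  also have "\<dots> = 2 ^ m * exp (real N)" by (simp add: choose_row_sum)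
  also have "\<dots> \<le> 2 ^ m * 4 ^ N"
  proof (rule mult_left_mono)
    have "exp (real N) = exp 1 ^ N" by (simp add: exp_of_nat_mult[symmetric])
    also have "\<dots> \<le> 4 ^ N" using exp_le by (intro power_mono) auto
    finally show "exp (real N) \<le> 4 ^ N" .
  qed simp
  also have "\<dots> = 2 ^ (m + 2 * N)" by (simp add: power_add power_mult)
  finally show ?thesis .
qed

section \<open>Structured programs\<close>

type_synonym store = "(reg \<Rightarrow> int) \<times> (nat \<Rightarrow> int)"

datatype com = Skip | Ins instr | Seq com com (infixr ";;" 60) | IfPos reg com com | WhilePos reg com

text \<open>Register 2 holds a positive number whenever an unconditional jump is executed.\<close>

primrec clen :: "com \<Rightarrow> nat" where
  "clen Skip = 0"
| "clen (Ins i) = 1"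
| "clen (c1 ;; c2) = clen c1 + clen c2"
| "clen (IfPos r c1 c2) = clen c1 + clen c2 + 2"
| "clen (WhilePos r c) = clen c + 2"

text \<open>\<open>a\<close> is the address at which the code is placed, as jump targets are
  absolute. The else branch stands before the then branch, and the test of a loop stands behind its
  body and is entered by a jump.\<close>

primrec compile :: "nat \<Rightarrow> com \<Rightarrow> program" where
  "compile a Skip = []"
| "compile a (Ins i) = [i]"
| "compile a (c1 ;; c2) = compile a c1 @ compile (a + clen c1) c2"
| "compile a (IfPos r c1 c2) = [JumpPos r (a + clen c2 + 2)] @ compile (a + 1) c2 @
     [JumpPos 2 (a + clen c1 + clen c2 + 2)] @ compile (a + clen c2 + 2) c1"
| "compile a (WhilePos r c) = [JumpPos 2 (a + clen c + 1)] @ compile (a + 1) c @ [JumpPos r (a + 1)]"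

lemma length_compile: "length (compile a c) = clen c"
  by (induction c arbitrary: a) auto

fun is_jump :: "instr \<Rightarrow> bool" where
  "is_jump (JumpPos r l) = True"
| "is_jump _ = False"

text \<open>Jumps aside, the program counter does not influence what an instruction does to
  registers and memory, so 0 is as good as any value.\<close>

definition effect :: "(real_input \<Rightarrow> real) \<Rightarrow> instr \<Rightarrow> store \<Rightarrow> store" where
  "effect x i s = (let s' = exec_instr x i \<lparr>pc = 0, regs = fst s, mem = snd s\<rparr> in (regs s', mem s'))"

definition cost :: "instr \<Rightarrow> store \<Rightarrow> nat" where
  "cost i s = instr_cost i \<lparr>pc = 0, regs = fst s, mem = snd s\<rparr>"

text \<open>The third argument is fuel that must not run out, which gives termination; the last,
  failing test uses one unit itself. \<open>Suc t\<close> adds the test that precedes the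
  body.\<close>

primrec wloop :: "reg \<Rightarrow> ((nat \<Rightarrow> store \<Rightarrow> bool) \<Rightarrow> store \<Rightarrow> bool) \<Rightarrow> nat \<Rightarrow> (nat \<Rightarrow> store \<Rightarrow> bool) \<Rightarrow> store \<Rightarrow> bool" where
  "wloop r B 0 Q s = False"
| "wloop r B (Suc k) Q s =
     (if fst s r > 0 then B (\<lambda>t s'. wloop r B k (\<lambda>t'. Q (Suc t + t')) s') s else Q 1 s)"

text \<open>The weakest precondition for termination in a state and after a number of instructions that
  satisfy \<open>Q\<close>, such that every executed instruction costs at most \<open>W\<close>.\<close>

primrec wp :: "(real_input \<Rightarrow> real) \<Rightarrow> nat \<Rightarrow> com \<Rightarrow> (nat \<Rightarrow> store \<Rightarrow> bool) \<Rightarrow> store \<Rightarrow> bool" where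
  "wp x W Skip Q s = Q 0 s"
| "wp x W (Ins i) Q s = (\<not> is_jump i \<and> cost i s \<le> W \<and> Q 1 (effect x i s))"
| "wp x W (c1 ;; c2) Q s = wp x W c1 (\<lambda>t s'. wp x W c2 (\<lambda>t'. Q (t + t')) s') s"
| "wp x W (IfPos r c1 c2) Q s = (if fst s r > 0 then wp x W c1 (\<lambda>t. Q (t + 1)) s
     else wp x W c2 (\<lambda>t s'. fst s' 2 > 0 \<and> Q (t + 2) s') s)"
| "wp x W (WhilePos r c) Q s = (fst s 2 > 0 \<and> (\<exists>k. wloop r (wp x W c) k (\<lambda>t. Q (t + 1)) s))"

text \<open>Stated for an abstract monotone body, because it is needed inside the induction that
  shows \<open>wp\<close> to be monotone.\<close>

lemma wloop_mono:
  assumes "\<And>Q Q' s. (\<And>t s. Q t s \<Longrightarrow> Q' t s) \<Longrightarrow> B Q s \<Longrightarrow> B Q' s"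
    and "\<And>t s. Q t s \<Longrightarrow> Q' t s" "wloop r B k Q s"
  shows "wloop r B k Q' s"
  using assms(2,3)
proof (induction k arbitrary: Q Q' s)
  case (Suc k)
  show ?case
  proof (cases "fst s r > 0")
    case True
    then have "B (\<lambda>t s'. wloop r B k (\<lambda>t'. Q (Suc t + t')) s') s" using Suc.prems by simp
    then have "B (\<lambda>t s'. wloop r B k (\<lambda>t'. Q' (Suc t + t')) s') s"
    proof (rule assms(1)[rotated])
      fix t s' assume "wloop r B k (\<lambda>t'. Q (Suc t + t')) s'"
      then show "wloop r B k (\<lambda>t'. Q' (Suc t + t')) s'" by (rule Suc.IH[rotated]) (rule Suc.prems(1))
    qed
    then show ?thesis using True by simp
  qed (use Suc in simp)
qed simp

lemma wp_mono:
  assumes "wp x W c Q s" "\<And>t s. Q t s \<Longrightarrow> Q' t s"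
  shows "wp x W c Q' s"
  using assms
proof (induction c arbitrary: Q Q' s)
  case (Seq c1 c2)
  have "wp x W c1 (\<lambda>t s'. wp x W c2 (\<lambda>t'. Q (t + t')) s') s" using Seq.prems by simp
  then have "wp x W c1 (\<lambda>t s'. wp x W c2 (\<lambda>t'. Q' (t + t')) s') s"
  proof (rule Seq.IH(1))
    fix t s' assume "wp x W c2 (\<lambda>t'. Q (t + t')) s'"
    then show "wp x W c2 (\<lambda>t'. Q' (t + t')) s'" by (rule Seq.IH(2)) (rule Seq.prems(2))
  qed
  then show ?case by simp
next
  case (IfPos r c1 c2)
  show ?case
  proof (cases "fst s r > 0")
    case True
    then have "wp x W c1 (\<lambda>t. Q (t + 1)) s" using IfPos.prems by simp
    then have "wp x W c1 (\<lambda>t. Q' (t + 1)) s" by (rule IfPos.IH(1)) (rule IfPos.prems(2))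
    then show ?thesis using True by simp
  next
    case False
    then have "wp x W c2 (\<lambda>t s'. fst s' 2 > 0 \<and> Q (t + 2) s') s" using IfPos.prems by simp
    then have "wp x W c2 (\<lambda>t s'. fst s' 2 > 0 \<and> Q' (t + 2) s') s"
      by (rule IfPos.IH(2)) (auto intro: IfPos.prems(2))
    then show ?thesis using False by simp
  qed
next
  case (WhilePos r c)
  then obtain k where "fst s 2 > 0" "wloop r (wp x W c) k (\<lambda>t. Q (t + 1)) s" by auto
  moreover from this(2) have "wloop r (wp x W c) k (\<lambda>t. Q' (t + 1)) s"
    by (rule wloop_mono[rotated 2]) (auto intro: WhilePos.IH WhilePos.prems(2))
  ultimately show ?case by auto
qed auto

lemma wloop_wp_mono:
  assumes "wloop r (wp x W c) k Q s" "\<And>t s. Q t s \<Longrightarrow> Q' t s"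
  shows "wloop r (wp x W c) k Q' s"
proof (rule wloop_mono[OF _ assms(2,1)])
  fix Q Q' s assume "\<And>t s. Q t s \<Longrightarrow> Q' t s" "wp x W c Q s"
  then show "wp x W c Q' s" using wp_mono by blast
qed

lemma wloop_witness:
  assumes B: "\<And>Q s. B Q s \<Longrightarrow> \<exists>t s'. Q t s' \<and> B (\<lambda>t' s''. t' = t \<and> s'' = s') s"
    and mono: "\<And>Q Q' s. (\<And>t s. Q t s \<Longrightarrow> Q' t s) \<Longrightarrow> B Q s \<Longrightarrow> B Q' s"
    and "wloop r B k Q s"
  shows "\<exists>t s'. Q t s' \<and> wloop r B k (\<lambda>t' s''. t' = t \<and> s'' = s') s"
  using assms(3)
proof (induction k arbitrary: Q s)
  case (Suc k)
  show ?case
  proof (cases "fst s r > 0")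
    case True
    then have "B (\<lambda>t s'. wloop r B k (\<lambda>t'. Q (Suc t + t')) s') s" using Suc.prems by simp
    from B[OF this] obtain t1 s1 where 1: "wloop r B k (\<lambda>t'. Q (Suc t1 + t')) s1" "B (\<lambda>t' s''. t' = t1 \<and> s'' = s1) s"
      by auto
    from Suc.IH[OF 1(1)] obtain t2 s2 where 2: "Q (Suc t1 + t2) s2" "wloop r B k (\<lambda>t' s''. t' = t2 \<and> s'' = s2) s1"
      by auto
    have "wloop r B k (\<lambda>t' s''. Suc t1 + t' = Suc t1 + t2 \<and> s'' = s2) s1"
      by (rule wloop_mono[OF mono _ 2(2)]) auto
    then have "B (\<lambda>t s'. wloop r B k (\<lambda>t' s''. Suc t + t' = Suc t1 + t2 \<and> s'' = s2) s') s"
      by (intro mono[OF _ 1(2)]) auto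
    then show ?thesis using 2(1) True by (intro exI[of _ "Suc t1 + t2"] exI[of _ s2]) simp
  qed (use Suc.prems in \<open>auto simp del: split_paired_Ex\<close>)
qed simp

text \<open>Execution is deterministic, so a precondition determines one final state and one
  instruction count. Naming them turns a postcondition into facts about a fixed state, from which
  runs can be chained.\<close>

lemma wp_witness:
  assumes "wp x W c Q s"
  shows "\<exists>t s'. Q t s' \<and> wp x W c (\<lambda>t' s''. t' = t \<and> s'' = s') s"
  using assms
proof (induction c arbitrary: Q s)
  case (Seq c1 c2)
  then have "wp x W c1 (\<lambda>t s'. wp x W c2 (\<lambda>t'. Q (t + t')) s') s" by simp
  from Seq.IH(1)[OF this] obtain t1 s1 where 1: "wp x W c2 (\<lambda>t'. Q (t1 + t')) s1" "wp x W c1 (\<lambda>t' s''. t' = t1 \<and> s'' = s1) s"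
    by auto
  from Seq.IH(2)[OF 1(1)] obtain t2 s2 where 2: "Q (t1 + t2) s2" "wp x W c2 (\<lambda>t' s''. t' = t2 \<and> s'' = s2) s1"
    by auto
  have "wp x W c2 (\<lambda>t' s''. t1 + t' = t1 + t2 \<and> s'' = s2) s1" by (rule wp_mono[OF 2(2)]) auto
  then have "wp x W c1 (\<lambda>t s'. wp x W c2 (\<lambda>t' s''. t + t' = t1 + t2 \<and> s'' = s2) s') s"
    by (intro wp_mono[OF 1(2)]) auto
  then show ?case using 2(1) by (intro exI[of _ "t1 + t2"] exI[of _ s2]) simp
next
  case (IfPos r c1 c2)
  show ?case
  proof (cases "fst s r > 0")
    case True
    then have "wp x W c1 (\<lambda>t. Q (t + 1)) s" using IfPos.prems by simp
    from IfPos.IH(1)[OF this] obtain t1 s1 where 1: "Q (t1 + 1) s1" "wp x W c1 (\<lambda>t' s''. t' = t1 \<and> s'' = s1) s" by auto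
    have "wp x W c1 (\<lambda>t' s''. t' + 1 = t1 + 1 \<and> s'' = s1) s" by (rule wp_mono[OF 1(2)]) auto
    then show ?thesis using True 1(1) by (intro exI[of _ "t1 + 1"] exI[of _ s1]) simp
  next
    case False
    then have "wp x W c2 (\<lambda>t s'. fst s' 2 > 0 \<and> Q (t + 2) s') s" using IfPos.prems by simp
    from IfPos.IH(2)[OF this] obtain t1 s1 where 1: "Q (t1 + 2) s1" "fst s1 2 > 0" "wp x W c2 (\<lambda>t' s''. t' = t1 \<and> s'' = s1) s" by auto
    have "wp x W c2 (\<lambda>t' s''. fst s'' 2 > 0 \<and> t' + 2 = t1 + 2 \<and> s'' = s1) s" by (rule wp_mono[OF 1(3)]) (use 1(2) in auto)
    then show ?thesis using False 1(1) by (intro exI[of _ "t1 + 2"] exI[of _ s1]) simp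
  qed
next
  case (WhilePos r c)
  then obtain k where k: "fst s 2 > 0" "wloop r (wp x W c) k (\<lambda>t. Q (t + 1)) s" by auto
  have "\<exists>t s'. Q (t + 1) s' \<and> wloop r (wp x W c) k (\<lambda>t' s''. t' = t \<and> s'' = s') s"
    by (rule wloop_witness[OF WhilePos.IH wp_mono k(2)])
  then obtain t1 s1 where 1: "Q (t1 + 1) s1" "wloop r (wp x W c) k (\<lambda>t' s''. t' = t1 \<and> s'' = s1) s" by auto
  have "wloop r (wp x W c) k (\<lambda>t' s''. t' + 1 = t1 + 1 \<and> s'' = s1) s"
    by (rule wloop_wp_mono[OF 1(2)]) auto
  then show ?case using 1(1) k(1) by (intro exI[of _ "t1 + 1"] exI[of _ s1]) auto
qed (auto simp del: split_paired_Ex)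

subsection \<open>Soundness of the compiler\<close>

text \<open>\<open>t\<close> enters only through the cost \<open>W * t\<close> that it allows; the
  number k of machine steps is left open.\<close>

definition reaches :: "(real_input \<Rightarrow> real) \<Rightarrow> program \<Rightarrow> nat \<Rightarrow> config \<Rightarrow> nat \<Rightarrow> config \<Rightarrow> bool" where
  "reaches x P W s t s' \<longleftrightarrow> (\<exists>k. run x P s k = s' \<and> run_time x P s k \<le> W * t)"

lemma run_add: "run x P s (k + l) = run x P (run x P s k) l"
  by (simp add: run_def add.commute[of k l] funpow_add)

lemma run_time_add: "run_time x P s (k + l) = run_time x P s k + run_time x P (run x P s k) l"
  by (induction l) (simp_all add: run_time_def run_add add.assoc[symmetric])

lemma reaches_refl: "reaches x P W s 0 s"
  by (auto simp: reaches_def run_def run_time_def intro!: exI[of _ 0])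

lemma reaches_trans:
  assumes "reaches x P W s t s'" "reaches x P W s' t' s''"
  shows "reaches x P W s (t + t') s''"
proof -
  obtain k l where "run x P s k = s'" "run_time x P s k \<le> W * t" "run x P s' l = s''" "run_time x P s' l \<le> W * t'"
    using assms by (auto simp: reaches_def)
  then show ?thesis
    unfolding reaches_def by (intro exI[of _ "k + l"]) (simp add: run_add run_time_add distrib_left)
qed

lemma reaches_instr:
  assumes "a < length P" "P ! a = i" "instr_cost i \<lparr>pc = a, regs = R, mem = m\<rparr> \<le> W"
  shows "reaches x P W \<lparr>pc = a, regs = R, mem = m\<rparr> 1 (exec_instr x i \<lparr>pc = a, regs = R, mem = m\<rparr>)"
  unfolding reaches_def using assms
  by (intro exI[of _ 1]) (simp add: run_def run_time_def step_def step_cost_def halted_def)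

lemma reaches_jump:
  assumes "P = p @ JumpPos r l # q" "W \<ge> 1"
  shows "reaches x P W \<lparr>pc = length p, regs = R, mem = m\<rparr> 1 \<lparr>pc = (if R r > 0 then l else length p + 1), regs = R, mem = m\<rparr>"
  using reaches_instr[of "length p" P "JumpPos r l" R m W x] assms by (cases "R r > 0") simp_all

text \<open>Quantified over the surrounding code, since the parts of a branch or a loop run inside a
  larger program.\<close>

definition correct :: "(real_input \<Rightarrow> real) \<Rightarrow> nat \<Rightarrow> com \<Rightarrow> bool" where
  "correct x W c \<longleftrightarrow> (\<forall>P p q Q R m. P = p @ compile (length p) c @ q \<longrightarrow> wp x W c Q (R, m) \<longrightarrow>
     (\<exists>t R' m'. Q t (R', m') \<and> reaches x P W \<lparr>pc = length p, regs = R, mem = m\<rparr> t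
        \<lparr>pc = length p + clen c, regs = R', mem = m'\<rparr>))"

lemma correctD:
  assumes "correct x W c" "P = p @ compile a c @ q" "length p = a" "wp x W c Q (R, m)"
  shows "\<exists>t R' m'. Q t (R', m') \<and>
    reaches x P W \<lparr>pc = a, regs = R, mem = m\<rparr> t \<lparr>pc = a + clen c, regs = R', mem = m'\<rparr>"
  using assms unfolding correct_def by metis

text \<open>Stated from the test behind the body, the point reached both on entering the loop and
  after every iteration; the induction is on the fuel.\<close>

lemma correct_while:
  assumes c: "correct x W c" and W: "W \<ge> 1"
    and P: "P = p @ compile (length p) (WhilePos r c) @ q" and l: "wloop r (wp x W c) k Q (R, m)"
  shows "\<exists>t R' m'. Q t (R', m') \<and> reaches x P W \<lparr>pc = length p + clen c + 1, regs = R, mem = m\<rparr> t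
        \<lparr>pc = length p + clen (WhilePos r c), regs = R', mem = m'\<rparr>"
  using l
proof (induction k arbitrary: Q R m)
  case (Suc k)
  let ?a = "length p"
  have P1: "P = (p @ [JumpPos 2 (?a + clen c + 1)] @ compile (?a + 1) c) @ JumpPos r (?a + 1) # q"
    using P by simp
  have j: "reaches x P W \<lparr>pc = ?a + clen c + 1, regs = R, mem = m\<rparr> 1
      \<lparr>pc = (if R r > 0 then ?a + 1 else ?a + clen c + 2), regs = R, mem = m\<rparr>"
    using reaches_jump[OF P1 W, of x R m]
    by (cases "R r > 0") (simp_all add: length_compile add.commute add.left_commute)
  show ?case
  proof (cases "R r > 0")
    case True
    then have w: "wp x W c (\<lambda>t s'. wloop r (wp x W c) k (\<lambda>t'. Q (Suc t + t')) s') (R, m)" using Suc.prems by simp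
    have P3: "P = (p @ [JumpPos 2 (?a + clen c + 1)]) @ compile (?a + 1) c @ (JumpPos r (?a + 1) # q)" using P by simp
    from correctD[OF c P3 _ w] obtain t1 R1 m1 where 1: "wloop r (wp x W c) k (\<lambda>t'. Q (Suc t1 + t')) (R1, m1)"
      "reaches x P W \<lparr>pc = ?a + 1, regs = R, mem = m\<rparr> t1 \<lparr>pc = ?a + 1 + clen c, regs = R1, mem = m1\<rparr>"
      by auto
    from Suc.IH[OF 1(1)] obtain t2 R2 m2 where 2: "Q (Suc t1 + t2) (R2, m2)"
      "reaches x P W \<lparr>pc = ?a + clen c + 1, regs = R1, mem = m1\<rparr> t2 \<lparr>pc = ?a + clen (WhilePos r c), regs = R2, mem = m2\<rparr>"
      by auto
    have "reaches x P W \<lparr>pc = ?a + clen c + 1, regs = R, mem = m\<rparr> (1 + t1 + t2) \<lparr>pc = ?a + clen (WhilePos r c), regs = R2, mem = m2\<rparr>"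
      using reaches_trans[OF reaches_trans[OF j] 2(2)] 1(2) True by (simp add: add.commute add.left_commute)
    then show ?thesis using 2(1) by (intro exI[of _ "Suc t1 + t2"]) auto
  next
    case False
    then show ?thesis using j Suc.prems by (intro exI[of _ 1] exI[of _ R] exI[of _ m]) simp
  qed
qed simp

lemma compile_correct: "W \<ge> 1 \<Longrightarrow> correct x W c"
proof (induction c)
  case Skip
  then show ?case by (auto simp: correct_def intro!: reaches_refl exI)
next
  case (Ins i)
  show ?case
    unfolding correct_def
  proof (intro allI impI)
    fix P p q :: program and Q R m
    assume P: "P = p @ compile (length p) (Ins i) @ q" and wp: "wp x W (Ins i) Q (R, m)"
    have "P ! length p = i" "length p < length P" using P by auto
    moreover have "instr_cost i \<lparr>pc = length p, regs = R, mem = m\<rparr> = cost i (R, m)"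
      by (cases i) (auto simp: cost_def)
    ultimately have "reaches x P W \<lparr>pc = length p, regs = R, mem = m\<rparr> 1 (exec_instr x i \<lparr>pc = length p, regs = R, mem = m\<rparr>)"
      using wp by (intro reaches_instr) auto
    moreover have "exec_instr x i \<lparr>pc = length p, regs = R, mem = m\<rparr> =
        \<lparr>pc = length p + 1, regs = fst (effect x i (R, m)), mem = snd (effect x i (R, m))\<rparr>"
      using wp by (cases i) (auto simp: effect_def)
    ultimately show "\<exists>t R' m'. Q t (R', m') \<and> reaches x P W \<lparr>pc = length p, regs = R, mem = m\<rparr> t
        \<lparr>pc = length p + clen (Ins i), regs = R', mem = m'\<rparr>"
      using wp by (intro exI[of _ 1] exI[of _ "fst (effect x i (R, m))"] exI[of _ "snd (effect x i (R, m))"]) simp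
  qed
next
  case (Seq c1 c2)
  show ?case
    unfolding correct_def
  proof (intro allI impI)
    fix P p q :: program and Q R m
    assume P: "P = p @ compile (length p) (c1 ;; c2) @ q" and wp: "wp x W (c1 ;; c2) Q (R, m)"
    have P1: "P = p @ compile (length p) c1 @ (compile (length p + clen c1) c2 @ q)"
      and P2: "P = (p @ compile (length p) c1) @ compile (length p + clen c1) c2 @ q" using P by simp_all
    from wp have w: "wp x W c1 (\<lambda>t s'. wp x W c2 (\<lambda>t'. Q (t + t')) s') (R, m)" by simp
    from correctD[OF Seq.IH(1)[OF Seq.prems] P1 refl w]
    obtain t1 R1 m1 where 1: "wp x W c2 (\<lambda>t'. Q (t1 + t')) (R1, m1)"
      "reaches x P W \<lparr>pc = length p, regs = R, mem = m\<rparr> t1 \<lparr>pc = length p + clen c1, regs = R1, mem = m1\<rparr>"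
      by auto
    from correctD[OF Seq.IH(2)[OF Seq.prems] P2 _ 1(1)]
    obtain t2 R2 m2 where 2: "Q (t1 + t2) (R2, m2)"
      "reaches x P W \<lparr>pc = length p + clen c1, regs = R1, mem = m1\<rparr> t2 \<lparr>pc = length p + clen c1 + clen c2, regs = R2, mem = m2\<rparr>"
      by (auto simp: length_compile)
    show "\<exists>t R' m'. Q t (R', m') \<and> reaches x P W \<lparr>pc = length p, regs = R, mem = m\<rparr> t
        \<lparr>pc = length p + clen (c1 ;; c2), regs = R', mem = m'\<rparr>"
      using reaches_trans[OF 1(2) 2(2)] 2(1) by (auto simp: add.assoc)
  qed
next
  case (IfPos r c1 c2)
  show ?case
    unfolding correct_def
  proof (intro allI impI)
    fix P p q :: program and Q R m
    let ?a = "length p"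
    let ?e = "?a + clen c1 + clen c2 + 2"
    assume P: "P = p @ compile (length p) (IfPos r c1 c2) @ q" and wp: "wp x W (IfPos r c1 c2) Q (R, m)"
    have j: "reaches x P W \<lparr>pc = ?a, regs = R, mem = m\<rparr> 1 \<lparr>pc = (if R r > 0 then ?a + clen c2 + 2 else ?a + 1), regs = R, mem = m\<rparr>"
      using reaches_jump[OF _ IfPos.prems, of P p r "?a + clen c2 + 2" _ x R m] P by simp
    show "\<exists>t R' m'. Q t (R', m') \<and> reaches x P W \<lparr>pc = length p, regs = R, mem = m\<rparr> t
        \<lparr>pc = length p + clen (IfPos r c1 c2), regs = R', mem = m'\<rparr>"
    proof (cases "R r > 0")
      case True
      have P1: "P = (p @ [JumpPos r (?a + clen c2 + 2)] @ compile (?a + 1) c2 @ [JumpPos 2 ?e]) @ compile (?a + clen c2 + 2) c1 @ q"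
        using P by simp
      from wp True have w: "wp x W c1 (\<lambda>t. Q (t + 1)) (R, m)" by simp
      from correctD[OF IfPos.IH(1)[OF IfPos.prems] P1 _ w]
      obtain t1 R1 m1 where 1: "Q (t1 + 1) (R1, m1)"
        "reaches x P W \<lparr>pc = ?a + clen c2 + 2, regs = R, mem = m\<rparr> t1 \<lparr>pc = ?a + clen c2 + 2 + clen c1, regs = R1, mem = m1\<rparr>"
        by (auto simp: length_compile)
      show ?thesis
        using reaches_trans[OF j, of t1] 1 True
        by (intro exI[of _ "t1 + 1"] exI[of _ R1] exI[of _ m1]) (simp add: add_ac)
    next
      case False
      have P1: "P = (p @ [JumpPos r (?a + clen c2 + 2)]) @ compile (?a + 1) c2 @ ([JumpPos 2 ?e] @ compile (?a + clen c2 + 2) c1 @ q)"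
        using P by simp
      from wp False have w: "wp x W c2 (\<lambda>t s'. fst s' 2 > 0 \<and> Q (t + 2) s') (R, m)" by simp
      from correctD[OF IfPos.IH(2)[OF IfPos.prems] P1 _ w]
      obtain t1 R1 m1 where 1: "R1 2 > 0" "Q (t1 + 2) (R1, m1)"
        "reaches x P W \<lparr>pc = ?a + 1, regs = R, mem = m\<rparr> t1 \<lparr>pc = ?a + 1 + clen c2, regs = R1, mem = m1\<rparr>"
        by auto
      have P2: "P = (p @ [JumpPos r (?a + clen c2 + 2)] @ compile (?a + 1) c2) @ JumpPos 2 ?e # (compile (?a + clen c2 + 2) c1 @ q)"
        using P by simp
      have "reaches x P W \<lparr>pc = ?a + 1 + clen c2, regs = R1, mem = m1\<rparr> 1 \<lparr>pc = ?e, regs = R1, mem = m1\<rparr>"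
        using reaches_jump[OF P2 IfPos.prems, of x R1 m1] 1(1) by (simp add: length_compile)
      from reaches_trans[OF reaches_trans[OF j] this, of t1] 1 False
      have "reaches x P W \<lparr>pc = ?a, regs = R, mem = m\<rparr> (1 + t1 + 1) \<lparr>pc = ?e, regs = R1, mem = m1\<rparr>" by simp
      then show ?thesis using 1(2) by (intro exI[of _ "t1 + 2"] exI[of _ R1] exI[of _ m1]) (simp add: add_ac)
    qed
  qed
next
  case (WhilePos r c)
  show ?case
    unfolding correct_def
  proof (intro allI impI)
    fix P p q :: program and Q R m
    let ?a = "length p"
    assume P: "P = p @ compile (length p) (WhilePos r c) @ q" and wp: "wp x W (WhilePos r c) Q (R, m)"
    obtain k where k: "R 2 > 0" "wloop r (wp x W c) k (\<lambda>t. Q (t + 1)) (R, m)" using wp by auto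
    have j: "reaches x P W \<lparr>pc = ?a, regs = R, mem = m\<rparr> 1 \<lparr>pc = ?a + clen c + 1, regs = R, mem = m\<rparr>"
      using reaches_jump[OF _ WhilePos.prems, of P p 2 "?a + clen c + 1" _ x R m] P k(1) by simp
    obtain t R' m' where 1: "Q (t + 1) (R', m')" "reaches x P W \<lparr>pc = ?a + clen c + 1, regs = R, mem = m\<rparr> t
        \<lparr>pc = ?a + clen (WhilePos r c), regs = R', mem = m'\<rparr>"
      using correct_while[OF WhilePos.IH[OF WhilePos.prems] WhilePos.prems P k(2)] by auto
    show "\<exists>t R' m'. Q t (R', m') \<and> reaches x P W \<lparr>pc = length p, regs = R, mem = m\<rparr> t
        \<lparr>pc = length p + clen (WhilePos r c), regs = R', mem = m'\<rparr>"
      using reaches_trans[OF j 1(2)] 1(1) by (intro exI[of _ "t + 1"]) auto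
  qed
qed

theorem compile_outputs_within:
  assumes "W \<ge> 1" "wp x W c (\<lambda>t s. t \<le> T \<and> fst s 1 > 0 \<and> z = real_of_int (fst s 0) / real_of_int (fst s 1)) (R, m)"
  shows "outputs_within x (compile 0 c) \<lparr>pc = 0, regs = R, mem = m\<rparr> (real (W * T)) z"
proof -
  obtain t R' m' where 1: "t \<le> T" "R' 1 > 0" "z = real_of_int (R' 0) / real_of_int (R' 1)"
    "reaches x (compile 0 c) W \<lparr>pc = 0, regs = R, mem = m\<rparr> t \<lparr>pc = 0 + clen c, regs = R', mem = m'\<rparr>"
    using correctD[OF compile_correct[OF assms(1)] _ _ assms(2), of "compile 0 c" "[]" 0 "[]"] by auto
  then obtain k where k: "run x (compile 0 c) \<lparr>pc = 0, regs = R, mem = m\<rparr> k = \<lparr>pc = clen c, regs = R', mem = m'\<rparr>"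
    "run_time x (compile 0 c) \<lparr>pc = 0, regs = R, mem = m\<rparr> k \<le> W * t" by (auto simp: reaches_def)
  have "W * t \<le> W * T" using 1(1) by simp
  then have "real (run_time x (compile 0 c) \<lparr>pc = 0, regs = R, mem = m\<rparr> k) \<le> real (W * T)"
    using k(2) order_trans of_nat_le_iff by blast
  then show ?thesis
    unfolding outputs_within_def using 1(2,3) k(1)
    by (intro exI[of _ k]) (simp add: halted_def length_compile)
qed

subsection \<open>Loops\<close>

lemma wloop_SucI:
  "fst s r > 0 \<Longrightarrow> B (\<lambda>t s'. wloop r B k (\<lambda>t'. Q (Suc t + t')) s') s \<Longrightarrow> wloop r B (Suc k) Q s"
  by simp

text \<open>The index k of the invariant bounds the remaining iterations, so it is termination
  measure and time bound in one. An iteration takes the body and its test; the final 2 is the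
  entering jump and the failing test.\<close>

lemma wp_while_inv:
  assumes "I k s" "fst s 2 > 0"
    and step: "\<And>k s. I k s \<Longrightarrow> fst s r > 0 \<Longrightarrow> \<exists>j. k = Suc j \<and> wp x W c (\<lambda>t s'. t \<le> T \<and> I j s') s"
    and fin: "\<And>k s. I k s \<Longrightarrow> \<not> fst s r > 0 \<Longrightarrow> F s"
  shows "wp x W (WhilePos r c) (\<lambda>t s'. t \<le> (T + 1) * k + 2 \<and> F s') s"
proof -
  have "wloop r (wp x W c) (Suc k) (\<lambda>t s'. t \<le> (T + 1) * k + 1 \<and> F s') s"
    using assms(1)
  proof (induction k arbitrary: s)
    case 0
    then have "\<not> fst s r > 0" using step[OF 0] by auto
    then show ?case using fin[OF 0] by simp
  next
    case (Suc k)
    show ?case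
    proof (cases "fst s r > 0")
      case True
      then have "wp x W c (\<lambda>t s'. t \<le> T \<and> I k s') s" using step[OF Suc.prems] by auto
      then have "wp x W c (\<lambda>t s'. wloop r (wp x W c) (Suc k) (\<lambda>t' s''. Suc t + t' \<le> (T + 1) * Suc k + 1 \<and> F s'') s') s"
      proof (rule wp_mono)
        fix t s' assume a: "t \<le> T \<and> I k s'"
        show "wloop r (wp x W c) (Suc k) (\<lambda>t' s''. Suc t + t' \<le> (T + 1) * Suc k + 1 \<and> F s'') s'"
          by (rule wloop_wp_mono[OF Suc.IH]) (use a in auto)
      qed
      then show ?thesis by (rule wloop_SucI[OF True])
    qed (use fin[OF Suc.prems] in simp)
  qed
  then have "wloop r (wp x W c) (Suc k) (\<lambda>t s'. t + 1 \<le> (T + 1) * k + 2 \<and> F s') s"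
    by (rule wloop_wp_mono) auto
  then show ?thesis using assms(2) by (auto simp del: wloop.simps)
qed

text \<open>Chains of iterations between given states. Unlike an invariant they compose, as the
  recursive search requires: the exploration of a subtree is a segment of one and the same
  loop.\<close>

inductive iters :: "(real_input \<Rightarrow> real) \<Rightarrow> nat \<Rightarrow> reg \<Rightarrow> com \<Rightarrow> nat \<Rightarrow> nat \<Rightarrow> store \<Rightarrow> store \<Rightarrow> bool"
  for x W r c T where
  iters_0: "iters x W r c T 0 s s"
| iters_Suc: "fst s r > 0 \<Longrightarrow> wp x W c (\<lambda>t s1. t \<le> T \<and> s1 = s') s \<Longrightarrow> iters x W r c T k s' s'' \<Longrightarrow>
    iters x W r c T (Suc k) s s''"

lemma iters_trans: "iters x W r c T k s s' \<Longrightarrow> iters x W r c T l s' s'' \<Longrightarrow> iters x W r c T (k + l) s s''"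
  by (induction rule: iters.induct) (auto intro: iters.intros)

lemma iters_step:
  assumes "fst s r > 0" "wp x W c (\<lambda>t s'. t \<le> T \<and> F s') s"
  obtains s' where "F s'" "iters x W r c T 1 s s'"
proof -
  obtain t s' where *: "t \<le> T" "F s'" "wp x W c (\<lambda>t' s''. t' = t \<and> s'' = s') s"
    using wp_witness[OF assms(2)] by auto
  have "wp x W c (\<lambda>t s1. t \<le> T \<and> s1 = s') s" by (rule wp_mono[OF *(3)]) (use * in auto)
  then have "iters x W r c T (Suc 0) s s'" by (rule iters_Suc[OF assms(1) _ iters_0])
  then show ?thesis using * that by simp
qed

lemma wp_while_iters:
  assumes "iters x W r c T k s s'" "fst s 2 > 0" "\<not> fst s' r > 0"
  shows "wp x W (WhilePos r c) (\<lambda>t s''. t \<le> (T + 1) * k + 2 \<and> s'' = s') s"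
proof -
  have "wloop r (wp x W c) (Suc k) (\<lambda>t s''. t \<le> (T + 1) * k + 1 \<and> s'' = s') s"
    using assms(1,3)
  proof (induction rule: iters.induct)
    case (iters_Suc s s' k s'')
    have "wp x W c (\<lambda>t y. wloop r (wp x W c) (Suc k) (\<lambda>t' z. Suc t + t' \<le> (T + 1) * Suc k + 1 \<and> z = s'') y) s"
    proof (rule wp_mono[OF iters_Suc(2)])
      fix t y assume a: "t \<le> T \<and> y = s'"
      have "wloop r (wp x W c) (Suc k) (\<lambda>t' z. Suc t + t' \<le> (T + 1) * Suc k + 1 \<and> z = s'') s'"
        by (rule wloop_wp_mono[OF iters_Suc(4)]) (use a iters_Suc in auto)
      then show "wloop r (wp x W c) (Suc k) (\<lambda>t' z. Suc t + t' \<le> (T + 1) * Suc k + 1 \<and> z = s'') y" using a by simp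
    qed
    then show ?case by (rule wloop_SucI[OF iters_Suc(1)])
  qed simp
  then have "wloop r (wp x W c) (Suc k) (\<lambda>t s''. t + 1 \<le> (T + 1) * k + 2 \<and> s'' = s') s"
    by (rule wloop_wp_mono) auto
  then show ?thesis using assms(2) by (auto simp del: wloop.simps)
qed

subsection \<open>Sizes of integers\<close>

lemma bits_le_iff: "bits z \<le> w \<longleftrightarrow> \<bar>z\<bar> < 2 ^ w"
proof -
  have "bits z \<le> w \<longleftrightarrow> nat \<bar>z\<bar> < 2 ^ w"
    unfolding bits_def using floorlog_leD[of 2 "nat \<bar>z\<bar>" w] floorlog_leI[of "nat \<bar>z\<bar>" 2 w] by auto
  also have "\<dots> \<longleftrightarrow> \<bar>z\<bar> < 2 ^ w" by (simp add: nat_less_iff)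
  finally show ?thesis .
qed

lemma bits_mult: "bits a \<le> u \<Longrightarrow> bits b \<le> v \<Longrightarrow> bits (a * b) \<le> u + v"
  unfolding bits_le_iff abs_mult power_add by (intro mult_strict_mono') auto

lemma bits_add: "bits a \<le> u \<Longrightarrow> bits b \<le> v \<Longrightarrow> bits (a + b) \<le> max u v + 1"
proof -
  assume "bits a \<le> u" "bits b \<le> v"
  then have "bits a \<le> max u v" "bits b \<le> max u v" by auto
  then show ?thesis unfolding bits_le_iff by simp
qed

lemma bits_diff: "bits a \<le> u \<Longrightarrow> bits b \<le> v \<Longrightarrow> bits (a - b) \<le> max u v + 1"
  using bits_add[of a u "- b" v] by (simp add: bits_def)

text \<open>Rounding down can move a negative quotient away from 0, but not below - |a|; hence
  division never lengthens its first operand.\<close>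

lemma abs_div_le: "\<bar>a div b\<bar> \<le> \<bar>a :: int\<bar>"
proof -
  have *: "\<bar>a div b\<bar> \<le> \<bar>a\<bar>" if "b > 0" for a b :: int
  proof (cases "a \<ge> 0")
    case True
    then show ?thesis using that zdiv_mono2[of a 1 b] by (simp add: pos_imp_zdiv_nonneg_iff)
  next
    case False
    have "a * b \<le> a * 1" using False that by (intro mult_left_mono_neg) auto
    then have "a \<le> a div b" using zdiv_mono1[of "a * b" a b] that by simp
    moreover have "a div b < 0" using False that by (intro div_neg_pos_less0) auto
    ultimately show ?thesis using False by simp
  qed
  consider "b > 0" | "b = 0" | "b < 0" by linarith
  then show ?thesis
  proof cases
    case 3
    have "a div b = (- a) div (- b)" by simp
    then show ?thesis using *[of "- b" "- a"] 3 by simp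
  qed (use * in auto)
qed

lemma bits_div: "bits a \<le> u \<Longrightarrow> bits (a div b) \<le> u"
  unfolding bits_le_iff using abs_div_le[of a b] by linarith

section \<open>The search program\<close>

lemma cost_simps:
  "cost (Const r c) s = 1"
  "cost (Add r a b) s = 1 + bits (fst s a) + bits (fst s b)"
  "cost (Sub r a b) s = 1 + bits (fst s a) + bits (fst s b)"
  "cost (Mul r a b) s = 1 + bits (fst s a) + bits (fst s b)"
  "cost (Div r a b) s = 1 + bits (fst s a) + bits (fst s b)"
  "cost (Load r a) s = 1 + bits (fst s a) + bits (snd s (nat (fst s a)))"
  "cost (Store a b) s = 1 + bits (fst s a) + bits (fst s b)"
  "cost (Query r p a) s = 1 + nat (fst s a)"
  by (simp_all add: cost_def)

lemma effect_simps:
  "effect x (Const r c) s = ((fst s)(r := c), snd s)"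
  "effect x (Add r a b) s = ((fst s)(r := fst s a + fst s b), snd s)"
  "effect x (Sub r a b) s = ((fst s)(r := fst s a - fst s b), snd s)"
  "effect x (Mul r a b) s = ((fst s)(r := fst s a * fst s b), snd s)"
  "effect x (Div r a b) s = ((fst s)(r := fst s a div fst s b), snd s)"
  "effect x (Load r a) s = ((fst s)(r := snd s (nat (fst s a))), snd s)"
  "effect x (Store a b) s = (fst s, (snd s)(nat (fst s a) := fst s b))"
  "effect x (Query r p a) s = ((fst s)(r := \<lfloor>2 ^ nat (fst s a) * x p\<rfloor>), snd s)"
  by (simp_all add: effect_def)

primrec block :: "instr list \<Rightarrow> com" where
  "block [] = Skip"
| "block (i # is) = (Ins i ;; block is)"

text \<open>Registers: 0 \<open>n\<close>, 1 the output denominator, 2 the constant 1, 3 \<open>L\<close>, 4 \<open>m\<close>, 5 \<open>N\<close>, 6 the depth budget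
  \<open>M\<close>, 7 the precision \<open>K\<close>, 8 the fixed-point unit \<open>S\<close>, 9 \<open>B\<close>, 10 \<open>G\<close>, 11 \<open>U\<close> (the weights in fixed point),
  12 \<open>n * n\<close>, 13 the root \<open>r\<close>, 14 the extrapolated ratio, 15 the node index \<open>j\<close>; search frame: 16 the
  vertex, 17 the next neighbour, 18 the product so far, 19 the remaining depth budget, 20 the stack pointer,
  21 the loop flag; 31 the output numerator; the others are scratch. In memory the adjacency matrix is
  followed by the search state \<open>\<sigma>\<close> (cell \<open>n * n + w\<close>) and the stack.\<close>

definition apply_msg :: com where
  "apply_msg = block
    [Mul 23 10 15, Mul 23 23 26, Mul 24 8 8, Mul 24 24 5, Add 23 23 24, Mul 23 23 15, Mul 23 23 18,
     Mul 24 15 26, Mul 25 9 5, Add 24 24 25, Mul 24 24 5, Mul 24 24 8, Div 18 23 24]"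

text \<open>Multiplication of register 18 by g at the node z = j / N, that is by G j / (S N),
  rounded down.\<close>

definition apply_g :: com where
  "apply_g = block [Mul 23 18 10, Mul 23 23 15, Mul 24 8 5, Div 18 23 24]"

definition next_w :: com where
  "next_w = Ins (Add 17 17 2)"

text \<open>As \<open>msg a g 0 = a\<close>, the argument 0 serves for a neighbour on the path that
  acts with \<open>a\<close> and equally for a subtree that is cut off.\<close>

definition apply_a :: com where
  "apply_a = (Ins (Const 26 0) ;; apply_msg ;; next_w)"

text \<open>Three cells save the vertex, its product and its budget. The state of the vertex becomes
  w + 1 for its neighbour w, and w starts with the product U, the fixed-point form of \<mu>. The
  position among the neighbours is not saved.\<close>

definition push_frame :: com where
  "push_frame = block
    [Store 20 16, Add 20 20 2, Store 20 18, Add 20 20 2, Store 20 19, Add 20 20 2,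
     Add 23 12 16, Add 24 17 2, Store 23 24, Const 25 0, Add 16 17 25, Const 17 0, Add 18 11 25]"

text \<open>The position at which the caller resumes is one more than the vertex just finished,
  because that vertex was the neighbour under consideration. The state of the caller returns to 0,
  i.e. free.\<close>

definition pop_frame :: com where
  "pop_frame = (block
    [Const 25 0, Add 26 18 25, Add 17 16 2, Sub 20 20 2, Load 19 20, Sub 20 20 2, Load 18 20,
     Sub 20 20 2, Load 16 20, Add 23 12 16, Store 23 25] ;; apply_msg)"

text \<open>One pass treats one candidate neighbour w of the current vertex u. Only positivity can
  be tested, so the square of \<sigma> w - u - 1 singles out the predecessor, which is passed over.
  Any other neighbour costs a unit of budget; on the path it acts with \<open>g\<close> or
  \<open>a\<close> according to the sign of \<sigma> w - u - 1, and a free one is entered if budget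
  remains. With all candidates treated, a vertex above r returns to its caller and the root r ends
  the loop.\<close>

definition search_step :: com where
  "search_step =
     (Ins (Sub 23 0 17) ;;
      IfPos 23
        (block [Mul 23 16 0, Add 23 23 17, Load 23 23] ;;
         IfPos 23
           (block [Add 23 12 17, Load 23 23, Sub 24 23 16, Sub 24 24 2, Mul 25 24 24] ;;
            IfPos 25
              (Ins (Sub 19 19 2) ;;
               IfPos 24 (apply_g ;; next_w)
                 (IfPos 23 apply_a (IfPos 19 push_frame apply_a)))
              next_w)
           next_w)
        (Ins (Sub 23 16 13) ;; IfPos 23 pop_frame (Ins (Const 21 0))))"

text \<open>P times \<open>msg a g (x / S)\<close>, rounded down, for a = j S / (N B) and g = G j /
  (S N). The fractions are cleared so that a single division rounds.\<close>

definition msg_int :: "int \<Rightarrow> int \<Rightarrow> int \<Rightarrow> int \<Rightarrow> int \<Rightarrow> int \<Rightarrow> int \<Rightarrow> int" where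
  "msg_int S B G N j x P = ((G * j * x + S * S * N) * j * P) div ((j * x + B * N) * N * S)"

text \<open>The budget b is an integer: once it is used up, the remaining neighbours still lower it,
  possibly below 0.\<close>

definition search_state :: "(reg \<Rightarrow> int) \<Rightarrow> nat \<Rightarrow> nat \<Rightarrow> int \<Rightarrow> int \<Rightarrow> nat \<Rightarrow> (nat \<Rightarrow> int) \<Rightarrow> store \<Rightarrow> bool" where
  "search_state R0 u w P b sp m s \<longleftrightarrow> snd s = m \<and> fst s 16 = int u \<and> fst s 17 = int w \<and> fst s 18 = P \<and>
     fst s 19 = b \<and> fst s 20 = int sp \<and> fst s 21 = 1 \<and> (\<forall>q. q \<notin> {16..26} \<longrightarrow> fst s q = R0 q)"

lemma search_state_pair:
  assumes "search_state R0 u w P b sp m s"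
  obtains R where "s = (R, m)"
proof -
  have "snd s = m" using assms unfolding search_state_def by blast
  then have "s = (fst s, m)" by (metis prod.collapse)
  then show ?thesis by (rule that)
qed

text \<open>\<open>v\<close> bounds the bit length of every operand. The addresses fit below n n + 4
  n + 4: the matrix, n states and a stack of at most n frames of three cells.\<close>

locale search =
  fixes x :: "real_input \<Rightarrow> real" and W v n r M :: nat and S B G U N j :: int and R0 :: "reg \<Rightarrow> int"
  assumes R0: "R0 0 = int n" "R0 2 = 1" "R0 5 = N" "R0 8 = S" "R0 9 = B" "R0 10 = G" "R0 11 = U"
      "R0 12 = int (n * n)" "R0 13 = int r" "R0 15 = j"
    and pos: "S > 0" "B > 0" "G \<ge> 0" "N > 0" "0 \<le> j" "j \<le> N" "0 \<le> U" "U \<le> S"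
    and sizes: "bits S \<le> v" "bits B \<le> v" "bits G \<le> v" "bits N \<le> v" "int (n * n + 4 * n + 4) < 2 ^ v"
      "int M + int n < 2 ^ v"
    and W: "W \<ge> 20 * v + 20"
begin

lemma bits_nat: "a \<le> n * n + 4 * n + 4 \<Longrightarrow> bits (int a) \<le> v"
  unfolding bits_le_iff using sizes(5) by linarith

lemma bits_between: "0 \<le> a \<Longrightarrow> a \<le> c \<Longrightarrow> bits c \<le> v \<Longrightarrow> bits a \<le> v"
  unfolding bits_le_iff by linarith

lemma bits_j: "bits j \<le> v"
  using bits_between[of j N] pos sizes by simp

lemma bits_0: "bits 0 \<le> v" and bits_1: "bits 1 \<le> v"
  using bits_nat[of 0] bits_nat[of 1] by simp_all

lemma cost_bound: "bits a \<le> p \<Longrightarrow> bits b \<le> q \<Longrightarrow> Suc (p + q) \<le> W \<Longrightarrow> Suc (bits a + bits b) \<le> W"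
  by simp

lemma bits_add': "bits a \<le> p \<Longrightarrow> bits b \<le> q \<Longrightarrow> bits (a + b) \<le> Suc (p + q)"
  and bits_diff': "bits a \<le> p \<Longrightarrow> bits b \<le> q \<Longrightarrow> bits (a - b) \<le> Suc (p + q)"
  using bits_add[of a p b q] bits_diff[of a p b q] by simp_all

lemma nat_address: "nat (int a * int b + int c) = a * b + c" "nat (int a + int b) = a + b"
  "nat (int a + 1) = a + 1" "nat (2 + int a) = a + 2"
  by (simp_all flip: of_nat_mult of_nat_add)

lemmas exec = cost_simps effect_simps nat_address

lemma bits_uminus: "bits a \<le> p \<Longrightarrow> bits (- a) \<le> p"
  by (simp add: bits_def)

lemmas bits_rules = bits_mult bits_add' bits_diff' bits_div bits_uminus bits_0 bits_1

lemma bits_2: "bits 2 \<le> v"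
  using bits_nat[of 2] by simp

lemma operand_bits: "bits S \<le> v" "bits B \<le> v" "bits G \<le> v" "bits N \<le> v" "bits j \<le> v" "bits U \<le> v"
  "bits (int n) \<le> v"
  using sizes bits_j bits_between[of U S] pos bits_nat[of n] by auto

lemma bits_vertex: "w < n \<Longrightarrow> bits (int w) \<le> v"
  by (rule bits_nat) simp

lemma search_stateD:
  assumes "search_state R0 u w P b sp m (R, m')"
  shows "R 16 = int u" "R 17 = int w" "R 18 = P" "R 19 = b" "R 20 = int sp" "R 0 = int n" "R 2 = 1"
    "R 5 = N" "R 8 = S" "R 9 = B" "R 10 = G" "R 11 = U" "R 12 = int n * int n" "R 13 = int r" "R 15 = j" "m' = m"
proof -
  have "\<forall>q. q \<notin> {16..26} \<longrightarrow> R q = R0 q" using assms unfolding search_state_def by simp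
  then have "R q = R0 q" if "q < 16" for q using that by simp
  then show "R 0 = int n" "R 2 = 1" "R 5 = N" "R 8 = S" "R 9 = B" "R 10 = G" "R 11 = U"
    "R 12 = int n * int n" "R 13 = int r" "R 15 = j" using R0 by simp_all
qed (use assms in \<open>simp_all add: search_state_def\<close>)

section \<open>One iteration of the search loop, branch by branch\<close>

lemma step_skip:
  assumes s: "search_state R0 u w P b sp m s" and u: "u < n" "w < n" and m: "m (u * n + w) = 0"
  shows "wp x W search_step (\<lambda>t s'. t \<le> 50 \<and> search_state R0 u (w + 1) P b sp m s') s"
proof -
  obtain R where s': "s = (R, m)" using search_state_pair[OF s] .
  note R = search_stateD(1-15)[OF s[unfolded s']]
  note bf = bits_rules operand_bits u[THEN bits_vertex]
  show ?thesis
    unfolding s' search_step_def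
    by (simp add: next_w_def exec R u m, intro conjI;
      ((rule cost_bound, (rule bf)+, use W in linarith) | (use W in linarith) |
       (use s[unfolded s'] in \<open>auto simp: search_state_def\<close>)))
qed

lemma step_parent:
  assumes s: "search_state R0 u w P b sp m s" and u: "u < n" "w < n"
    and m: "m (u * n + w) = 1" "m (n * n + w) = int u + 1"
  shows "wp x W search_step (\<lambda>t s'. t \<le> 50 \<and> search_state R0 u (w + 1) P b sp m s') s"
proof -
  obtain R where s': "s = (R, m)" using search_state_pair[OF s] .
  note R = search_stateD(1-15)[OF s[unfolded s']]
  note bf = bits_rules operand_bits u[THEN bits_vertex]
  show ?thesis
    unfolding s' search_step_def
    by (simp add: next_w_def exec R u m, intro conjI;
      ((rule cost_bound, (rule bf)+, use W in linarith) | (use W in linarith) |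
       (use s[unfolded s'] in \<open>auto simp: search_state_def\<close>)))
qed

lemma step_pin_g:
  assumes s: "search_state R0 u w P b sp m s" and u: "u < n" "w < n"
    and m: "m (u * n + w) = 1" "m (n * n + w) > int u + 1" and bits: "bits (m (n * n + w)) \<le> v" "bits P \<le> v" "bits b \<le> v"
  shows "wp x W search_step (\<lambda>t s'. t \<le> 50 \<and> search_state R0 u (w + 1) (P * G * j div (S * N)) (b - 1) sp m s') s"
proof -
  obtain R where s': "s = (R, m)" using search_state_pair[OF s] .
  note R = search_stateD(1-15)[OF s[unfolded s']]
  note bf = bits_rules operand_bits u[THEN bits_vertex] bits
  have c: "1 < m (n * n + w) - int u" "0 < m (n * n + w) - int u - 1" using m by linarith+
  have c2: "0 < (m (n * n + w) - int u - 1) * (m (n * n + w) - int u - 1)" using c(2) by (intro mult_pos_pos)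
  show ?thesis
    unfolding s' search_step_def
    by (simp add: next_w_def apply_g_def exec R u m(1) c(1) c2, intro conjI;
      ((rule cost_bound, (rule bf)+, use W in linarith) | (use W in linarith) |
       (use s[unfolded s'] in \<open>auto simp: search_state_def\<close>)))
qed

lemma step_pin_a:
  assumes s: "search_state R0 u w P b sp m s" and u: "u < n" "w < n"
    and m: "m (u * n + w) = 1" "0 < m (n * n + w)" "m (n * n + w) < int u + 1"
    and bits: "bits (m (n * n + w)) \<le> v" "bits P \<le> v" "bits b \<le> v"
  shows "wp x W search_step (\<lambda>t s'. t \<le> 50 \<and> search_state R0 u (w + 1) (msg_int S B G N j 0 P) (b - 1) sp m s') s"
proof -
  obtain R where s': "s = (R, m)" using search_state_pair[OF s] .
  note R = search_stateD(1-15)[OF s[unfolded s']]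
  note bf = bits_rules operand_bits u[THEN bits_vertex] bits
  have c: "\<not> 1 < m (n * n + w) - int u" "m (n * n + w) - int u - 1 < 0" using m by linarith+
  have c2: "0 < (m (n * n + w) - int u - 1) * (m (n * n + w) - int u - 1)" using c(2) by (intro mult_neg_neg)
  \<comment> \<open>Naming the operand 0 keeps the result in the shape of \<open>msg_int\<close> at
    x = 0.\<close>
  obtain z where z: "z = (0::int)" by blast
  then have e: "effect x (Const 26 0) s = ((fst s)(26 := z), snd s)" for s by (simp add: effect_simps)
  have bz: "bits z \<le> v" using z bits_0 by simp
  show ?thesis
    unfolding s' search_step_def z[symmetric]
    by (simp add: next_w_def apply_a_def apply_msg_def msg_int_def cost_simps effect_simps(2-8) nat_address e R u m(1,2) c(1) c2, intro conjI;
      ((rule cost_bound, (rule bf bz)+, use W in linarith) | (use W in linarith) |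
       (use s[unfolded s'] in \<open>auto simp: search_state_def\<close>)))
qed

lemma step_cut:
  assumes s: "search_state R0 u w P b sp m s" and u: "u < n" "w < n"
    and m: "m (u * n + w) = 1" "m (n * n + w) = 0" and b: "b \<le> 1" and bits: "bits P \<le> v" "bits b \<le> v"
  shows "wp x W search_step (\<lambda>t s'. t \<le> 50 \<and> search_state R0 u (w + 1) (msg_int S B G N j 0 P) (b - 1) sp m s') s"
proof -
  obtain R where s': "s = (R, m)" using search_state_pair[OF s] .
  note R = search_stateD(1-15)[OF s[unfolded s']]
  note bf = bits_rules operand_bits u[THEN bits_vertex] bits
  have c: "0 < (- int u - 1) * (- int u - 1)" by (simp add: zero_less_mult_iff)
  obtain z where z: "z = (0::int)" by blast
  then have e: "effect x (Const 26 0) s = ((fst s)(26 := z), snd s)" for s by (simp add: effect_simps)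
  have bz: "bits z \<le> v" using z bits_0 by simp
  show ?thesis
    unfolding s' search_step_def z[symmetric]
    by (simp add: next_w_def apply_a_def apply_msg_def msg_int_def cost_simps effect_simps(2-8) nat_address e R u m b c not_less[THEN iffD2, OF b], intro conjI;
      ((rule cost_bound, (rule bf bz)+, use W in linarith) | (use W in linarith) |
       (use s[unfolded s'] in \<open>auto simp: search_state_def\<close>)))
qed

lemma step_push:
  assumes s: "search_state R0 u w P b sp m s" and u: "u < n" "w < n"
    and m: "m (u * n + w) = 1" "m (n * n + w) = 0" and b: "b > 1"
    and bits: "bits P \<le> v" "bits b \<le> v" and sp: "sp \<le> n * n + 4 * n"
  shows "wp x W search_step (\<lambda>t s'. t \<le> 50 \<and> search_state R0 w 0 U (b - 1) (sp + 3)
    (m(sp := int u, sp + 1 := P, sp + 2 := b - 1, n * n + u := int w + 1)) s') s"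
proof -
  obtain R where s': "s = (R, m)" using search_state_pair[OF s] .
  note R = search_stateD(1-15)[OF s[unfolded s']]
  note bf = bits_rules operand_bits u[THEN bits_vertex] bits bits_2 bits_nat[of sp]
  have c: "0 < (- int u - 1) * (- int u - 1)" by (simp add: zero_less_mult_iff)
  show ?thesis
    unfolding s' search_step_def
    by (simp add: push_frame_def exec R u m b c, intro conjI;
      ((rule cost_bound, ((rule bf) | (use sp in simp; fail))+, use W in linarith) | (use W in linarith) |
       (use s[unfolded s'] in \<open>auto simp: search_state_def\<close>)))
qed

lemma step_pop:
  assumes s: "search_state R0 u n p b sp m s" and sp: "sp = sp' + 3" "sp \<le> n * n + 4 * n + 4" and u: "r < u" "u < n" "u' < n"
    and m: "m sp' = int u'" "m (sp' + 1) = P" "m (sp' + 2) = b'"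
    and bits: "bits P \<le> v" "bits b' \<le> v" "bits p \<le> v"
  shows "wp x W search_step (\<lambda>t s'. t \<le> 50 \<and> search_state R0 u' (u + 1) (msg_int S B G N j p P) b' sp'
    (m(n * n + u' := 0)) s') s"
proof -
  obtain R where s': "s = (R, m)" using search_state_pair[OF s] .
  note R = search_stateD(1-15)[OF s[unfolded s']]
  have "bits (int r) \<le> v" using u by (intro bits_vertex) simp
  note bf = bits_rules operand_bits u(2,3)[THEN bits_vertex] bits bits_2 this bits_nat[of sp']
  have a: "nat (2 + int sp') = sp' + 2" "nat (1 + int sp') = sp' + 1"
    "m (Suc sp') = P" "m (Suc (Suc sp')) = b'" using m by simp_all
  have b3: "bits 3 \<le> v" using bits_nat[of 3] by simp
  show ?thesis
    unfolding s' search_step_def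
    apply (simp add: pop_frame_def apply_msg_def msg_int_def exec R u m sp(1) a)
    apply (intro conjI;
      ((rule cost_bound, ((rule bf b3) | (use sp in simp; fail))+, use W in linarith) | (use W in linarith) |
       (use s[unfolded s'] in \<open>auto simp: search_state_def\<close>)))
    done
qed

lemma step_finish:
  assumes s: "search_state R0 r n p b sp m s" and r: "r < n"
  shows "wp x W search_step (\<lambda>t s'. t \<le> 50 \<and> snd s' = m \<and> fst s' 18 = p \<and> fst s' 21 = 0 \<and>
    (\<forall>q. q \<notin> {16..26} \<longrightarrow> fst s' q = R0 q)) s"
proof -
  obtain R where s': "s = (R, m)" using search_state_pair[OF s] .
  note R = search_stateD(1-15)[OF s[unfolded s']]
  note bf = bits_rules operand_bits bits_vertex[OF r]
  show ?thesis
    unfolding s' search_step_def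
    by (simp add: exec R r, intro conjI;
      ((rule cost_bound, (rule bf)+, use W in linarith) | (use W in linarith) |
       (use s[unfolded s'] in \<open>auto simp: search_state_def\<close>)))
qed

end

section \<open>Accuracy of the search\<close>

text \<open>As a and g are at most 1/4, the numerator a + a g x is at most (1 + a x) / 4.\<close>

lemma msg_range:
  fixes a g x :: real
  assumes "0 \<le> a" "a \<le> 1/4" "0 \<le> g" "g \<le> 1/4" "0 \<le> x"
  shows "0 \<le> msg a g x" "msg a g x \<le> 1/4"
proof -
  show "0 \<le> msg a g x" using assms by (simp add: msg_def)
  have "0 \<le> a * x" using assms by simp
  moreover have "a * (g * x) \<le> a * (1/4 * x)" using assms by (intro mult_left_mono mult_right_mono) auto
  moreover have "a * (1/4 * x) = a * x / 4" by simp
  ultimately have "a * (1 + g * x) \<le> 1/4 * (1 + a * x)" using assms(2) unfolding distrib_left by linarith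
  then show "msg a g x \<le> 1/4" using \<open>0 \<le> a * x\<close> by (simp add: msg_def pos_divide_le_eq)
qed

text \<open>The derivative is a (g - a) / (1 + a x)^2, and both a and |g - a| are at most
  1/4.\<close>

lemma msg_lipschitz:
  fixes a g x y :: real
  assumes "0 \<le> a" "a \<le> 1/4" "0 \<le> g" "g \<le> 1/4" "0 \<le> x" "0 \<le> y"
  shows "\<bar>msg a g x - msg a g y\<bar> \<le> \<bar>x - y\<bar> / 16"
proof -
  have p: "1 + a * x \<ge> 1" "1 + a * y \<ge> 1" using assms by auto
  have "msg a g x - msg a g y = a * (g - a) * (x - y) / ((1 + a * x) * (1 + a * y))"
    using p by (simp add: msg_def divide_simps) (simp add: algebra_simps)
  then have "\<bar>msg a g x - msg a g y\<bar> = \<bar>a * (g - a)\<bar> * \<bar>x - y\<bar> / ((1 + a * x) * (1 + a * y))"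
    using p by (simp add: abs_mult abs_divide)
  also have "\<dots> \<le> \<bar>a * (g - a)\<bar> * \<bar>x - y\<bar> / 1"
  proof (rule divide_left_mono)
    have "1 * 1 \<le> (1 + a * x) * (1 + a * y)" by (rule mult_mono) (use p in auto)
    then show "1 \<le> (1 + a * x) * (1 + a * y)" by simp
    then show "0 < (1 + a * x) * (1 + a * y) * 1" by simp
  qed simp
  also have "\<bar>a * (g - a)\<bar> \<le> 1/4 * (1/4)"
  proof -
    have "\<bar>g - a\<bar> \<le> 1/4" "\<bar>a\<bar> \<le> 1/4" using assms unfolding abs_le_iff by linarith+
    then show ?thesis unfolding abs_mult by (intro mult_mono) auto
  qed
  finally show ?thesis by (simp add: mult_right_mono)
qed

text \<open>Every factor of the recursion is at most 1. Hence replacing an unexplored ratio by 0 is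
  an error of at most 1.\<close>

lemma path_ratio_le_1:
  fixes a g \<mu> :: real
  assumes E: "finite E" "\<And>p q. (p, q) \<in> E \<Longrightarrow> p < q" and a: "0 \<le> a" "a \<le> 1/4" "0 \<le> g" "g \<le> 1/4" "0 \<le> \<mu>" "\<mu> \<le> 1"
    and u: "u < n" "\<sigma> u = 0"
  shows "path_ratio a g \<mu> n E \<sigma> u \<le> 1"
proof -
  have nl: "\<not> adj E v v" for v using E(2) by (auto simp: adj_def)
  have f: "0 \<le> (if \<sigma> w > 0 then pin a g (\<sigma> w) u else msg a g (path_ratio a g \<mu> n E (\<sigma>(u := Suc w)) w)) \<and>
    (if \<sigma> w > 0 then pin a g (\<sigma> w) u else msg a g (path_ratio a g \<mu> n E (\<sigma>(u := Suc w)) w)) \<le> 1"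
    if "w \<in> {w. w < n \<and> adj E u w}" for w
  proof (cases "\<sigma> w > 0")
    case False
    have "w \<noteq> u" using that nl by auto
    then have "0 \<le> path_ratio a g \<mu> n E (\<sigma>(u := Suc w)) w"
      using that a False by (intro path_ratio_nonneg) auto
    then show ?thesis using msg_range[of a g] a False by (simp add: order_trans[of _ "1/4" 1])
  qed (use a in \<open>auto simp: pin_def\<close>)
  have "path_ratio a g \<mu> n E \<sigma> u = \<mu> * (\<Prod>w\<in>{w. w < n \<and> adj E u w}.
    if \<sigma> w > 0 then pin a g (\<sigma> w) u else msg a g (path_ratio a g \<mu> n E (\<sigma>(u := Suc w)) w))"
    by (rule path_ratio_recursion) (use E a u in auto)
  also have "\<dots> \<le> \<mu> * 1"
    using a f by (intro mult_left_mono prod_le_1) auto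
  finally have "path_ratio a g \<mu> n E \<sigma> u \<le> \<mu> * 1" .
  then show ?thesis using a by simp
qed

lemma div_real_bounds:
  fixes A D :: int
  shows "of_int (A div D) \<le> real_of_int A / of_int D" "real_of_int A / of_int D - 1 \<le> of_int (A div D)"
  unfolding floor_divide_of_int_eq[where ?'a = real, symmetric] by linarith+

text \<open>One more factor \<open>f \<le> 1/4\<close> shrinks the error made so far; this leaves room for the error of
  the factor itself and for rounding.\<close>

lemma factor_error:
  fixes d t :: real
  assumes "\<bar>P' - P * f'\<bar> \<le> d" "0 \<le> f'" "f' \<le> 1/4" "\<bar>f' - f\<bar> \<le> e" "0 \<le> Q" "Q \<le> (1/4) ^ c"
    "\<bar>P - Q\<bar> \<le> (1/2) ^ b + 3 * d" "(1/4) ^ c * e \<le> (1/2) ^ b / 8 + d"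
  shows "\<bar>P' - Q * f\<bar> \<le> (1/2) ^ b + 3 * (d::real)"
proof -
  have "\<bar>P' - Q * f\<bar> \<le> \<bar>P' - P * f'\<bar> + \<bar>(P - Q) * f'\<bar> + \<bar>Q * (f' - f)\<bar>"
    by (simp add: algebra_simps)
  also have "\<bar>(P - Q) * f'\<bar> \<le> ((1/2) ^ b + 3 * d) * (1/4)"
    unfolding abs_mult using assms by (intro mult_mono) auto
  also have "\<bar>Q * (f' - f)\<bar> \<le> (1/4) ^ c * e"
    unfolding abs_mult using assms by (intro mult_mono) auto
  \<comment> \<open>Altogether (3/8) (1/2)^b + (11/4) d.\<close>
  finally have "\<bar>P' - Q * f\<bar> \<le> d + ((1/2) ^ b + 3 * d) * (1/4) + ((1/2) ^ b / 8 + d)"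
    using assms by linarith
  moreover have "0 \<le> d" using assms(1) by linarith
  moreover have "0 < (1/2 :: real) ^ b" by simp
  ultimately show ?thesis by argo
qed

text \<open>The two inequalities say that a = z / \<beta> and g = \<gamma> z are at most 1/4 at the
  node z = j / N, with \<beta> and \<gamma> replaced by B / S and G / S.\<close>

locale search_graph = search +
  fixes E :: "(nat \<times> nat) set"
  assumes E: "simple_graph n E"
    and small: "4 * j * S \<le> N * B" "4 * G * j \<le> S * N"
begin

definition a :: real where "a = of_int (j * S) / of_int (N * B)"
definition g :: real where "g = of_int (G * j) / of_int (S * N)"
definition \<mu> :: real where "\<mu> = of_int U / of_int S"

lemma fin_E: "finite E" "(p, q) \<in> E \<Longrightarrow> p < q" and no_loop: "\<not> adj E u u"
proof -
  have "E \<subseteq> {..<n} \<times> {..<n}" using E unfolding simple_graph_def by auto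
  then show "finite E" by (rule finite_subset) simp
  show "(p, q) \<in> E \<Longrightarrow> p < q" using E by (auto simp: simple_graph_def)
  show "\<not> adj E u u" using E by (auto simp: simple_graph_def adj_def)
qed

lemma ag: "0 \<le> a" "a \<le> 1/4" "0 \<le> g" "g \<le> 1/4" "0 \<le> \<mu>" "\<mu> \<le> 1"
proof -
  have "real_of_int (4 * j * S) \<le> of_int (N * B)" "real_of_int (4 * G * j) \<le> of_int (S * N)"
    using small by (simp_all only: of_int_le_iff)
  then show "0 \<le> a" "a \<le> 1/4" "0 \<le> g" "g \<le> 1/4" "0 \<le> \<mu>" "\<mu> \<le> 1"
    using pos unfolding a_def g_def \<mu>_def by (auto simp: divide_le_eq)
qed

text \<open>The quotient A / D equals P times the exact message, so the only error is that of one
  rounding, a unit of 1 / S.\<close>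

lemma msg_int_bounds:
  assumes P: "0 \<le> P" "P \<le> S" and p: "0 \<le> p"
  shows "0 \<le> msg_int S B G N j p P" "msg_int S B G N j p P \<le> S"
    "\<bar>real_of_int (msg_int S B G N j p P) / S - P / S * msg a g (p / S)\<bar> \<le> 1 / S"
proof -
  define D where "D = (j * p + B * N) * N * S"
  define A where "A = (G * j * p + S * S * N) * j * P"
  have D: "D > 0" using pos p by (simp add: D_def add_nonneg_pos)
  have A: "A \<ge> 0" using pos p P by (simp add: A_def)
  have e: "real_of_int A / D = P * msg a g (p / S)"
  proof -
    have "j * p + B * N > 0" using pos p by (simp add: add_nonneg_pos)
    then have "real_of_int (j * p + B * N) > 0" by (simp only: of_int_0_less_iff)
    then have nz: "real_of_int S \<noteq> 0" "real_of_int B \<noteq> 0" "real_of_int N \<noteq> 0" "real_of_int (j * p + B * N) \<noteq> 0"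
      using pos by auto
    have "1 + a * (p / S) = real_of_int (j * p + B * N) / (B * N)" using nz by (simp add: a_def field_simps)
    moreover have "1 + g * (p / S) = real_of_int (G * j * p + S * S * N) / (S * S * N)" using nz by (simp add: g_def field_simps)
    moreover have "real_of_int (j * S) / (N * B) * (real_of_int (G * j * p + S * S * N) / (S * S * N)) /
        (real_of_int (j * p + B * N) / (B * N)) = real_of_int ((G * j * p + S * S * N) * j) / ((j * p + B * N) * N * S)"
      using nz by (simp only: of_int_mult) (simp add: divide_simps)
    ultimately have "msg a g (p / S) = real_of_int ((G * j * p + S * S * N) * j) / ((j * p + B * N) * N * S)"
      by (simp only: msg_def a_def[symmetric])
    then show ?thesis by (simp add: A_def D_def)
  qed
  have m: "0 \<le> msg a g (p / S)" "msg a g (p / S) \<le> 1/4"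
    using msg_range[of a g "p / S"] ag p pos by auto
  show "0 \<le> msg_int S B G N j p P"
    unfolding msg_int_def A_def[symmetric] D_def[symmetric] using A D by (simp add: pos_imp_zdiv_nonneg_iff)
  note b = div_real_bounds[of A D, unfolded e]
  have "P * msg a g (p / S) \<le> real_of_int P * 1" using m P by (intro mult_left_mono) auto
  then have "real_of_int (A div D) \<le> S" using b(1) P by linarith
  then show "msg_int S B G N j p P \<le> S"
    unfolding msg_int_def A_def[symmetric] D_def[symmetric] by simp
  have "\<bar>real_of_int (A div D) - P * msg a g (p / S)\<bar> \<le> 1" using b by linarith
  then have "\<bar>(real_of_int (A div D) - P * msg a g (p / S)) / S\<bar> \<le> 1 / S"
    using pos unfolding abs_divide by (intro frac_le) auto
  then show "\<bar>real_of_int (msg_int S B G N j p P) / S - P / S * msg a g (p / S)\<bar> \<le> 1 / S"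
    unfolding msg_int_def A_def[symmetric] D_def[symmetric] by (simp add: diff_divide_distrib)
qed

lemma pin_g_bounds:
  assumes P: "0 \<le> P" "P \<le> S"
  shows "0 \<le> P * G * j div (S * N)" "P * G * j div (S * N) \<le> S"
    "\<bar>real_of_int (P * G * j div (S * N)) / S - P / S * g\<bar> \<le> 1 / S"
proof -
  have D: "S * N > 0" using pos by simp
  have e: "real_of_int (P * G * j) / (S * N) = P * g" by (simp add: g_def)
  show "0 \<le> P * G * j div (S * N)" using D pos P by (simp add: pos_imp_zdiv_nonneg_iff)
  note b = div_real_bounds[of "P * G * j" "S * N", unfolded e]
  have "P * g \<le> real_of_int P * 1" using ag P by (intro mult_left_mono) auto
  then have "real_of_int (P * G * j div (S * N)) \<le> S" using b(1) P by linarith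
  then show "P * G * j div (S * N) \<le> S" by simp
  have "\<bar>real_of_int (P * G * j div (S * N)) - P * g\<bar> \<le> 1" using b by linarith
  then have "\<bar>(real_of_int (P * G * j div (S * N)) - P * g) / S\<bar> \<le> 1 / S"
    using pos unfolding abs_divide by (intro frac_le) auto
  then show "\<bar>real_of_int (P * G * j div (S * N)) / S - P / S * g\<bar> \<le> 1 / S"
    by (simp add: diff_divide_distrib)
qed

definition represents :: "(nat \<Rightarrow> int) \<Rightarrow> (nat \<Rightarrow> nat) \<Rightarrow> bool" where
  "represents m \<sigma> \<longleftrightarrow> (\<forall>i<n. \<forall>k<n. m (i * n + k) = (if adj E i k then 1 else 0)) \<and>
     (\<forall>w<n. m (n * n + w) = int (\<sigma> w))"

lemma row_address: "i < n \<Longrightarrow> k < n \<Longrightarrow> i * n + k < n * (n::nat)"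
proof -
  assume "i < n" "k < n"
  then have "Suc i * n \<le> n * n" by (intro mult_right_mono) auto
  then show ?thesis using \<open>k < n\<close> by simp
qed

lemma represents_cong:
  assumes "represents m \<sigma>" "\<And>a. a < n * n + n \<Longrightarrow> m' a = m a"
  shows "represents m' \<sigma>"
  unfolding represents_def
proof (intro conjI allI impI)
  fix i k assume "i < n" "k < n"
  then show "m' (i * n + k) = (if adj E i k then 1 else 0)"
    using assms row_address[of i k] by (simp add: represents_def)
next
  fix w assume "w < n"
  then show "m' (n * n + w) = int (\<sigma> w)" using assms by (simp add: represents_def)
qed

lemma represents_upd:
  assumes "represents m \<sigma>" "u < n"
  shows "represents (m(n * n + u := int k)) (\<sigma>(u := k))"
  unfolding represents_def
proof (intro conjI allI impI)
  fix i l assume "i < n" "l < n"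
  then show "(m(n * n + u := int k)) (i * n + l) = (if adj E i l then 1 else 0)"
    using assms row_address[of i l] by (simp add: represents_def)
next
  fix w assume "w < n"
  then show "(m(n * n + u := int k)) (n * n + w) = int ((\<sigma>(u := k)) w)" using assms by (simp add: represents_def)
qed

text \<open>Induction on the budget b. A frame runs from u with no neighbour treated to u with all
  treated and restores the memory below sp. Either u is the root or the root is on the path; as
  everything below r is occupied, a free neighbour is then larger than r, which tells a return from
  the end of the search. A push takes three cells and occupies one free vertex, which bounds the
  stack. Accuracy and time both rest on giving a child only the budget that its elder siblings have
  left.\<close>

lemma search_frame:
  assumes "represents m \<sigma>" "\<And>w. w < n \<Longrightarrow> \<sigma> w \<le> n" "\<And>w. w < r \<Longrightarrow> \<sigma> w \<noteq> 0" "u < n" "\<sigma> u = 0" "u = r \<or> \<sigma> r \<noteq> 0"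
    and "search_state R0 u 0 U (int b) sp m s" "n * n + n \<le> sp"
    and "sp + 3 * card {w. w < n \<and> \<sigma> w = 0} \<le> n * n + 4 * n" "b \<le> M"
  shows "\<exists>k s' p b' m'. iters x W 21 search_step 50 k s s' \<and> search_state R0 u n p b' sp m' s' \<and>
    (\<forall>a<sp. m' a = m a) \<and> k \<le> 2 * n * 2 ^ b \<and> 0 \<le> p \<and> p \<le> S \<and>
    \<bar>p / S - path_ratio a g \<mu> n E \<sigma> u\<bar> \<le> (1/2) ^ b + 3 * (1 / S)"
  using assms
proof (induction b arbitrary: m \<sigma> u sp s rule: less_induct)
  case (less b)
  note mem = \<open>represents m \<sigma>\<close> and \<sigma>n = \<open>\<And>w. w < n \<Longrightarrow> \<sigma> w \<le> n\<close> and \<sigma>r = \<open>\<And>w. w < r \<Longrightarrow> \<sigma> w \<noteq> 0\<close>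
    and u = \<open>u < n\<close> \<open>\<sigma> u = 0\<close> and ur = \<open>u = r \<or> \<sigma> r \<noteq> 0\<close> and s0 = \<open>search_state R0 u 0 U (int b) sp m s\<close> and sp = \<open>n * n + n \<le> sp\<close>
    and spc = \<open>sp + 3 * card {w. w < n \<and> \<sigma> w = 0} \<le> n * n + 4 * n\<close> and bM = \<open>b \<le> M\<close>
  define \<phi> where "\<phi> w = (if \<sigma> w > 0 then pin a g (\<sigma> w) u else msg a g (path_ratio a g \<mu> n E (\<sigma>(u := Suc w)) w))" for w
  \<comment> \<open>\<open>cnt\<close> is the budget used so far; the predecessor of u, whose factor
    is 1, is not charged.\<close>
  define cnt where "cnt w = card {i. i < w \<and> adj E u i \<and> \<sigma> i \<noteq> Suc u}" for w
  define Q where "Q w = \<mu> * (\<Prod>i\<in>{i. i < w \<and> adj E u i}. \<phi> i)" for w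
  have cntS: "cnt (Suc w) = cnt w + (if adj E u w \<and> \<sigma> w \<noteq> Suc u then 1 else 0)" for w
  proof -
    have "{i. i < Suc w \<and> adj E u i \<and> \<sigma> i \<noteq> Suc u} = (if adj E u w \<and> \<sigma> w \<noteq> Suc u
      then insert w {i. i < w \<and> adj E u i \<and> \<sigma> i \<noteq> Suc u} else {i. i < w \<and> adj E u i \<and> \<sigma> i \<noteq> Suc u})"
      by (auto simp: less_Suc_eq)
    then show ?thesis by (simp add: cnt_def)
  qed
  have QS: "Q (Suc w) = Q w * (if adj E u w then \<phi> w else 1)" for w
  proof -
    have "{i. i < Suc w \<and> adj E u i} = (if adj E u w then insert w {i. i < w \<and> adj E u i} else {i. i < w \<and> adj E u i})"
      by (auto simp: less_Suc_eq)
    then show ?thesis by (simp add: Q_def)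
  qed
  have cnt_le: "cnt w \<le> w" for w
  proof (induction w)
    case (Suc w)
    then show ?case by (simp add: cntS)
  qed (simp add: cnt_def)
  have X: "0 \<le> path_ratio a g \<mu> n E (\<sigma>(u := Suc w)) w" "path_ratio a g \<mu> n E (\<sigma>(u := Suc w)) w \<le> 1"
    if "w < n" "adj E u w" "\<sigma> w = 0" for w
  proof -
    have "w \<noteq> u" using that no_loop by auto
    then show "0 \<le> path_ratio a g \<mu> n E (\<sigma>(u := Suc w)) w" "path_ratio a g \<mu> n E (\<sigma>(u := Suc w)) w \<le> 1"
      using that ag fin_E by (auto intro!: path_ratio_nonneg path_ratio_le_1)
  qed
  have \<phi>1: "\<phi> w = 1" if "\<sigma> w = Suc u" for w using that by (simp add: \<phi>_def pin_def)
  have \<phi>2: "0 \<le> \<phi> w \<and> \<phi> w \<le> 1/4" if "w < n" "adj E u w" "\<sigma> w \<noteq> Suc u" for w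
    using that ag X[of w] msg_range[of a g] by (auto simp: \<phi>_def pin_def)
  \<comment> \<open>Each charged factor is at most 1/4; this smallness pays for the reduced budgets
    of the later siblings.\<close>
  have Q: "0 \<le> Q w \<and> Q w \<le> (1/4) ^ cnt w" if "w \<le> n" for w
    using that
  proof (induction w)
    case 0
    then show ?case using ag by (simp add: Q_def cnt_def)
  next
    case (Suc w)
    then have IH: "0 \<le> Q w" "Q w \<le> (1/4) ^ cnt w" by auto
    show ?case
    proof (cases "adj E u w \<and> \<sigma> w \<noteq> Suc u")
      case True
      then have "0 \<le> \<phi> w" "\<phi> w \<le> 1/4" using \<phi>2[of w] Suc.prems by auto
      then have "0 \<le> Q w * \<phi> w" "Q w * \<phi> w \<le> (1/4) ^ cnt w * (1/4)"
        using IH by (simp, intro mult_mono) auto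
      then show ?thesis using True by (simp add: QS cntS)
    qed (use IH \<phi>1 in \<open>auto simp: QS cntS\<close>)
  qed
  have Qn: "Q n = path_ratio a g \<mu> n E \<sigma> u"
    unfolding Q_def \<phi>_def by (rule path_ratio_recursion[symmetric]) (use fin_E ag u in auto)
  \<comment> \<open>The term 2 n 2^(b - cnt w) is a potential. Entering a neighbour halves it, and
    the half set free is exactly what the search below that neighbour may cost; the 2 w pays for the
    push and the return, or for a single pass.\<close>
  have inv: "\<exists>k s' P m'. iters x W 21 search_step 50 k s s' \<and> search_state R0 u w P (int b - int (cnt w)) sp m' s' \<and>
      (\<forall>a<sp. m' a = m a) \<and> k + 2 * n * 2 ^ (b - cnt w) \<le> 2 * w + 2 * n * 2 ^ b \<and> 0 \<le> P \<and> P \<le> S \<and>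
      \<bar>P / S - Q w\<bar> \<le> (1/2) ^ b + 3 * (1 / S)" if "w \<le> n" for w
    using that
  proof (induction w)
    case 0
    have "\<bar>U / S - Q 0\<bar> \<le> (1/2) ^ b + 3 * (1 / S)" using pos by (simp add: Q_def \<mu>_def)
    moreover have "cnt 0 = 0" by (simp add: cnt_def)
    ultimately show ?case
      using s0 pos by (intro exI[of _ 0] exI[of _ s] exI[of _ U] exI[of _ m]) (simp add: iters_0)
  next
    case (Suc w)
    then have w: "w < n" "w \<le> n" by auto
    from Suc.IH[OF w(2)] obtain k s1 P m1 where IH: "iters x W 21 search_step 50 k s s1"
      "search_state R0 u w P (int b - int (cnt w)) sp m1 s1" "\<forall>a<sp. m1 a = m a"
      "k + 2 * n * 2 ^ (b - cnt w) \<le> 2 * w + 2 * n * 2 ^ b" "0 \<le> P" "P \<le> S"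
      "\<bar>P / S - Q w\<bar> \<le> (1/2) ^ b + 3 * (1 / S)" by blast
    have rep1: "represents m1 \<sigma>" using represents_cong[OF mem] IH(3) sp by auto
    have m1: "m1 (u * n + w) = (if adj E u w then 1 else 0)" "m1 (n * n + w) = int (\<sigma> w)"
      using rep1 u w by (auto simp: represents_def)
    have bits: "bits (m1 (n * n + w)) \<le> v" "bits P \<le> v" "bits (int b - int (cnt w)) \<le> v"
    proof -
      have "\<sigma> w \<le> n * n + 4 * n + 4" using \<sigma>n[OF w(1)] by simp
      then show "bits (m1 (n * n + w)) \<le> v" unfolding m1 by (rule bits_nat)
      show "bits P \<le> v" using IH pos sizes bits_between by blast
      have "\<bar>int b - int (cnt w)\<bar> \<le> int M + int n" using bM cnt_le[of w] w by auto
      then show "bits (int b - int (cnt w)) \<le> v" unfolding bits_le_iff using sizes(6) by linarith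
    qed
    have go: "fst s1 21 > 0" using IH(2) by (simp add: search_state_def)
    have finish: ?case
      if st: "wp x W search_step (\<lambda>t s'. t \<le> 50 \<and> search_state R0 u (w + 1) P' (int b - int (cnt (Suc w))) sp m1 s') s1"
        and P': "0 \<le> P'" "P' \<le> S" "\<bar>P' / S - Q (Suc w)\<bar> \<le> (1/2) ^ b + 3 * (1 / S)" for P'
    proof -
      obtain s2 where s2: "search_state R0 u (w + 1) P' (int b - int (cnt (Suc w))) sp m1 s2" "iters x W 21 search_step 50 1 s1 s2"
        using iters_step[OF go st] by blast
      \<comment> \<open>With the budget used up the truncated subtraction stays at 0, so here the
        potential merely does not grow.\<close>
      have "(2::nat) ^ (b - cnt (Suc w)) \<le> 2 ^ (b - cnt w)" by (rule power_increasing) (auto simp: cntS)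
      then have "2 * n * 2 ^ (b - cnt (Suc w)) \<le> 2 * n * 2 ^ (b - cnt w)" by (intro mult_left_mono) auto
      moreover have "k + 1 + l \<le> 2 * Suc w + l''" if "l \<le> l'" "k + l' \<le> 2 * w + l''" for l l' l'' :: nat
        using that by simp
      ultimately have "k + 1 + 2 * n * 2 ^ (b - cnt (Suc w)) \<le> 2 * Suc w + 2 * n * 2 ^ b" using IH(4) by blast
      then show ?thesis using iters_trans[OF IH(1) s2(2)] s2(1) IH(3) P'
        by (intro exI[of _ "k + 1"] exI[of _ s2] exI[of _ P'] exI[of _ m1]) simp
    qed
    show ?case
    proof (cases "adj E u w")
      case False
      show ?thesis
        by (rule finish[of P]) (use step_skip[OF IH(2) u(1) w(1)] m1 False IH in \<open>simp_all add: cntS QS\<close>)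
    next
      case adj: True
      note m1a = m1(1)[unfolded if_P[OF adj]]
      have Sp: "real_of_int S > 0" using pos by simp
      show ?thesis
      proof (cases "\<sigma> w = Suc u")
        case True
        show ?thesis
          by (rule finish[of P]) (use step_parent[OF IH(2) u(1) w(1) m1a] m1(2) True adj \<phi>1[OF True] IH in \<open>simp_all add: cntS QS\<close>)
      next
        case np: False
        have cS: "cnt (Suc w) = cnt w + 1" using adj np by (simp add: cntS)
        then have bc: "int b - int (cnt (Suc w)) = int b - int (cnt w) - 1" by simp
        have QS': "Q (Suc w) = Q w * \<phi> w" using adj by (simp add: QS)
        note q = Q[OF w(2)]
        consider (g) "\<sigma> w > Suc u" | (a) "0 < \<sigma> w" "\<sigma> w < Suc u" | (free) "\<sigma> w = 0" using np by linarith
        then show ?thesis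
        proof cases
          case g
          have "\<bar>(P * G * j div (S * N)) / S - Q w * \<phi> w\<bar> \<le> (1/2) ^ b + 3 * (1 / S)"
            by (rule factor_error[OF pin_g_bounds(3)[OF IH(5,6)] ag(3,4) _ _ _ IH(7), where e = 0 and c = "cnt w"])
              (use q g Sp in \<open>auto simp: \<phi>_def pin_def\<close>)
          then show ?thesis
            using step_pin_g[OF IH(2) u(1) w(1) m1a _ bits] m1(2) g pin_g_bounds[OF IH(5,6)]
            by (intro finish[of "P * G * j div (S * N)"]) (simp_all add: bc QS')
        next
          case a
          have "\<bar>real_of_int (msg_int S B G N j 0 P) / S - P / S * msg a g 0\<bar> \<le> 1 / S"
            using msg_int_bounds(3)[OF IH(5,6), of 0] by simp
          then have "\<bar>real_of_int (msg_int S B G N j 0 P) / S - P / S * a\<bar> \<le> 1 / S" by (simp add: msg_def)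
          then have "\<bar>msg_int S B G N j 0 P / S - Q w * \<phi> w\<bar> \<le> (1/2) ^ b + 3 * (1 / S)"
            by (rule factor_error[OF _ ag(1,2) _ _ _ IH(7), where e = 0 and c = "cnt w"])
              (use q a Sp in \<open>auto simp: \<phi>_def pin_def\<close>)
          then show ?thesis
            using step_pin_a[OF IH(2) u(1) w(1) m1a _ _ bits] m1(2) a msg_int_bounds[OF IH(5,6), of 0]
            by (intro finish[of "msg_int S B G N j 0 P"]) (simp_all add: bc QS')
        next
          case free
          define X where "X = path_ratio a g \<mu> n E (\<sigma>(u := Suc w)) w"
          have X01: "0 \<le> X" "X \<le> 1" using X[OF w(1) adj free] by (auto simp: X_def)
          have \<phi>X: "\<phi> w = msg a g X" using free by (simp add: \<phi>_def X_def)
          show ?thesis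
          proof (cases "int b - int (cnt w) \<le> 1")
            case cut: True
            have "\<bar>real_of_int (msg_int S B G N j 0 P) / S - P / S * msg a g 0\<bar> \<le> 1 / S"
              using msg_int_bounds(3)[OF IH(5,6), of 0] by simp
            then have "\<bar>msg_int S B G N j 0 P / S - Q w * \<phi> w\<bar> \<le> (1/2) ^ b + 3 * (1 / S)"
            proof (rule factor_error[OF _ _ _ _ _ _ IH(7), where e = "1/16" and c = "cnt w"])
              show "0 \<le> msg a g 0" "msg a g 0 \<le> 1/4" using msg_range[of a g 0] ag by auto
              show "\<bar>msg a g 0 - \<phi> w\<bar> \<le> 1 / 16"
                using msg_lipschitz[of a g 0 X] ag X01 by (simp add: \<phi>X)
              \<comment> \<open>A cut means b \<le> cnt w + 1, so the exponent 2 cnt w + 4 is at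
                least b + 3.\<close>
              have "(1/4 :: real) ^ cnt w * (1/16) = (1/2) ^ (2 * cnt w + 4)" by (simp add: power_mult power_add power_divide)
              also have "\<dots> \<le> (1/2) ^ (b + 3)" using cut by (intro power_decreasing) auto
              finally show "(1/4) ^ cnt w * (1/16) \<le> (1/2) ^ b / 8 + 1 / real_of_int S"
                using Sp by (simp add: power_add power_divide add_increasing2)
            qed (use q in auto)
            then show ?thesis
              using step_cut[OF IH(2) u(1) w(1) m1a _ cut bits(2,3)] m1(2) free msg_int_bounds[OF IH(5,6), of 0]
              by (intro finish[of "msg_int S B G N j 0 P"]) (simp_all add: bc QS')
          next
            case False
            define b2 where "b2 = b - cnt w - 1"
            have b2: "int b2 = int b - int (cnt w) - 1" "b2 < b" "b2 \<le> M" "b2 = b - cnt (Suc w)"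
              using False bM by (auto simp: b2_def cS)
            define m2 where "m2 = m1(sp := int u, sp + 1 := P, sp + 2 := int b - int (cnt w) - 1, n * n + u := int w + 1)"
            have cardf: "card {i. i < n \<and> (\<sigma>(u := Suc w)) i = 0} + 1 = card {i. i < n \<and> \<sigma> i = 0}"
            proof -
              have "{i. i < n \<and> \<sigma> i = 0} = insert u {i. i < n \<and> (\<sigma>(u := Suc w)) i = 0}" using u by auto
              then show ?thesis by simp
            qed
            have spb: "sp \<le> n * n + 4 * n" using spc by simp
            have "wp x W search_step (\<lambda>t s'. t \<le> 50 \<and> search_state R0 w 0 U (int b2) (sp + 3) m2 s') s1"
              unfolding b2(1) m2_def
              by (rule step_push[OF IH(2) u(1) w(1) m1a _ _ bits(2,3) spb]) (use m1(2) free False in auto)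
            then obtain s2 where s2: "search_state R0 w 0 U (int b2) (sp + 3) m2 s2" "iters x W 21 search_step 50 1 s1 s2"
              using iters_step[OF go] by blast
            have rep2: "represents m2 (\<sigma>(u := Suc w))"
            proof -
              have "represents (m1(n * n + u := int (Suc w))) (\<sigma>(u := Suc w))" by (rule represents_upd[OF rep1 u(1)])
              then show ?thesis by (rule represents_cong) (use sp u in \<open>auto simp: m2_def\<close>)
            qed
            have wu: "w \<noteq> u" using adj no_loop by auto
            have "\<exists>k s' p b' m'. iters x W 21 search_step 50 k s2 s' \<and> search_state R0 w n p b' (sp + 3) m' s' \<and>
              (\<forall>a<sp + 3. m' a = m2 a) \<and> k \<le> 2 * n * 2 ^ b2 \<and> 0 \<le> p \<and> p \<le> S \<and>
              \<bar>p / S - path_ratio a g \<mu> n E (\<sigma>(u := Suc w)) w\<bar> \<le> (1/2) ^ b2 + 3 * (1 / S)"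
            proof (rule less.IH[OF b2(2) rep2 _ _ w(1) _ _ s2(1) _ _ b2(3)])
              show "(\<sigma>(u := Suc w)) i \<le> n" if "i < n" for i using that \<sigma>n w by auto
              show "(\<sigma>(u := Suc w)) i \<noteq> 0" if "i < r" for i using that \<sigma>r by auto
              show "sp + 3 + 3 * card {i. i < n \<and> (\<sigma>(u := Suc w)) i = 0} \<le> n * n + 4 * n" using spc cardf by linarith
            qed (use free wu sp ur in auto)
            then obtain k3 s3 p b3 m3 where s3: "iters x W 21 search_step 50 k3 s2 s3" "search_state R0 w n p b3 (sp + 3) m3 s3"
              "\<And>a. a < sp + 3 \<Longrightarrow> m3 a = m2 a" "k3 \<le> 2 * n * 2 ^ b2" "0 \<le> p" "p \<le> S" "\<bar>p / S - X\<bar> \<le> (1/2) ^ b2 + 3 * (1 / S)"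
              unfolding X_def by blast
            have go3: "fst s3 21 > 0" using s3(2) by (simp add: search_state_def)
            \<comment> \<open>The program returns from w only if w exceeds r.\<close>
            have rw: "r < w"
            proof -
              have "\<not> w < r" using \<sigma>r free by blast
              moreover have "w \<noteq> r" using ur free wu by auto
              ultimately show ?thesis by simp
            qed
            have ne: "n * n + u \<noteq> sp" "n * n + u \<noteq> sp + 1" "n * n + u \<noteq> sp + 2" using sp u by auto
            have m3: "m3 sp = int u" "m3 (sp + 1) = P" "m3 (sp + 2) = int b - int (cnt w) - 1"
              using s3(3)[of sp] s3(3)[of "sp + 1"] s3(3)[of "sp + 2"] ne by (auto simp: m2_def)
            have bits3: "bits (int b - int (cnt w) - 1) \<le> v" "bits p \<le> v"
            proof -
              have "\<bar>int b2\<bar> \<le> int M + int n" using b2 by auto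
              then show "bits (int b - int (cnt w) - 1) \<le> v" unfolding bits_le_iff b2(1)[symmetric] using sizes(6) by linarith
              show "bits p \<le> v" using s3 sizes bits_between by blast
            qed
            have "wp x W search_step (\<lambda>t s'. t \<le> 50 \<and> search_state R0 u (w + 1) (msg_int S B G N j p P) (int b - int (cnt w) - 1) sp
               (m3(n * n + u := 0)) s') s3"
              by (rule step_pop[OF s3(2) _ _ rw w(1) u(1) m3 bits(2) bits3]) (use spb in auto)
            then obtain s4 where s4: "search_state R0 u (w + 1) (msg_int S B G N j p P) (int b - int (cnt w) - 1) sp (m3(n * n + u := 0)) s4"
              "iters x W 21 search_step 50 1 s3 s4" using iters_step[OF go3] by blast
            \<comment> \<open>The state of u is the only cell below sp that the push changes, and
              the return sets it back to 0, its value before.\<close>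
            have m4: "\<forall>a<sp. (m3(n * n + u := 0)) a = m a"
            proof (intro allI impI)
              fix a assume a: "a < sp"
              show "(m3(n * n + u := 0)) a = m a"
              proof (cases "a = n * n + u")
                case True
                then show ?thesis using mem u by (simp add: represents_def)
              next
                case False
                then have "m2 a = m1 a" using a by (simp add: m2_def)
                then show ?thesis using False s3(3)[of a] a IH(3) by simp
              qed
            qed
            have msgp: "0 \<le> msg a g (p / S)" "msg a g (p / S) \<le> 1/4" using msg_range[of a g "p / S"] ag s3(5) Sp by auto
            have err: "\<bar>msg_int S B G N j p P / S - Q w * \<phi> w\<bar> \<le> (1/2) ^ b + 3 * (1 / S)"
            proof (rule factor_error[OF msg_int_bounds(3)[OF IH(5,6) s3(5)] msgp _ _ _ IH(7),
                  where e = "((1/2) ^ b2 + 3 * (1 / S)) / 16" and c = "cnt w"])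
              have "\<bar>msg a g (p / S) - \<phi> w\<bar> \<le> \<bar>p / S - X\<bar> / 16"
                unfolding \<phi>X using ag X01 s3(5) Sp by (intro msg_lipschitz) auto
              then show "\<bar>msg a g (p / S) - \<phi> w\<bar> \<le> ((1/2) ^ b2 + 3 * (1 / S)) / 16" by (rule order_trans[OF _ divide_right_mono[OF s3(7)]]) simp
              \<comment> \<open>The exponent equals b + cnt w + 3: the cnt w factors 1/4 gain twice
                what the smaller budget loses.\<close>
              have "(1/4 :: real) ^ cnt w * (1/2) ^ b2 / 16 = (1/2) ^ (2 * cnt w + b2 + 4)" by (simp add: power_mult power_add power_divide)
              also have "\<dots> \<le> (1/2) ^ (b + 3)" using b2 False by (intro power_decreasing) (auto simp: b2_def)
              finally have 1: "(1/4 :: real) ^ cnt w * (1/2) ^ b2 / 16 \<le> (1/2) ^ b / 8" by (simp add: power_add power_divide)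
              have "(1/4 :: real) ^ cnt w * (3 * (1 / S) / 16) \<le> 1 * (3 * (1 / S) / 16)"
                using Sp by (intro mult_right_mono power_le_one) auto
              moreover have "1 * (3 * (1 / S) / 16) \<le> 1 / real_of_int S" using Sp by (simp add: field_simps)
              ultimately have 2: "(1/4 :: real) ^ cnt w * (3 * (1 / S) / 16) \<le> 1 / S" by (rule order_trans)
              have "(1/4 :: real) ^ cnt w * (((1/2) ^ b2 + 3 * (1 / S)) / 16) =
                (1/4) ^ cnt w * (1/2) ^ b2 / 16 + (1/4) ^ cnt w * (3 * (1 / S) / 16)" by (simp add: algebra_simps)
              then show "(1/4) ^ cnt w * (((1/2) ^ b2 + 3 * (1 / S)) / 16) \<le> (1/2) ^ b / 8 + 1 / real_of_int S"
                using 1 2 by linarith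
            qed (use q in auto)
            have pow: "(2::nat) ^ (b - cnt w) = 2 * 2 ^ b2"
            proof -
              have "b - cnt w = Suc b2" using False by (auto simp: b2_def)
              then show ?thesis by simp
            qed
            have cost: "k + 1 + k3 + 1 + 2 * n * 2 ^ (b - cnt (Suc w)) \<le> 2 * Suc w + 2 * n * 2 ^ b"
              using IH(4) s3(4) unfolding b2(4)[symmetric] pow by simp
            have "iters x W 21 search_step 50 (k + 1 + k3 + 1) s s4"
              using iters_trans[OF iters_trans[OF iters_trans[OF IH(1) s2(2)] s3(1)] s4(2)] .
            then show ?thesis
              using s4(1) m4 cost msg_int_bounds(1,2)[OF IH(5,6) s3(5)] err
              by (intro exI[of _ "k + 1 + k3 + 1"] exI[of _ s4] exI[of _ "msg_int S B G N j p P"] exI[of _ "m3(n * n + u := 0)"])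
                (simp add: bc QS' del: fun_upd_apply)
          qed
        qed
      qed
    qed
  qed
  from inv[OF order_refl] obtain k s' P m' where fin: "iters x W 21 search_step 50 k s s'"
    "search_state R0 u n P (int b - int (cnt n)) sp m' s'" "\<forall>a<sp. m' a = m a"
    "k + 2 * n * 2 ^ (b - cnt n) \<le> 2 * n + 2 * n * 2 ^ b" "0 \<le> P" "P \<le> S" "\<bar>P / S - Q n\<bar> \<le> (1/2) ^ b + 3 * (1 / S)" by blast
  \<comment> \<open>The potential left at the end is at least 2 n and absorbs the linear
    term.\<close>
  have "2 * n * 1 \<le> 2 * n * 2 ^ (b - cnt n)" by (intro mult_left_mono) auto
  then have "k \<le> 2 * n * 2 ^ b" using fin(4) by linarith
  then show ?case using fin unfolding Qn by blast
qed

end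

section \<open>The approximation program\<close>

text \<open>Register 3 becomes L. The first loop asks for one more bit of \<epsilon> until the
  answer is positive; the second doubles register 33 as long as n - 2^l + 1 > 0, that is 2^l \<le>
  n, and counts the doublings on top.\<close>

definition choose_precision :: "com" where
  "choose_precision =
    (block [Const 2 1, Const 3 1, Const 32 1] ;;
     WhilePos 32 (Ins (Query 33 Eps 3) ;; IfPos 33 (Ins (Const 32 0)) (Ins (Add 3 3 2))) ;;
     block [Const 33 1, Sub 32 0 33, Add 32 32 2] ;;
     WhilePos 32 (block [Add 33 33 33, Add 3 3 2, Sub 32 0 33, Add 32 32 2]))"

text \<open>The registers 4 to 7 receive m = c L, N = m \<nu>, M = 2 (m + N) and K = M + m. The
  field alone is scaled by S / (S + 1) before it is rounded, which keeps it strictly below 1 even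
  for \<mu> = 1.\<close>

definition read_parameters :: "nat \<Rightarrow> nat \<Rightarrow> com" where
  "read_parameters c \<nu> =
    (block [Const 32 (int c), Mul 4 3 32, Const 32 (int \<nu>), Mul 5 4 32, Add 6 4 5, Add 6 6 6, Add 7 6 4,
       Const 8 1, Const 33 0, Add 32 7 33] ;;
     WhilePos 32 (block [Add 8 8 8, Sub 32 32 2]) ;;
     block [Query 9 real_input.Beta 7, Query 10 real_input.Gamma 7, Query 11 Mu 7, Mul 11 11 8, Add 32 8 2, Div 11 11 32,
       Mul 12 0 0, Const 31 1, Const 1 1, Const 13 0])"

text \<open>At the nodes i / N the factor (1 - x i) / (x j - x i) is (N - i) / (j - i). Registers 29
  and 30 collect numerators and denominators exactly, so that rounding happens once per node; the
  square of j - i excludes i = j.\<close>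

definition lagrange_factor :: com where
  "lagrange_factor =
    (block [Sub 33 15 28, Mul 36 33 33] ;;
     IfPos 36 (block [Sub 36 5 28, Mul 29 29 36, Mul 30 30 33]) Skip ;;
     block [Add 28 28 2, Sub 35 4 28, Add 35 35 2])"

text \<open>A register is copied by adding one that holds 0. The stack of the search begins behind
  the matrix and the n states, at n n + n.\<close>

definition add_node :: com where
  "add_node =
    (block [Const 33 0, Add 16 13 33, Const 17 0, Add 18 11 33, Add 19 6 33, Add 20 12 0, Const 21 1] ;;
     WhilePos 21 search_step ;;
     block [Const 29 1, Const 30 1, Const 28 0, Add 35 4 2] ;;
     WhilePos 35 lagrange_factor ;;
     block [Mul 33 18 29, Div 33 33 30, Add 14 14 33, Add 15 15 2, Sub 34 4 15, Add 34 34 2])"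

text \<open>Restores the power of \<beta> that was divided out: every edge contributes B / S, at its
  larger endpoint.\<close>

definition multiply_edge :: com where
  "multiply_edge =
    (block [Mul 33 13 0, Add 33 33 28, Load 33 33] ;;
     IfPos 33 (block [Mul 31 31 9, Mul 1 1 8]) Skip ;;
     block [Add 28 28 2, Sub 34 13 28])"

text \<open>The output fraction gains the factor 1 + Y / S for the ratio Y / S of r; afterwards
  state 1 is stored for r, which pins it to spin 0 in all later searches.\<close>

definition process_vertex :: com where
  "process_vertex =
    (block [Const 14 0, Const 15 0, Add 34 4 2] ;;
     WhilePos 34 add_node ;;
     block [Add 33 8 14, Mul 31 31 33, Mul 1 1 8, Const 28 0, Sub 34 13 28] ;;
     WhilePos 34 multiply_edge ;;
     block [Add 33 12 13, Store 33 2, Add 13 13 2, Sub 32 0 13])"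

definition spin_program :: "nat \<Rightarrow> nat \<Rightarrow> com" where
  "spin_program c \<nu> =
    (choose_precision ;; read_parameters c \<nu> ;; Ins (Sub 32 0 13) ;; WhilePos 32 process_vertex ;;
     block [Const 33 0, Add 0 31 33])"

lemma wp_seq:
  assumes "wp x W c1 (\<lambda>t s'. t \<le> T1 \<and> F s') s" "\<And>s'. F s' \<Longrightarrow> wp x W c2 (\<lambda>t s''. t \<le> T2 \<and> Q s'') s'"
    and "T1 + T2 \<le> T"
  shows "wp x W (c1 ;; c2) (\<lambda>t s''. t \<le> T \<and> Q s'') s"
proof -
  have "wp x W c1 (\<lambda>t s'. wp x W c2 (\<lambda>t' s''. t + t' \<le> T \<and> Q s'') s') s"
  proof (rule wp_mono[OF assms(1)])
    fix t s' assume a: "t \<le> T1 \<and> F s'"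
    then show "wp x W c2 (\<lambda>t' s''. t + t' \<le> T \<and> Q s'') s'"
      by (intro wp_mono[OF assms(2)[of s']]) (use assms(3) in auto)
  qed
  then show ?thesis by simp
qed

lemma wp_weaken:
  assumes "wp x W c (\<lambda>t s'. t \<le> T \<and> F s') s" "\<And>s'. F s' \<Longrightarrow> F' s'" "T \<le> T'"
  shows "wp x W c (\<lambda>t s'. t \<le> T' \<and> F' s') s"
  by (rule wp_mono[OF assms(1)]) (use assms(2,3) in auto)

section \<open>Extrapolating the ratio of one vertex\<close>

locale spin_system =
  fixes x :: "real_input \<Rightarrow> real" and W v n m N M :: nat and S B G U :: int and E :: "(nat \<times> nat) set"
  assumes E: "simple_graph n E"
    and pos: "S > 0" "B > 0" "G \<ge> 0" "N > 0" "m \<le> N" "0 \<le> U" "U \<le> S"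
    and small: "4 * int m * S \<le> int N * B" "4 * G * int m \<le> S * int N"
    and sizes: "bits S \<le> v" "bits B \<le> v" "bits G \<le> v" "bits (int N) \<le> v" "int (n * n + 4 * n + 4) < 2 ^ v"
      "int M + int n < 2 ^ v"
    and W: "W \<ge> 20 * ((n + 2) * (n + 2) * ((m + 5) * (v + 1)))"
begin

text \<open>\<open>F0\<close> bounds the bits that a single factor adds to the output fraction;
  fewer than (n + 2)^2 factors then give \<open>F1\<close>.\<close>

definition F0 :: nat where "F0 = (m + 5) * (v + 1)"
definition F1 :: nat where "F1 = (n + 2) * (n + 2) * F0"

lemma W_ge: "W \<ge> 20 * F1" "F1 \<ge> F0" "F0 \<ge> v + 1" "F0 \<ge> (m + 4) * v + m + 5"
proof -
  show "W \<ge> 20 * F1" using W by (simp add: F1_def F0_def)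
  show "F1 \<ge> F0" by (simp add: F1_def)
  have "1 * (v + 1) \<le> (m + 5) * (v + 1)" by (rule mult_right_mono) auto
  then show "F0 \<ge> v + 1" by (simp add: F0_def)
  show "F0 \<ge> (m + 4) * v + m + 5" by (simp add: F0_def algebra_simps)
qed

definition node_ratio :: "nat \<Rightarrow> nat \<Rightarrow> real" where
  "node_ratio r j = path_ratio (of_int (int j * S) / of_int (int N * B)) (of_int (G * int j) / of_int (S * int N))
     (of_int U / of_int S) n E (\<lambda>w. if w < r then 1 else 0) r"

definition node_weight :: "nat \<Rightarrow> real" where
  "node_weight j = lagrange_at_one m (\<lambda>i. real i / real N) j"

text \<open>The memory between two searches: vertices below r pinned, all others free.\<close>

definition represents_from :: "(nat \<Rightarrow> int) \<Rightarrow> nat \<Rightarrow> bool" where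
  "represents_from mm r \<longleftrightarrow> (\<forall>i<n. \<forall>k<n. mm (i * n + k) = (if adj E i k then 1 else 0)) \<and>
     (\<forall>w<n. mm (n * n + w) = (if w < r then 1 else 0))"

definition vertex_state :: "nat \<Rightarrow> int \<Rightarrow> int \<Rightarrow> store \<Rightarrow> bool" where
  "vertex_state r num den s \<longleftrightarrow> fst s 0 = int n \<and> fst s 2 = 1 \<and> fst s 4 = int m \<and> fst s 5 = int N \<and>
     fst s 6 = int M \<and> fst s 8 = S \<and> fst s 9 = B \<and> fst s 10 = G \<and> fst s 11 = U \<and> fst s 12 = int n * int n \<and>
     fst s 13 = int r \<and> fst s 31 = num \<and> fst s 1 = den \<and> represents_from (snd s) r"

lemma vertex_stateD:
  assumes "vertex_state r num den (R, mm)"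
  shows "R 0 = int n" "R 2 = 1" "R 4 = int m" "R 5 = int N" "R 6 = int M" "R 8 = S" "R 9 = B" "R 10 = G"
    "R 11 = U" "R 12 = int n * int n" "R 13 = int r" "R 31 = num" "R 1 = den"
  using assms by (simp_all add: vertex_state_def)

lemma bits_nat: "k \<le> n * n + 4 * n + 4 \<Longrightarrow> bits (int k) \<le> v"
  unfolding bits_le_iff using sizes(5) by linarith

lemma bits_le_nat: "k \<le> N \<Longrightarrow> bits (int k) \<le> v"
  using sizes(4) unfolding bits_le_iff by linarith

lemma operands: "bits (int n) \<le> v" "bits 0 \<le> v" "bits 1 \<le> v" "bits 2 \<le> v" "bits (int m) \<le> v" "bits (int M) \<le> v" "bits U \<le> v"
proof -
  show "bits (int n) \<le> v" "bits 0 \<le> v" "bits 1 \<le> v" "bits 2 \<le> v"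
    using bits_nat[of n] bits_nat[of 0] bits_nat[of 1] bits_nat[of 2] by simp_all
  show "bits (int m) \<le> v" using pos by (intro bits_le_nat)
  show "bits (int M) \<le> v" using sizes(6) unfolding bits_le_iff by linarith
  show "bits U \<le> v" using pos sizes(1) unfolding bits_le_iff by linarith
qed

lemma add_bound: "bits a \<le> p \<Longrightarrow> bits b \<le> q \<Longrightarrow> bits (a + b) \<le> Suc (p + q)"
  and diff_bound: "bits a \<le> p \<Longrightarrow> bits b \<le> q \<Longrightarrow> bits (a - b) \<le> Suc (p + q)"
  using bits_add[of a p b q] bits_diff[of a p b q] by simp_all

lemma cost_bound: "bits a \<le> p \<Longrightarrow> bits b \<le> q \<Longrightarrow> Suc (p + q) \<le> W \<Longrightarrow> Suc (bits a + bits b) \<le> W"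
  by simp

lemma nat_address: "nat (int a * int b + int c) = a * b + c" "nat (int a + int b) = a + b"
  by (simp_all flip: of_nat_mult of_nat_add)

lemmas exec = cost_simps effect_simps nat_address
lemmas rules = bits_mult add_bound diff_bound bits_div operands sizes(1-4)

text \<open>The frame of the root with the full budget M and an empty stack, followed by one more
  iteration, in which the root clears the loop flag.\<close>

lemma while_search:
  assumes s: "vertex_state r num den s" and r: "r < n" and j: "j \<le> m" and R: "fst s 15 = int j" "fst s 16 = int r" "fst s 17 = 0"
    "fst s 18 = U" "fst s 19 = int M" "fst s 20 = int (n * n + n)" "fst s 21 = 1"
  shows "wp x W (WhilePos 21 search_step) (\<lambda>t s'. t \<le> 51 * (2 * n * 2 ^ M + 1) + 2 \<and>
    (\<forall>q. q \<notin> {16..26} \<longrightarrow> fst s' q = fst s q) \<and> represents_from (snd s') r \<and>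
    0 \<le> fst s' 18 \<and> fst s' 18 \<le> S \<and> \<bar>fst s' 18 / S - node_ratio r j\<bar> \<le> (1/2) ^ M + 3 * (1 / S)) s"
proof -
  note R0 = vertex_stateD[of r num den "fst s" "snd s"]
  interpret search_graph x W v n r M S B G U "int N" "int j" "fst s" E
  proof
    have s': "vertex_state r num den (fst s, snd s)" using s by simp
    show "fst s 0 = int n" "fst s 2 = 1" "fst s 5 = int N" "fst s 8 = S" "fst s 9 = B" "fst s 10 = G" "fst s 11 = U"
      "fst s 12 = int (n * n)" "fst s 13 = int r" using R0[OF s'] by simp_all
    show "4 * int j * S \<le> int N * B"
    proof -
      have "int j * (4 * S) \<le> int m * (4 * S)" using j pos by (intro mult_right_mono) auto
      then show ?thesis using small(1) by (simp add: mult_ac)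
    qed
    show "4 * G * int j \<le> S * int N"
    proof -
      have "(4 * G) * int j \<le> (4 * G) * int m" using j pos by (intro mult_left_mono) auto
      then show ?thesis using small(2) by (simp add: mult_ac)
    qed
    show "W \<ge> 20 * v + 20" using W_ge by linarith
  qed (use R pos j sizes E in auto)
  define \<sigma> :: "nat \<Rightarrow> nat" where "\<sigma> w = (if w < r then 1 else 0)" for w
  have rep: "represents (snd s) \<sigma>"
    using s by (auto simp: vertex_state_def represents_from_def represents_def \<sigma>_def)
  have st: "search_state (fst s) r 0 U (int M) (n * n + n) (snd s) s"
    using R by (simp add: search_state_def)
  have "card {w. w < n \<and> \<sigma> w = 0} \<le> card {..<n}" by (rule card_mono) auto
  then have card: "n * n + n + 3 * card {w. w < n \<and> \<sigma> w = 0} \<le> n * n + 4 * n" by simp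
  have "\<exists>k s' p b' m'. iters x W 21 search_step 50 k s s' \<and> search_state (fst s) r n p b' (n * n + n) m' s' \<and>
    (\<forall>a<n * n + n. m' a = snd s a) \<and> k \<le> 2 * n * 2 ^ M \<and> 0 \<le> p \<and> p \<le> S \<and>
    \<bar>p / S - path_ratio a g \<mu> n E \<sigma> r\<bar> \<le> (1/2) ^ M + 3 * (1 / S)"
    by (rule search_frame[OF rep _ _ r _ _ st order_refl card order_refl]) (use r in \<open>auto simp: \<sigma>_def\<close>)
  then obtain k s' p b' m' where 1: "iters x W 21 search_step 50 k s s'" "search_state (fst s) r n p b' (n * n + n) m' s'"
    "\<forall>a<n * n + n. m' a = snd s a" "k \<le> 2 * n * 2 ^ M" "0 \<le> p" "p \<le> S"
    "\<bar>p / S - path_ratio a g \<mu> n E \<sigma> r\<bar> \<le> (1/2) ^ M + 3 * (1 / S)" by blast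
  have go: "fst s' 21 > 0" using 1(2) by (simp add: search_state_def)
  obtain s2 where s2: "snd s2 = m' \<and> fst s2 18 = p \<and> fst s2 21 = 0 \<and> (\<forall>q. q \<notin> {16..26} \<longrightarrow> fst s2 q = fst s q)"
    "iters x W 21 search_step 50 1 s' s2"
    using iters_step[OF go step_finish[OF 1(2) r]] by blast
  have it: "iters x W 21 search_step 50 (k + 1) s s2" by (rule iters_trans[OF 1(1) s2(2)])
  have rep2: "represents_from (snd s2) r"
  proof -
    have "represents m' \<sigma>" by (rule represents_cong[OF rep]) (use 1(3) in auto)
    then show ?thesis using s2(1) by (auto simp: represents_from_def represents_def \<sigma>_def)
  qed
  have "wp x W (WhilePos 21 search_step) (\<lambda>t s''. t \<le> (50 + 1) * (k + 1) + 2 \<and> s'' = s2) s"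
    by (rule wp_while_iters[OF it]) (use s s2 in \<open>auto simp: vertex_state_def\<close>)
  then show ?thesis
  proof (rule wp_weaken)
    fix s'' assume "s'' = s2"
    then show "(\<forall>q. q \<notin> {16..26} \<longrightarrow> fst s'' q = fst s q) \<and> represents_from (snd s'') r \<and>
    0 \<le> fst s'' 18 \<and> fst s'' 18 \<le> S \<and> \<bar>fst s'' 18 / S - node_ratio r j\<bar> \<le> (1/2) ^ M + 3 * (1 / S)"
      using s2(1) rep2 1 by (simp add: node_ratio_def a_def g_def \<mu>_def \<sigma>_def[abs_def])
  next
    show "(50 + 1) * (k + 1) + 2 \<le> 51 * (2 * n * 2 ^ M + 1) + 2" using 1(4) by simp
  qed
qed

lemma bits_between: "0 \<le> a \<Longrightarrow> a \<le> c \<Longrightarrow> bits c \<le> w \<Longrightarrow> bits a \<le> w"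
  unfolding bits_le_iff by linarith

lemma lagrange_loop:
  assumes s: "fst s 2 = 1" "fst s 4 = int m" "fst s 5 = int N" "fst s 15 = int j" "fst s 28 = 0" "fst s 29 = 1" "fst s 30 = 1"
     "fst s 35 = int m + 1" and j: "j \<le> m"
  shows "wp x W (WhilePos 35 lagrange_factor) (\<lambda>t s'. t \<le> 21 * (m + 1) + 2 \<and> snd s' = snd s \<and>
    (\<forall>q. q \<notin> {28, 29, 30, 33, 35, 36} \<longrightarrow> fst s' q = fst s q) \<and>
    fst s' 29 = (\<Prod>i\<in>{..m} - {j}. int N - int i) \<and> fst s' 30 = (\<Prod>i\<in>{..m} - {j}. int j - int i) \<and>
    bits (fst s' 29) \<le> (m + 2) * v \<and> bits (fst s' 30) \<le> (m + 2) * v) s"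
proof -
  define I where "I k s' \<longleftrightarrow> k \<le> m + 1 \<and> snd s' = snd s \<and>
    (\<forall>q. q \<notin> {28, 29, 30, 33, 35, 36} \<longrightarrow> fst s' q = fst s q) \<and> fst s' 28 = int (m + 1 - k) \<and> fst s' 35 = int k \<and>
    fst s' 29 = (\<Prod>i\<in>{..<m + 1 - k} - {j}. int N - int i) \<and> fst s' 30 = (\<Prod>i\<in>{..<m + 1 - k} - {j}. int j - int i) \<and>
    bits (fst s' 29) \<le> (m + 2 - k) * v \<and> bits (fst s' 30) \<le> (m + 2 - k) * v" for k s'
  have "wp x W (WhilePos 35 lagrange_factor) (\<lambda>t s'. t \<le> (20 + 1) * (m + 1) + 2 \<and> I 0 s') s"
  proof (rule wp_while_inv[where I = I])
    show "I (m + 1) s" using s operands by (simp add: I_def)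
    show "fst s 2 > 0" using s by simp
  next
    fix k s1 assume "I k s1" "\<not> fst s1 35 > 0"
    then show "I 0 s1" by (cases "k = 0") (auto simp: I_def)
  next
    fix k s1 assume I: "I k s1" and go: "fst s1 35 > 0"
    then have k: "k > 0" by (auto simp: I_def)
    then obtain k' where k': "k = Suc k'" by (cases k) auto
    define i where "i = m + 1 - k"
    have km: "k' \<le> m" using I k' by (simp add: I_def)
    have i: "i \<le> m" "m + 1 - k' = Suc i" "m + 2 - k = Suc i" "m + 2 - k' = Suc (Suc i)" "int k' = int m - int i"
      using k' km by (auto simp: i_def)
    obtain R where s1: "s1 = (R, snd s)" using I by (cases s1) (auto simp: I_def)
    have R: "R 2 = 1" "R 4 = int m" "R 5 = int N" "R 15 = int j" "R 28 = int i"
      "R 29 = (\<Prod>i\<in>{..<i} - {j}. int N - int i)" "R 30 = (\<Prod>i\<in>{..<i} - {j}. int j - int i)"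
      "bits (R 29) \<le> Suc i * v" "bits (R 30) \<le> Suc i * v" and
      R': "\<And>q. q \<notin> {28, 29, 30, 33, 35, 36} \<Longrightarrow> R q = fst s q"
    proof -
      note I' = I[unfolded I_def s1 fst_conv snd_conv, folded i_def, unfolded i(3)]
      show R': "\<And>q. q \<notin> {28, 29, 30, 33, 35, 36} \<Longrightarrow> R q = fst s q" using I' by blast
      show "R 2 = 1" "R 4 = int m" "R 5 = int N" "R 15 = int j" using s by (simp_all add: R')
      show "R 28 = int i" "R 29 = (\<Prod>i\<in>{..<i} - {j}. int N - int i)" "R 30 = (\<Prod>i\<in>{..<i} - {j}. int j - int i)"
        "bits (R 29) \<le> Suc i * v" "bits (R 30) \<le> Suc i * v" using I' by blast+
    qed
    have bN: "bits (int N - int i) \<le> v" using i(1) pos sizes(4) unfolding bits_le_iff by linarith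
    have bj: "bits (int j - int i) \<le> v"
      using i(1) j pos sizes(4) unfolding bits_le_iff by linarith
    have bi: "bits (int i) \<le> v" "bits (int j) \<le> v" using i(1) j pos by (auto intro: bits_le_nat)
    have Wi: "Suc i * v + v + 4 \<le> W" "Suc i * v + 3 * v + 4 \<le> W"
    proof -
      have "Suc i * v \<le> (m + 1) * v" using i(1) by (intro mult_right_mono) auto
      moreover have "(m + 1) * v + 3 * v = (m + 4) * v" by (simp add: algebra_simps)
      ultimately have "Suc i * v + 3 * v \<le> (m + 4) * v" by linarith
      then show "Suc i * v + 3 * v + 4 \<le> W" "Suc i * v + v + 4 \<le> W" using W_ge by linarith+
    qed
    have W20: "20 * v + 20 \<le> W" using W_ge by linarith
    have ext: "{..<Suc i} - {j} = (if i = j then {..<i} - {j} else insert i ({..<i} - {j}))"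
      by (auto simp: less_Suc_eq)
    have prodS: "(\<Prod>l\<in>{..<Suc i} - {j}. f l) = (if i = j then 1 else f i) * (\<Prod>l\<in>{..<i} - {j}. f l)" for f :: "nat \<Rightarrow> int"
      unfolding ext by auto
    have b': "bits (R 29 * (int N - int i)) \<le> Suc i * v + v" "bits (R 30 * (int j - int i)) \<le> Suc i * v + v"
      using bits_mult R(8,9) bN bj by blast+
    have fin: "I k' (R2, snd s)"
      if "R2 28 = int i + 1" "R2 35 = int m - int i" "R2 29 = (if i = j then R 29 else R 29 * (int N - int i))"
        "R2 30 = (if i = j then R 30 else R 30 * (int j - int i))" "\<And>q. q \<notin> {28, 29, 30, 33, 35, 36} \<Longrightarrow> R2 q = R q" for R2
    proof -
      have "R2 29 = (\<Prod>l\<in>{..<Suc i} - {j}. int N - int l)" "R2 30 = (\<Prod>l\<in>{..<Suc i} - {j}. int j - int l)"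
        unfolding prodS that(3,4) R(6,7) by simp_all
      moreover have "bits (R2 29) \<le> Suc (Suc i) * v" "bits (R2 30) \<le> Suc (Suc i) * v"
      proof -
        have "Suc i * v \<le> Suc (Suc i) * v" "Suc i * v + v \<le> Suc (Suc i) * v" by simp_all
        note le = order_trans[OF R(8) this(1)] order_trans[OF R(9) this(1)] order_trans[OF b'(1) this(2)] order_trans[OF b'(2) this(2)]
        show "bits (R2 29) \<le> Suc (Suc i) * v" "bits (R2 30) \<le> Suc (Suc i) * v"
          unfolding that(3,4) using le by (cases "i = j"; simp only: if_True if_False)+
      qed
      ultimately show ?thesis
        unfolding I_def i(2,4,5) fst_conv snd_conv using that km R' by auto
    qed
    have "wp x W lagrange_factor (\<lambda>t s'. t \<le> 20 \<and> I k' s') (R, snd s)"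
    proof (cases "i = j")
      case True
      show ?thesis
        unfolding lagrange_factor_def
        by (simp add: exec R(1-5) True, intro conjI;
          ((rule cost_bound, (rule rules bi bN bj R(8,9))+, use W20 Wi in linarith) | (use W20 in linarith) |
           (rule fin; simp add: True)))
    next
      case False
      have c: "0 < (int j - int i) * (int j - int i)" using False by (simp add: zero_less_mult_iff) linarith
      show ?thesis
        unfolding lagrange_factor_def
        by (simp add: exec R(1-5) c, intro conjI;
          ((rule cost_bound, (rule rules bi bN bj R(8,9))+, use W20 Wi in linarith) | (use W20 in linarith) |
           (rule fin; simp add: False)))
    qed
    then show "\<exists>j. k = Suc j \<and> wp x W lagrange_factor (\<lambda>t s'. t \<le> 20 \<and> I j s') s1" using k' s1 by simp
  qed
  then show ?thesis
  proof (rule wp_weaken)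
    fix s' assume "I 0 s'"
    then show "snd s' = snd s \<and>
    (\<forall>q. q \<notin> {28, 29, 30, 33, 35, 36} \<longrightarrow> fst s' q = fst s q) \<and>
    fst s' 29 = (\<Prod>i\<in>{..m} - {j}. int N - int i) \<and> fst s' 30 = (\<Prod>i\<in>{..m} - {j}. int j - int i) \<and>
    bits (fst s' 29) \<le> (m + 2) * v \<and> bits (fst s' 30) \<le> (m + 2) * v"
      unfolding I_def diff_zero Suc_eq_plus1[symmetric] lessThan_Suc_atMost by blast
  qed simp
qed

text \<open>The error per node is the accuracy of the search, weighted, and one unit for the
  division by the Lagrange denominator. Each addition may lengthen the sum by a bit.\<close>

definition partial_sum :: "nat \<Rightarrow> nat \<Rightarrow> int \<Rightarrow> bool" where
  "partial_sum r k Y \<longleftrightarrow> \<bar>Y / S - (\<Sum>j<k. node_weight j * node_ratio r j)\<bar> \<le>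
     (\<Sum>j<k. \<bar>node_weight j\<bar> * ((1/2) ^ M + 3 / S) + 1 / S) \<and> bits Y \<le> (m + 3) * v + k + 1"

lemma add_node_correct:
  assumes s: "vertex_state r num den s" "fst s 14 = Y" "fst s 15 = int j" and Y: "partial_sum r j Y"
    and r: "r < n" and j: "j \<le> m"
  shows "wp x W add_node (\<lambda>t s'. t \<le> 51 * (2 * n * 2 ^ M + 1) + 21 * (m + 1) + 30 \<and> vertex_state r num den s' \<and>
    fst s' 15 = int (j + 1) \<and> fst s' 34 = int m - int j \<and> partial_sum r (j + 1) (fst s' 14)) s"
proof -
  obtain R mm where sR: "s = (R, mm)" by fastforce
  note R = vertex_stateD[OF s(1)[unfolded sR]]
  have R15: "R 14 = Y" "R 15 = int j" using s sR by auto
  have W20: "20 * v + 20 \<le> W" using W_ge by linarith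
  have br: "bits (int r) \<le> v" "bits (int j) \<le> v" using r j pos by (auto intro: bits_nat bits_le_nat)
  define R1 where "R1 = R(33 := 0, 16 := int r, 17 := 0, 18 := U, 19 := int M, 20 := int n * int n + int n, 21 := 1)"
  have v1: "vertex_state r num den (R1, mm)" using s(1) by (simp add: sR vertex_state_def R1_def)
  define s1 where "s1 = (R1, mm)"
  have prefix: "wp x W (block [Const 33 0, Add 16 13 33, Const 17 0, Add 18 11 33, Add 19 6 33, Add 20 12 0, Const 21 1])
    (\<lambda>t s'. t \<le> 7 \<and> s' = s1) s"
    unfolding sR s1_def R1_def
    by (simp add: exec R, intro conjI; ((rule cost_bound, (rule rules br)+, use W20 in linarith) | (use W20 in linarith) | simp)?)
  define F where "F s' \<longleftrightarrow> (\<forall>q. q \<notin> {16..26} \<longrightarrow> fst s' q = R1 q) \<and> represents_from (snd s') r \<and>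
    0 \<le> fst s' 18 \<and> fst s' 18 \<le> S \<and> \<bar>fst s' 18 / S - node_ratio r j\<bar> \<le> (1/2) ^ M + 3 * (1 / S)" for s' :: store
  have search: "wp x W (WhilePos 21 search_step) (\<lambda>t s'. t \<le> 51 * (2 * n * 2 ^ M + 1) + 2 \<and> F s') s1"
  proof (rule wp_mono[OF while_search[OF v1[folded s1_def] r j]])
    show "fst s1 15 = int j" "fst s1 16 = int r" "fst s1 17 = 0" "fst s1 18 = U" "fst s1 19 = int M"
      "fst s1 20 = int (n * n + n)" "fst s1 21 = 1" using R15 by (simp_all add: s1_def R1_def)
  qed (auto simp: F_def s1_def)
  have rest: "wp x W (block [Const 29 1, Const 30 1, Const 28 0, Add 35 4 2] ;; WhilePos 35 lagrange_factor ;;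
     block [Mul 33 18 29, Div 33 33 30, Add 14 14 33, Add 15 15 2, Sub 34 4 15, Add 34 34 2])
     (\<lambda>t s'. t \<le> 21 * (m + 1) + 12 \<and> vertex_state r num den s' \<and>
    fst s' 15 = int (j + 1) \<and> fst s' 34 = int m - int j \<and> partial_sum r (j + 1) (fst s' 14)) s2" if F: "F s2" for s2
  proof -
    obtain R2 m2 where s2: "s2 = (R2, m2)" by fastforce
    have R2q: "R2 q = R1 q" if "q \<notin> {16..26}" for q using F that unfolding F_def s2 by auto
    have R2: "R2 0 = int n" "R2 2 = 1" "R2 4 = int m" "R2 5 = int N"
    "R2 6 = int M" "R2 8 = S" "R2 9 = B" "R2 10 = G" "R2 11 = U" "R2 12 = int n * int n" "R2 13 = int r" "R2 31 = num" "R2 1 = den"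
    "R2 14 = Y" "R2 15 = int j"
      using R R15 by (simp_all add: R2q R1_def)
    define p where "p = R2 18"
    have p: "0 \<le> p" "p \<le> S" "\<bar>p / S - node_ratio r j\<bar> \<le> (1/2) ^ M + 3 * (1 / S)" "represents_from m2 r"
      using F by (auto simp: F_def s2 p_def)
    define R3 where "R3 = R2(29 := 1, 30 := 1, 28 := 0, 35 := int m + 1)"
    have pre3: "wp x W (block [Const 29 1, Const 30 1, Const 28 0, Add 35 4 2]) (\<lambda>t s'. t \<le> 4 \<and> s' = (R3, m2)) s2"
      unfolding s2 R3_def
      by (simp add: exec R2, intro conjI; ((rule cost_bound, (rule rules)+, use W20 in linarith) | (use W20 in linarith) | simp)?)
    define A C where "A = (\<Prod>i\<in>{..m} - {j}. int N - int i)" and "C = (\<Prod>i\<in>{..m} - {j}. int j - int i)"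
    have loop: "wp x W (WhilePos 35 lagrange_factor) (\<lambda>t s'. t \<le> 21 * (m + 1) + 2 \<and> snd s' = m2 \<and>
      (\<forall>q. q \<notin> {28, 29, 30, 33, 35, 36} \<longrightarrow> fst s' q = R3 q) \<and> fst s' 29 = A \<and> fst s' 30 = C \<and>
      bits A \<le> (m + 2) * v \<and> bits C \<le> (m + 2) * v) (R3, m2)"
      by (rule wp_mono[OF lagrange_loop[of "(R3, m2)" j]]) (use R2 j in \<open>auto simp: R3_def A_def C_def\<close>)
    let ?post = "\<lambda>t0 t s'. t \<le> (t0 :: nat) \<and> vertex_state r num den s' \<and> fst s' 15 = int (j + 1) \<and>
      fst s' 34 = int m - int j \<and> partial_sum r (j + 1) (fst s' 14)"
    have post: "wp x W (block [Mul 33 18 29, Div 33 33 30, Add 14 14 33, Add 15 15 2, Sub 34 4 15, Add 34 34 2]) (?post 6) s4"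
      if s4: "snd s4 = m2 \<and> (\<forall>q. q \<notin> {28, 29, 30, 33, 35, 36} \<longrightarrow> fst s4 q = R3 q) \<and> fst s4 29 = A \<and> fst s4 30 = C \<and>
        bits A \<le> (m + 2) * v \<and> bits C \<le> (m + 2) * v" for s4
    proof -
      obtain R4 where s4R: "s4 = (R4, m2)" using s4 by (metis prod.collapse)
      have R4q: "R4 q = R3 q" if "q \<notin> {28, 29, 30, 33, 35, 36}" for q using s4 that by (auto simp: s4R)
      have R4: "R4 0 = int n" "R4 2 = 1" "R4 4 = int m" "R4 5 = int N"
        "R4 6 = int M" "R4 8 = S" "R4 9 = B" "R4 10 = G" "R4 11 = U" "R4 12 = int n * int n" "R4 13 = int r" "R4 31 = num" "R4 1 = den"
        "R4 14 = Y" "R4 15 = int j" "R4 18 = p" "R4 29 = A" "R4 30 = C"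
        using R2 s4 by (simp_all add: R4q R3_def p_def s4R)
      have bA: "bits A \<le> (m + 2) * v" "bits C \<le> (m + 2) * v" using s4 by auto
      have bp: "bits p \<le> v" using p sizes bits_between by blast
      have bY: "bits Y \<le> (m + 3) * v + j + 1" using Y by (simp add: partial_sum_def)
      have bq: "bits (p * A div C) \<le> (m + 3) * v"
      proof -
        have "bits (p * A div C) \<le> v + (m + 2) * v" by (intro bits_div bits_mult bp bA)
        then show ?thesis by (simp add: algebra_simps)
      qed
      have bY': "bits (Y + p * A div C) \<le> (m + 3) * v + (j + 1) + 1"
        using bits_add[OF bY bq] by simp
      have Wb: "(m + 3) * v + (m + 3) * v + j + 5 \<le> W" "(m + 2) * v + (m + 2) * v + v + 5 \<le> W"
      proof -
        have "(m + 3) * v \<le> (m + 4) * v" "(m + 2) * v \<le> (m + 4) * v" by (intro mult_right_mono; simp)+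
        then show "(m + 3) * v + (m + 3) * v + j + 5 \<le> W" "(m + 2) * v + (m + 2) * v + v + 5 \<le> W"
          using W_ge j by linarith+
      qed
      have new: "partial_sum r (j + 1) (Y + p * A div C)"
      proof -
        \<comment> \<open>The denominators N of the nodes cancel, and the weight is the quotient of
          the two integer products.\<close>
        have wt: "node_weight j = A / C"
        proof -
          have Nr: "real N > 0" using pos by simp
          have "node_weight j = (\<Prod>i\<in>{..m} - {j}. real_of_int (int N - int i) / real_of_int (int j - int i))"
            unfolding node_weight_def lagrange_at_one_def
          proof (intro prod.cong refl)
            fix i assume "i \<in> {..m} - {j}"
            then show "(1 - real i / real N) / (real j / real N - real i / real N) = real_of_int (int N - int i) / real_of_int (int j - int i)"
              using Nr by (simp add: diff_divide_distrib[symmetric]) (simp add: field_simps)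
          qed
          then show ?thesis by (simp add: prod_dividef A_def C_def)
        qed
        have Sp: "real_of_int S > 0" using pos by simp
        have e0: "real_of_int (p * A) / real_of_int C = p * node_weight j" by (simp add: wt)
        have "\<bar>real_of_int (p * A div C) - p * node_weight j\<bar> \<le> 1"
          using div_real_bounds[of "p * A" C] unfolding e0 by linarith
        then have "\<bar>(real_of_int (p * A div C) - p * node_weight j) / S\<bar> \<le> 1 / S"
          using Sp unfolding abs_divide by (intro frac_le) auto
        then have e1: "\<bar>real_of_int (p * A div C) / S - node_weight j * (p / S)\<bar> \<le> 1 / S"
          by (simp add: diff_divide_distrib mult.commute)
        have e2: "\<bar>node_weight j * (p / S) - node_weight j * node_ratio r j\<bar> \<le> \<bar>node_weight j\<bar> * ((1/2) ^ M + 3 / S)"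
          unfolding right_diff_distrib[symmetric] abs_mult using p(3) by (intro mult_left_mono) auto
        have e3: "\<bar>Y / S - (\<Sum>j<j. node_weight j * node_ratio r j)\<bar> \<le> (\<Sum>j<j. \<bar>node_weight j\<bar> * ((1/2) ^ M + 3 / S) + 1 / S)"
          using Y by (simp add: partial_sum_def)
        have "real_of_int (Y + p * A div C) / S = Y / S + real_of_int (p * A div C) / S" by (simp add: add_divide_distrib)
        then have "\<bar>real_of_int (Y + p * A div C) / S - (\<Sum>j<j + 1. node_weight j * node_ratio r j)\<bar> \<le>
          (\<Sum>j<j + 1. \<bar>node_weight j\<bar> * ((1/2) ^ M + 3 / S) + 1 / S)"
          using e1 e2 e3 by simp
        then show ?thesis using bY' unfolding partial_sum_def by simp
      qed
      have vs: "vertex_state r num den (R5, m2)" if "\<And>q. q \<notin> {14, 15, 28, 29, 30, 33, 34, 35, 36} \<Longrightarrow> R5 q = R4 q" for R5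
        using R4 p(4) by (simp add: vertex_state_def that)
      show ?thesis
        unfolding s4R
        by (simp add: exec R4 new[simplified], intro conjI;
          ((rule cost_bound, (rule bq rules br bp bA bY)+, use W20 Wb in linarith) | (use W20 in linarith) | (rule vs; simp))?)
    qed
    have "wp x W (WhilePos 35 lagrange_factor ;; block [Mul 33 18 29, Div 33 33 30, Add 14 14 33, Add 15 15 2, Sub 34 4 15, Add 34 34 2])
      (?post (21 * (m + 1) + 8)) (R3, m2)"
      by (rule wp_seq[OF loop post]) auto
    then have "wp x W (WhilePos 35 lagrange_factor ;; block [Mul 33 18 29, Div 33 33 30, Add 14 14 33, Add 15 15 2, Sub 34 4 15, Add 34 34 2])
      (?post (21 * (m + 1) + 8)) s'" if "s' = (R3, m2)" for s' using that by simp
    then show ?thesis by (rule wp_seq[OF pre3]) auto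
  qed
  show ?thesis
    unfolding add_node_def
  proof (rule wp_seq[OF prefix])
    fix s' assume "s' = s1"
    then show "wp x W (WhilePos 21 search_step ;; block [Const 29 1, Const 30 1, Const 28 0, Add 35 4 2] ;;
        WhilePos 35 lagrange_factor ;; block [Mul 33 18 29, Div 33 33 30, Add 14 14 33, Add 15 15 2, Sub 34 4 15, Add 34 34 2])
      (\<lambda>t s'. t \<le> 51 * (2 * n * 2 ^ M + 1) + 2 + (21 * (m + 1) + 12) \<and> vertex_state r num den s' \<and>
        fst s' 15 = int (j + 1) \<and> fst s' 34 = int m - int j \<and> partial_sum r (j + 1) (fst s' 14)) s'"
      using wp_seq[OF search rest order_refl] by simp
  qed simp
qed

end

section \<open>Loops over the nodes, the edges and the vertices\<close>

context spin_system
begin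

definition node_time :: nat where "node_time = 51 * (2 * n * 2 ^ M + 1) + 21 * (m + 1) + 30"

lemma node_loop:
  assumes s: "vertex_state r num den s" "fst s 14 = 0" "fst s 15 = 0" "fst s 34 = int m + 1" and r: "r < n"
  shows "wp x W (WhilePos 34 add_node) (\<lambda>t s'. t \<le> (node_time + 1) * (m + 1) + 2 \<and> vertex_state r num den s' \<and>
    partial_sum r (m + 1) (fst s' 14)) s"
proof -
  define I where "I k s' \<longleftrightarrow> k \<le> m + 1 \<and> vertex_state r num den s' \<and> fst s' 15 = int (m + 1 - k) \<and> fst s' 34 = int k \<and>
    partial_sum r (m + 1 - k) (fst s' 14)" for k s'
  have "wp x W (WhilePos 34 add_node) (\<lambda>t s'. t \<le> (node_time + 1) * (m + 1) + 2 \<and> I 0 s') s"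
  proof (rule wp_while_inv[where I = I])
    have "partial_sum r 0 0" by (simp add: partial_sum_def bits_le_iff)
    then show "I (m + 1) s" using s by (simp add: I_def)
    show "fst s 2 > 0" using s(1) by (simp add: vertex_state_def)
  next
    fix k s1 assume "I k s1" "\<not> fst s1 34 > 0"
    then show "I 0 s1" by (cases "k = 0") (auto simp: I_def)
  next
    fix k s1 assume I: "I k s1" and go: "fst s1 34 > 0"
    then have "k > 0" by (auto simp: I_def)
    then obtain k' where k': "k = Suc k'" by (cases k) auto
    define j where "j = m + 1 - k"
    have j: "j \<le> m" "m + 1 - k' = j + 1" "int m - int j = int k'" using I k' by (auto simp: j_def I_def)
    note I' = I[unfolded I_def, folded j_def]
    have "wp x W add_node (\<lambda>t s'. t \<le> node_time \<and> I k' s') s1"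
    proof (rule wp_weaken[OF add_node_correct[of r num den s1 "fst s1 14" j]])
      fix s' assume "vertex_state r num den s' \<and> fst s' 15 = int (j + 1) \<and> fst s' 34 = int m - int j \<and> partial_sum r (j + 1) (fst s' 14)"
      then show "I k' s'" using I' k' j unfolding I_def j(2) by simp
    qed (use I' r j in \<open>auto simp: node_time_def\<close>)
    then show "\<exists>j. k = Suc j \<and> wp x W add_node (\<lambda>t s'. t \<le> node_time \<and> I j s') s1" using k' by simp
  qed
  then show ?thesis by (rule wp_weaken) (auto simp: I_def)
qed

definition lower_degree :: "nat \<Rightarrow> nat" where
  "lower_degree r = card {w. w < r \<and> adj E r w}"

text \<open>The bit bound charges \<open>F0\<close> for every vertex below r, adjacent or not, which
  makes it independent of the graph.\<close>

lemma edge_loop: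
  assumes s: "vertex_state r num den s" "fst s 28 = 0" "fst s 34 = int r" and r: "r < n"
    and b: "bits num \<le> F0 * (2 + r * (n + 1))" "bits den \<le> F0 * (2 + r * (n + 1))"
  shows "wp x W (WhilePos 34 multiply_edge) (\<lambda>t s'. t \<le> 13 * r + 2 \<and>
    vertex_state r (num * B ^ lower_degree r) (den * S ^ lower_degree r) s' \<and>
    bits (num * B ^ lower_degree r) \<le> F0 * (2 + r * (n + 1) + r) \<and>
    bits (den * S ^ lower_degree r) \<le> F0 * (2 + r * (n + 1) + r)) s"
proof -
  define c where "c w = card {i. i < w \<and> adj E r i}" for w
  have cS: "c (Suc w) = c w + (if adj E r w then 1 else 0)" for w
  proof -
    have "{i. i < Suc w \<and> adj E r i} = (if adj E r w then insert w {i. i < w \<and> adj E r i} else {i. i < w \<and> adj E r i})"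
      by (auto simp: less_Suc_eq)
    then show ?thesis by (simp add: c_def)
  qed
  define I where "I k s' \<longleftrightarrow> k \<le> r \<and> vertex_state r (num * B ^ c (r - k)) (den * S ^ c (r - k)) s' \<and>
    fst s' 28 = int (r - k) \<and> fst s' 34 = int k \<and>
    bits (num * B ^ c (r - k)) \<le> F0 * (2 + r * (n + 1) + (r - k)) \<and>
    bits (den * S ^ c (r - k)) \<le> F0 * (2 + r * (n + 1) + (r - k))" for k s'
  have "wp x W (WhilePos 34 multiply_edge) (\<lambda>t s'. t \<le> (12 + 1) * r + 2 \<and> I 0 s') s"
  proof (rule wp_while_inv[where I = I])
    have "c 0 = 0" by (simp add: c_def)
    then show "I r s" using s b by (simp add: I_def)
    show "fst s 2 > 0" using s(1) by (simp add: vertex_state_def)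
  next
    fix k s1 assume "I k s1" "\<not> fst s1 34 > 0"
    then show "I 0 s1" by (cases "k = 0") (auto simp: I_def)
  next
    fix k s1 assume I: "I k s1" and go: "fst s1 34 > 0"
    then have "k > 0" by (auto simp: I_def)
    then obtain k' where k': "k = Suc k'" by (cases k) auto
    define w where "w = r - k"
    have w: "w < r" "r - k' = Suc w" "int r - int w = int k" "int k' = int r - (int w + 1)" using I k' by (auto simp: w_def I_def)
    note I' = I[unfolded I_def, folded w_def]
    obtain R mm where s1: "s1 = (R, mm)" by fastforce
    have vs: "vertex_state r (num * B ^ c w) (den * S ^ c w) (R, mm)" using I' s1 by simp
    note R = vertex_stateD[OF vs] vertex_stateD(13)[OF vs, unfolded One_nat_def]
    have R28: "R 28 = int w" using I' s1 by simp
    have adjm: "mm (r * n + w) = (if adj E r w then 1 else 0)"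
      using vs r w by (simp add: vertex_state_def represents_from_def)
    have bits: "bits (num * B ^ c w) \<le> F0 * (2 + r * (n + 1) + w)" "bits (den * S ^ c w) \<le> F0 * (2 + r * (n + 1) + w)"
      using I' by auto
    have bw: "bits (int r) \<le> v" "bits (int w) \<le> v" using r w by (auto intro: bits_nat)
    have le: "F0 * (2 + r * (n + 1) + w) + v \<le> F0 * (2 + r * (n + 1) + Suc w)"
      using W_ge by (simp add: algebra_simps)
    have le1: "F0 * (2 + r * (n + 1) + w) \<le> F1"
    proof -
      have "r * (n + 1) \<le> n * (n + 1)" using r by (intro mult_right_mono) auto
      then have "2 + r * (n + 1) + w \<le> (n + 2) * (n + 2)" using r w by (simp add: algebra_simps)
      then have "F0 * (2 + r * (n + 1) + w) \<le> F0 * ((n + 2) * (n + 2))" by (rule mult_left_mono) simp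
      then show ?thesis by (simp add: F1_def mult_ac)
    qed
    have Wb: "F0 * (2 + r * (n + 1) + w) + v + 20 \<le> W" "20 * v + 20 \<le> W" using W_ge le1 by linarith+
    have mult: "bits (num * B ^ c w * B) \<le> F0 * (2 + r * (n + 1) + Suc w)" "bits (den * S ^ c w * S) \<le> F0 * (2 + r * (n + 1) + Suc w)"
      using bits_mult[OF bits(1) sizes(2)] bits_mult[OF bits(2) sizes(1)] le by linarith+
    have mono: "F0 * (2 + r * (n + 1) + w) \<le> F0 * (2 + r * (n + 1) + Suc w)" using le by linarith
    have k'r: "k' \<le> r" using I k' by (simp add: I_def)
    have fin: "I k' (R2, mm)"
      if "R2 28 = int w + 1" "R2 34 = int r - (int w + 1)" "R2 31 = (if adj E r w then num * B ^ c w * B else num * B ^ c w)"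
        "R2 1 = (if adj E r w then den * S ^ c w * S else den * S ^ c w)" "\<And>q. q \<notin> {1, 28, 31, 33, 34} \<Longrightarrow> R2 q = R q" for R2
    proof -
      have e: "R2 31 = num * B ^ c (Suc w)" "R2 1 = den * S ^ c (Suc w)" unfolding that(3,4) cS by simp_all
      have "vertex_state r (num * B ^ c (Suc w)) (den * S ^ c (Suc w)) (R2, mm)"
        using vs e(2)[unfolded One_nat_def] unfolding vertex_state_def by (simp add: that(5) e(1))
      moreover have "bits (num * B ^ c (Suc w)) \<le> F0 * (2 + r * (n + 1) + Suc w)" "bits (den * S ^ c (Suc w)) \<le> F0 * (2 + r * (n + 1) + Suc w)"
        unfolding e[symmetric] that(3,4) using mult order_trans[OF bits(1) mono] order_trans[OF bits(2) mono]
        by (cases "adj E r w"; simp only: if_True if_False)+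
      ultimately show ?thesis unfolding I_def w(2) fst_conv snd_conv using that(1,2) w(4) k'r by simp
    qed
    have "wp x W multiply_edge (\<lambda>t s'. t \<le> 12 \<and> I k' s') (R, mm)"
    proof (cases "adj E r w")
      case True
      show ?thesis
        unfolding multiply_edge_def
        by (simp add: exec R R28 adjm True, intro conjI;
          ((rule cost_bound, (rule bits rules bw)+, use Wb in linarith) | (use Wb in linarith) |
           (rule fin; simp add: True)))
    next
      case False
      show ?thesis
        unfolding multiply_edge_def
        by (simp add: exec R R28 adjm False, intro conjI;
          ((rule cost_bound, (rule bits rules bw)+, use Wb in linarith) | (use Wb in linarith) |
           (rule fin; simp add: False R)))
    qed
    then show "\<exists>j. k = Suc j \<and> wp x W multiply_edge (\<lambda>t s'. t \<le> 12 \<and> I j s') s1" using k' s1 by simp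
  qed
  then show ?thesis
  proof (rule wp_weaken)
    fix s' assume "I 0 s'"
    then show "vertex_state r (num * B ^ lower_degree r) (den * S ^ lower_degree r) s' \<and>
      bits (num * B ^ lower_degree r) \<le> F0 * (2 + r * (n + 1) + r) \<and> bits (den * S ^ lower_degree r) \<le> F0 * (2 + r * (n + 1) + r)"
      unfolding I_def diff_zero c_def lower_degree_def by blast
  qed simp
qed

definition vertex_time :: nat where "vertex_time = (node_time + 1) * (m + 1) + 13 * n + 20"

text \<open>Each vertex is charged n + 1 factors of \<open>F0\<close> bits: one for its ratio and
  the others for the edges to lower vertices.\<close>

lemma process_vertex_correct:
  assumes s: "vertex_state r num den s" and r: "r < n"
    and b: "bits num \<le> F0 * (1 + r * (n + 1))" "bits den \<le> F0 * (1 + r * (n + 1))"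
  shows "wp x W process_vertex (\<lambda>t s'. t \<le> vertex_time \<and> (\<exists>Y. partial_sum r (m + 1) Y \<and> fst s' 32 = int n - int (r + 1) \<and>
    vertex_state (r + 1) (num * ((S + Y) * B ^ lower_degree r)) (den * (S * S ^ lower_degree r)) s' \<and>
    bits (num * ((S + Y) * B ^ lower_degree r)) \<le> F0 * (1 + (r + 1) * (n + 1)) \<and>
    bits (den * (S * S ^ lower_degree r)) \<le> F0 * (1 + (r + 1) * (n + 1)))) s"
proof -
  obtain R mm where sR: "s = (R, mm)" by fastforce
  note R = vertex_stateD[OF s[unfolded sR]] vertex_stateD(13)[OF s[unfolded sR], unfolded One_nat_def]
  have W20: "20 * v + 20 \<le> W" using W_ge by linarith
  have br: "bits (int r) \<le> v" using r by (auto intro: bits_nat)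
  have le1: "F0 * (2 + r * (n + 1) + r) \<le> F1"
  proof -
    have "r * (n + 1) \<le> n * (n + 1)" using r by (intro mult_right_mono) auto
    then have "2 + r * (n + 1) + r \<le> (n + 2) * (n + 2)" using r by (simp add: algebra_simps)
    then have "F0 * (2 + r * (n + 1) + r) \<le> F0 * ((n + 2) * (n + 2))" by (rule mult_left_mono) simp
    then show ?thesis by (simp add: F1_def mult_ac)
  qed
  have le0: "F0 * (1 + r * (n + 1)) + F0 = F0 * (2 + r * (n + 1))" "F0 * (2 + r * (n + 1)) \<le> F0 * (2 + r * (n + 1) + r)"
    by (simp_all add: algebra_simps)
  have le2: "F0 * (2 + r * (n + 1) + r) \<le> F0 * (1 + (r + 1) * (n + 1))"
    using r by (intro mult_left_mono) (simp_all add: algebra_simps)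
  define R1 where "R1 = R(14 := 0, 15 := 0, 34 := int m + 1)"
  have v1: "vertex_state r num den (R1, mm)" using s by (simp add: sR vertex_state_def R1_def)
  have pre: "wp x W (block [Const 14 0, Const 15 0, Add 34 4 2]) (\<lambda>t s'. t \<le> 3 \<and> s' = (R1, mm)) s"
    unfolding sR R1_def
    by (simp add: exec R, intro conjI; ((rule cost_bound, (rule rules br)+, use W20 in linarith) | (use W20 in linarith) | simp)?)
  have loop1: "wp x W (WhilePos 34 add_node) (\<lambda>t s'. t \<le> (node_time + 1) * (m + 1) + 2 \<and> vertex_state r num den s' \<and>
    partial_sum r (m + 1) (fst s' 14)) s'" if "s' = (R1, mm)" for s'
    unfolding that by (rule node_loop[OF v1 _ _ _ r]) (simp_all add: R1_def)
  define Post where "Post s' \<longleftrightarrow> (\<exists>Y. partial_sum r (m + 1) Y \<and> fst s' 32 = int n - int (r + 1) \<and>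
    vertex_state (r + 1) (num * ((S + Y) * B ^ lower_degree r)) (den * (S * S ^ lower_degree r)) s' \<and>
    bits (num * ((S + Y) * B ^ lower_degree r)) \<le> F0 * (1 + (r + 1) * (n + 1)) \<and>
    bits (den * (S * S ^ lower_degree r)) \<le> F0 * (1 + (r + 1) * (n + 1)))" for s'
  have rest: "wp x W (block [Add 33 8 14, Mul 31 31 33, Mul 1 1 8, Const 28 0, Sub 34 13 28] ;; WhilePos 34 multiply_edge ;;
     block [Add 33 12 13, Store 33 2, Add 13 13 2, Sub 32 0 13]) (\<lambda>t s'. t \<le> 5 + (13 * n + 2 + 4) \<and> Post s') s2"
    if s2: "vertex_state r num den s2 \<and> partial_sum r (m + 1) (fst s2 14)" for s2
  proof -
    obtain R2 m2 where s2R: "s2 = (R2, m2)" by fastforce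
    define Y where "Y = R2 14"
    have vs2: "vertex_state r num den (R2, m2)" and Y: "partial_sum r (m + 1) Y" using s2 by (auto simp: s2R Y_def)
    note R2 = vertex_stateD[OF vs2] vertex_stateD(13)[OF vs2, unfolded One_nat_def] Y_def[symmetric]
    have bY: "bits Y \<le> (m + 3) * v + (m + 1) + 1" using Y by (simp add: partial_sum_def)
    have bSY: "bits (S + Y) \<le> F0"
    proof -
      have "bits (S + Y) \<le> max v ((m + 3) * v + (m + 1) + 1) + 1" by (rule bits_add[OF sizes(1) bY])
      moreover have "max v ((m + 3) * v + (m + 1) + 1) + 1 \<le> F0" using W_ge by (simp add: algebra_simps)
      ultimately show ?thesis by linarith
    qed
    have Wb: "(m + 3) * v + (m + 1) + v + 20 \<le> W" "F0 * (1 + r * (n + 1)) + F0 + 1 \<le> W" "F0 * (1 + r * (n + 1)) + v + 1 \<le> W"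
    proof -
      have "(m + 3) * v + v = (m + 4) * v" by (simp add: algebra_simps)
      then show "(m + 3) * v + (m + 1) + v + 20 \<le> W" using W_ge by linarith
      show "F0 * (1 + r * (n + 1)) + F0 + 1 \<le> W" "F0 * (1 + r * (n + 1)) + v + 1 \<le> W" using le0 le1 W_ge by linarith+
    qed
    have b2: "bits (num * (S + Y)) \<le> F0 * (2 + r * (n + 1))" "bits (den * S) \<le> F0 * (2 + r * (n + 1))"
      using bits_mult[OF b(1) bSY] bits_mult[OF b(2) sizes(1)] le0 W_ge by linarith+
    define R3 where "R3 = R2(33 := S + Y, 31 := num * (S + Y), 1 := den * S, 28 := 0, 34 := int r)"
    have v3: "vertex_state r (num * (S + Y)) (den * S) (R3, m2)" using vs2 by (simp add: vertex_state_def R3_def)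
    have pre3: "wp x W (block [Add 33 8 14, Mul 31 31 33, Mul 1 1 8, Const 28 0, Sub 34 13 28]) (\<lambda>t s'. t \<le> 5 \<and> s' = (R3, m2)) s2"
      unfolding s2R R3_def
      by (simp add: exec R2, intro conjI; ((rule cost_bound, (rule b bSY bY rules br)+, use W20 Wb in linarith) | (use W20 in linarith) | simp)?)
    have loop3: "wp x W (WhilePos 34 multiply_edge) (\<lambda>t s'. t \<le> 13 * n + 2 \<and>
      vertex_state r (num * (S + Y) * B ^ lower_degree r) (den * S * S ^ lower_degree r) s' \<and>
      bits (num * (S + Y) * B ^ lower_degree r) \<le> F0 * (2 + r * (n + 1) + r) \<and>
      bits (den * S * S ^ lower_degree r) \<le> F0 * (2 + r * (n + 1) + r)) s'" if "s' = (R3, m2)" for s'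
      unfolding that by (rule wp_weaken[OF edge_loop[OF v3 _ _ r b2]]) (use r in \<open>auto simp: R3_def\<close>)
    have post: "wp x W (block [Add 33 12 13, Store 33 2, Add 13 13 2, Sub 32 0 13]) (\<lambda>t s'. t \<le> 4 \<and> Post s') s4"
      if s4: "vertex_state r (num * (S + Y) * B ^ lower_degree r) (den * S * S ^ lower_degree r) s4 \<and>
      bits (num * (S + Y) * B ^ lower_degree r) \<le> F0 * (2 + r * (n + 1) + r) \<and>
      bits (den * S * S ^ lower_degree r) \<le> F0 * (2 + r * (n + 1) + r)" for s4
    proof -
      obtain R4 m4 where s4R: "s4 = (R4, m4)" by fastforce
      have vs4: "vertex_state r (num * (S + Y) * B ^ lower_degree r) (den * S * S ^ lower_degree r) (R4, m4)" using s4 by (simp add: s4R)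
      note R4 = vertex_stateD[OF vs4] vertex_stateD(13)[OF vs4, unfolded One_nat_def]
      have rep: "represents_from (m4(n * n + r := 1)) (Suc r)"
        unfolding represents_from_def
      proof (intro conjI allI impI)
        fix i k assume ik: "i < n" "k < n"
        then have "Suc i * n \<le> n * n" by (intro mult_right_mono) auto
        then have "i * n + k < n * n" using ik by simp
        then show "(m4(n * n + r := 1)) (i * n + k) = (if adj E i k then 1 else 0)"
          using vs4 ik by (simp add: vertex_state_def represents_from_def)
      next
        fix w assume "w < n"
        then show "(m4(n * n + r := 1)) (n * n + w) = (if w < Suc r then 1 else 0)"
          using vs4 by (simp add: vertex_state_def represents_from_def)
      qed
      have P: "Post (R5, m4(n * n + r := 1))" if "R5 13 = int r + 1" "R5 32 = int n - (int r + 1)" "\<And>q. q \<notin> {13, 32, 33} \<Longrightarrow> R5 q = R4 q" for R5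
        unfolding Post_def
      proof (intro exI conjI)
        show "partial_sum r (m + 1) Y" by (rule Y)
        show "fst (R5, m4(n * n + r := 1)) 32 = int n - int (r + 1)" using that(2) by simp
        show "vertex_state (r + 1) (num * ((S + Y) * B ^ lower_degree r)) (den * (S * S ^ lower_degree r)) (R5, m4(n * n + r := 1))"
          using R4 rep that(1) by (simp add: vertex_state_def that(3) mult.assoc)
        show "bits (num * ((S + Y) * B ^ lower_degree r)) \<le> F0 * (1 + (r + 1) * (n + 1))"
          "bits (den * (S * S ^ lower_degree r)) \<le> F0 * (1 + (r + 1) * (n + 1))"
          using s4 le2 unfolding mult.assoc[symmetric] by linarith+
      qed
      show ?thesis
        unfolding s4R
        by (simp add: exec R4, intro conjI; ((rule cost_bound, (rule rules br)+, use W20 in linarith) | (use W20 in linarith) | (rule P; simp))?)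
    qed
    have "wp x W (WhilePos 34 multiply_edge ;; block [Add 33 12 13, Store 33 2, Add 13 13 2, Sub 32 0 13])
      (\<lambda>t s'. t \<le> 13 * n + 2 + 4 \<and> Post s') s'" if "s' = (R3, m2)" for s'
      by (rule wp_seq[OF loop3[OF that] post]) auto
    then show ?thesis by (rule wp_seq[OF pre3]) auto
  qed
  have "wp x W (WhilePos 34 add_node ;; block [Add 33 8 14, Mul 31 31 33, Mul 1 1 8, Const 28 0, Sub 34 13 28] ;; WhilePos 34 multiply_edge ;;
     block [Add 33 12 13, Store 33 2, Add 13 13 2, Sub 32 0 13]) (\<lambda>t s'. t \<le> (node_time + 1) * (m + 1) + 2 + (5 + (13 * n + 2 + 4)) \<and> Post s') s'"
    if "s' = (R1, mm)" for s'
    by (rule wp_seq[OF loop1[OF that] rest]) auto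
  then show ?thesis
    unfolding process_vertex_def Post_def[symmetric] by (rule wp_seq[OF pre]) (auto simp: vertex_time_def)
qed

lemma vertex_loop:
  assumes s: "vertex_state 0 1 1 s" "fst s 32 = int n"
  shows "wp x W (WhilePos 32 process_vertex) (\<lambda>t s'. t \<le> (vertex_time + 1) * n + 2 \<and>
    (\<exists>Y. (\<forall>r<n. partial_sum r (m + 1) (Y r)) \<and>
      vertex_state n (\<Prod>r<n. (S + Y r) * B ^ lower_degree r) (\<Prod>r<n. S * S ^ lower_degree r) s' \<and>
      bits (\<Prod>r<n. (S + Y r) * B ^ lower_degree r) + v + 20 \<le> W)) s"
proof -
  define I where "I k s' \<longleftrightarrow> k \<le> n \<and> fst s' 32 = int k \<and> (\<exists>Y. (\<forall>r<n - k. partial_sum r (m + 1) (Y r)) \<and>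
      vertex_state (n - k) (\<Prod>r<n - k. (S + Y r) * B ^ lower_degree r) (\<Prod>r<n - k. S * S ^ lower_degree r) s' \<and>
      bits (\<Prod>r<n - k. (S + Y r) * B ^ lower_degree r) \<le> F0 * (1 + (n - k) * (n + 1)) \<and>
      bits (\<Prod>r<n - k. S * S ^ lower_degree r) \<le> F0 * (1 + (n - k) * (n + 1)))" for k s'
  have "wp x W (WhilePos 32 process_vertex) (\<lambda>t s'. t \<le> (vertex_time + 1) * n + 2 \<and> I 0 s') s"
  proof (rule wp_while_inv[where I = I])
    have "bits 1 \<le> F0" using operands(3) W_ge by linarith
    then show "I n s" using s by (auto simp: I_def)
    show "fst s 2 > 0" using s(1) by (simp add: vertex_state_def)
  next
    fix k s1 assume "I k s1" "\<not> fst s1 32 > 0"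
    then show "I 0 s1" by (cases "k = 0") (auto simp: I_def)
  next
    fix k s1 assume I: "I k s1" and go: "fst s1 32 > 0"
    then have "k > 0" by (auto simp: I_def)
    then obtain k' where k': "k = Suc k'" by (cases k) auto
    define r where "r = n - k"
    have kn: "k \<le> n" using I by (simp add: I_def)
    have r: "r < n" "n - k' = r + 1" "int k' = int n - int (r + 1)" using kn k' by (auto simp: r_def)
    from I[unfolded I_def, folded r_def] obtain Y where Y: "\<forall>i<r. partial_sum i (m + 1) (Y i)"
      "vertex_state r (\<Prod>i<r. (S + Y i) * B ^ lower_degree i) (\<Prod>i<r. S * S ^ lower_degree i) s1"
      "bits (\<Prod>i<r. (S + Y i) * B ^ lower_degree i) \<le> F0 * (1 + r * (n + 1))"
      "bits (\<Prod>i<r. S * S ^ lower_degree i) \<le> F0 * (1 + r * (n + 1))" by blast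
    have "wp x W process_vertex (\<lambda>t s'. t \<le> vertex_time \<and> I k' s') s1"
    proof (rule wp_weaken[OF process_vertex_correct[OF Y(2) r(1) Y(3,4)]], elim exE conjE)
      fix s' Z
      assume Z: "partial_sum r (m + 1) Z" "fst s' 32 = int n - int (r + 1)"
        "vertex_state (r + 1) ((\<Prod>i<r. (S + Y i) * B ^ lower_degree i) * ((S + Z) * B ^ lower_degree r))
          ((\<Prod>i<r. S * S ^ lower_degree i) * (S * S ^ lower_degree r)) s'"
        "bits ((\<Prod>i<r. (S + Y i) * B ^ lower_degree i) * ((S + Z) * B ^ lower_degree r)) \<le> F0 * (1 + (r + 1) * (n + 1))"
        "bits ((\<Prod>i<r. S * S ^ lower_degree i) * (S * S ^ lower_degree r)) \<le> F0 * (1 + (r + 1) * (n + 1))"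
      have p: "(\<Prod>i<r + 1. (S + (Y(r := Z)) i) * B ^ lower_degree i) = (\<Prod>i<r. (S + Y i) * B ^ lower_degree i) * ((S + Z) * B ^ lower_degree r)"
        by simp
      have q: "(\<Prod>i<r + 1. S * S ^ lower_degree i) = (\<Prod>i<r. S * S ^ lower_degree i) * (S * S ^ lower_degree r)" by simp
      show "I k' s'"
        unfolding I_def r(2)
      proof (intro conjI exI[of _ "Y(r := Z)"])
        show "\<forall>i<r + 1. partial_sum i (m + 1) ((Y(r := Z)) i)" using Y(1) Z(1) by (auto simp: less_Suc_eq)
        show "k' \<le> n" using kn k' by simp
        show "fst s' 32 = int k'" using Z(2) r(3) by simp
      qed (unfold p q, rule Z(3), rule Z(4), rule Z(5))
    qed simp
    then show "\<exists>j. k = Suc j \<and> wp x W process_vertex (\<lambda>t s'. t \<le> vertex_time \<and> I j s') s1" using k' by simp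
  qed
  then show ?thesis
  proof (rule wp_weaken)
    fix s' assume "I 0 s'"
    then obtain Y where Y: "\<forall>r<n. partial_sum r (m + 1) (Y r)"
      "vertex_state n (\<Prod>r<n. (S + Y r) * B ^ lower_degree r) (\<Prod>r<n. S * S ^ lower_degree r) s'"
      "bits (\<Prod>r<n. (S + Y r) * B ^ lower_degree r) \<le> F0 * (1 + n * (n + 1))"
      unfolding I_def diff_zero by blast
    have "1 + n * (n + 1) \<le> (n + 2) * (n + 2)" by (simp add: algebra_simps)
    then have "F0 * (1 + n * (n + 1)) \<le> F0 * ((n + 2) * (n + 2))" by (rule mult_left_mono) simp
    then have "F0 * (1 + n * (n + 1)) \<le> F1" by (simp add: F1_def mult_ac)
    then have "bits (\<Prod>r<n. (S + Y r) * B ^ lower_degree r) + v + 20 \<le> W" using Y(3) W_ge by linarith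
    then show "\<exists>Y. (\<forall>r<n. partial_sum r (m + 1) (Y r)) \<and>
      vertex_state n (\<Prod>r<n. (S + Y r) * B ^ lower_degree r) (\<Prod>r<n. S * S ^ lower_degree r) s' \<and>
      bits (\<Prod>r<n. (S + Y r) * B ^ lower_degree r) + v + 20 \<le> W" using Y by blast
  qed simp
qed

end

section \<open>The precision as a function of the input\<close>

definition eps_exp :: "real \<Rightarrow> nat" where
  "eps_exp \<epsilon> = (LEAST k. 1 \<le> k \<and> 1 \<le> \<epsilon> * 2 ^ k)"

definition size_exp :: "nat \<Rightarrow> nat" where
  "size_exp n = (LEAST l. n < 2 ^ l)"

text \<open>By minimality 2^\<open>eps_exp\<close> is at most 2 / \<epsilon> unless the exponent is
  1, which is forced for large \<epsilon> and explains the summand 2.\<close>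

lemma eps_exp:
  assumes "\<epsilon> > 0"
  shows "1 \<le> eps_exp \<epsilon>" "1 \<le> \<epsilon> * 2 ^ eps_exp \<epsilon>" "1 \<le> k \<Longrightarrow> k < eps_exp \<epsilon> \<Longrightarrow> \<epsilon> * 2 ^ k < 1"
    "2 ^ eps_exp \<epsilon> \<le> 2 + 2 / \<epsilon>"
proof -
  obtain k where "1 / \<epsilon> < 2 ^ k" using real_arch_pow[of 2 "1 / \<epsilon>"] by auto
  then have "1 \<le> \<epsilon> * 2 ^ k" using assms by (simp add: field_simps)
  also have "\<dots> \<le> \<epsilon> * 2 ^ Suc k" using assms by simp
  finally have "1 \<le> Suc k \<and> 1 \<le> \<epsilon> * 2 ^ Suc k" by simp
  then have *: "1 \<le> eps_exp \<epsilon> \<and> 1 \<le> \<epsilon> * 2 ^ eps_exp \<epsilon>"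
    unfolding eps_exp_def by (rule LeastI)
  then show "1 \<le> eps_exp \<epsilon>" "1 \<le> \<epsilon> * 2 ^ eps_exp \<epsilon>" by auto
  show less: "\<epsilon> * 2 ^ k < 1" if "1 \<le> k" "k < eps_exp \<epsilon>" for k
    using not_less_Least[of k "\<lambda>k. 1 \<le> k \<and> 1 \<le> \<epsilon> * 2 ^ k"] that unfolding eps_exp_def by auto
  show "2 ^ eps_exp \<epsilon> \<le> 2 + 2 / \<epsilon>"
  proof (cases "eps_exp \<epsilon> = 1")
    case False
    then have "\<epsilon> * 2 ^ (eps_exp \<epsilon> - 1) < 1" using * by (intro less) auto
    then have "2 * 2 ^ (eps_exp \<epsilon> - 1) < 2 / \<epsilon>" using assms by (simp add: field_simps)
    moreover have "eps_exp \<epsilon> = Suc (eps_exp \<epsilon> - 1)" using * by simp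
    then have "(2::real) ^ eps_exp \<epsilon> = 2 * 2 ^ (eps_exp \<epsilon> - 1)" by (metis power_Suc)
    ultimately show ?thesis by linarith
  qed (use assms in simp)
qed

lemma size_exp:
  shows "n < 2 ^ size_exp n" "l < size_exp n \<Longrightarrow> 2 ^ l \<le> n" "2 ^ size_exp n \<le> 2 * n + 1"
proof -
  have "n < 2 ^ n" by (rule less_exp)
  then show "n < 2 ^ size_exp n" unfolding size_exp_def by (rule LeastI)
  show less: "2 ^ l \<le> n" if "l < size_exp n" for l
    using not_less_Least[of l "\<lambda>l. n < 2 ^ l"] that unfolding size_exp_def by auto
  show "2 ^ size_exp n \<le> 2 * n + 1"
  proof (cases "size_exp n")
    case (Suc l)
    then show ?thesis using less[of l] by simp
  qed simp
qed

lemma bits_of_nat: "k < 2 ^ w \<Longrightarrow> bits (int k) \<le> w"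
  by (simp add: bits_le_iff)

text \<open>A query of precision l is answered by a positive number exactly when 1 \<le> \<epsilon>
  2^l. The state after the last iteration is listed apart in the invariant, because register 3 does
  not grow there.\<close>

lemma eps_loop:
  assumes "fst s 2 = 1" "fst s 3 = 1" "fst s 32 = 1" "x Eps > 0" and W: "W \<ge> 5 * eps_exp (x Eps) + 10"
  shows "wp x W (WhilePos 32 (Ins (Query 33 Eps 3) ;; IfPos 33 (Ins (Const 32 0)) (Ins (Add 3 3 2))))
    (\<lambda>t s'. t \<le> 6 * eps_exp (x Eps) + 2 \<and> snd s' = snd s \<and> fst s' 3 = int (eps_exp (x Eps)) \<and> (\<forall>q. q \<notin> {3, 32, 33} \<longrightarrow> fst s' q = fst s q)) s"
proof -
  define e where "e = eps_exp (x Eps)"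
  note e = eps_exp[OF assms(4), folded e_def]
  define I where "I k s' \<longleftrightarrow> snd s' = snd s \<and> (\<forall>q. q \<notin> {3, 32, 33} \<longrightarrow> fst s' q = fst s q) \<and>
    (1 \<le> k \<and> k \<le> e \<and> fst s' 32 = 1 \<and> fst s' 3 = int (e + 1 - k) \<or> k = 0 \<and> fst s' 32 = 0 \<and> fst s' 3 = int e)" for k s'
  have "wp x W (WhilePos 32 (Ins (Query 33 Eps 3) ;; IfPos 33 (Ins (Const 32 0)) (Ins (Add 3 3 2))))
    (\<lambda>t s'. t \<le> (5 + 1) * e + 2 \<and> I 0 s') s"
  proof (rule wp_while_inv[where I = I])
    show "I e s" using assms e(1) by (simp add: I_def)
    show "fst s 2 > 0" using assms by simp
  next
    fix k s1 assume "I k s1" "\<not> fst s1 32 > 0"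
    then show "I 0 s1" by (auto simp: I_def)
  next
    fix k s1 assume I: "I k s1" and go: "fst s1 32 > 0"
    define l where "l = e + 1 - k"
    have k: "1 \<le> k" "k \<le> e" "fst s1 3 = int l" using I go by (auto simp: I_def l_def)
    have l: "1 \<le> l" "l \<le> e" using k by (auto simp: l_def)
    obtain R where s1: "s1 = (R, snd s)" using I by (metis I_def prod.collapse)
    have R: "R 3 = int l" "R 2 = 1" and R': "\<And>q. q \<notin> {3, 32, 33} \<Longrightarrow> R q = fst s q" and R32: "R 32 = 1"
      using I k assms by (auto simp: I_def s1)
    have bl: "bits (int l) \<le> e"
    proof -
      have "l < 2 ^ l" by (rule less_exp)
      also have "\<dots> \<le> 2 ^ e" using l by (intro power_increasing) auto
      finally show ?thesis by (simp add: bits_le_iff)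
    qed
    have b1: "bits 1 \<le> 1" by (simp add: bits_le_iff)
    have We: "5 * e + 10 \<le> W" using W e_def by simp
    have cost: "Suc (bits (int l) + bits 1) \<le> W" "Suc l \<le> W" "Suc 0 \<le> W" using bl b1 l We by linarith+
    have "\<exists>k'. k = Suc k' \<and> wp x W (Ins (Query 33 Eps 3) ;; IfPos 33 (Ins (Const 32 0)) (Ins (Add 3 3 2)))
      (\<lambda>t s'. t \<le> 5 \<and> I k' s') (R, snd s)"
    proof (cases "l = e")
      case True
      have "k = Suc 0" using True k by (simp add: l_def)
      moreover have c: "0 < \<lfloor>2 ^ l * x Eps\<rfloor>" using e(2) True by (simp add: le_floor_iff mult.commute)
      have "I 0 (R(33 := \<lfloor>2 ^ l * x Eps\<rfloor>, 32 := 0), snd s)"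
        using R R' True by (simp add: I_def)
      then have "wp x W (Ins (Query 33 Eps 3) ;; IfPos 33 (Ins (Const 32 0)) (Ins (Add 3 3 2)))
      (\<lambda>t s'. t \<le> 5 \<and> I 0 s') (R, snd s)"
        using cost c by (simp add: cost_simps effect_simps R)
      ultimately show ?thesis by blast
    next
      case False
      then have le: "l < e" using l by simp
      then obtain k' where k': "k = Suc k'" "1 \<le> k'" "e + 1 - k' = l + 1" using k by (cases k) (auto simp: l_def)
      have c: "\<not> 0 < \<lfloor>2 ^ l * x Eps\<rfloor>" using e(3)[OF l(1) le] by (simp add: not_less floor_le_iff mult.commute)
      have "I k' (R(33 := \<lfloor>2 ^ l * x Eps\<rfloor>, 3 := int l + 1), snd s)"
        using R R' R32 k' k by (simp add: I_def)
      then have "wp x W (Ins (Query 33 Eps 3) ;; IfPos 33 (Ins (Const 32 0)) (Ins (Add 3 3 2)))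
      (\<lambda>t s'. t \<le> 5 \<and> I k' s') (R, snd s)"
        using cost c by (simp add: cost_simps effect_simps R)
      then show ?thesis using k' by blast
    qed
    then show "\<exists>j. k = Suc j \<and> wp x W (Ins (Query 33 Eps 3) ;; IfPos 33 (Ins (Const 32 0)) (Ins (Add 3 3 2)))
      (\<lambda>t s'. t \<le> 5 \<and> I j s') s1" by (simp add: s1)
  qed
  then show ?thesis by (rule wp_weaken) (auto simp: I_def e_def)
qed

lemma size_loop:
  assumes "fst s 0 = int n" "fst s 2 = 1" "fst s 3 = int e" "fst s 33 = 1" "fst s 32 = int n"
    and W: "W \<ge> 5 * (e + size_exp n) + 20"
  shows "wp x W (WhilePos 32 (block [Add 33 33 33, Add 3 3 2, Sub 32 0 33, Add 32 32 2]))
    (\<lambda>t s'. t \<le> 6 * size_exp n + 2 \<and> snd s' = snd s \<and> fst s' 3 = int (e + size_exp n) \<and> (\<forall>q. q \<notin> {3, 32, 33} \<longrightarrow> fst s' q = fst s q)) s"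
proof -
  define z where "z = size_exp n"
  note z = size_exp[where n = n, folded z_def]
  define I where "I k s' \<longleftrightarrow> snd s' = snd s \<and> (\<forall>q. q \<notin> {3, 32, 33} \<longrightarrow> fst s' q = fst s q) \<and> k \<le> z \<and>
    fst s' 33 = 2 ^ (z - k) \<and> fst s' 3 = int (e + (z - k)) \<and> fst s' 32 = int n - 2 ^ (z - k) + 1" for k s'
  have "wp x W (WhilePos 32 (block [Add 33 33 33, Add 3 3 2, Sub 32 0 33, Add 32 32 2]))
    (\<lambda>t s'. t \<le> (5 + 1) * z + 2 \<and> I 0 s') s"
  proof (rule wp_while_inv[where I = I])
    show "I z s" using assms by (simp add: I_def)
    show "fst s 2 > 0" using assms by simp
  next
    fix k s1 assume I: "I k s1" and "\<not> fst s1 32 > 0"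
    then have "int n < 2 ^ (z - k)" "k \<le> z" by (auto simp: I_def)
    then have n: "n < 2 ^ (z - k)" by simp
    \<comment> \<open>The loop cannot stop early, since 2^l \<le> n for every l below
      \<open>size_exp n\<close>.\<close>
    have "k = 0"
    proof (rule ccontr)
      assume "k \<noteq> 0"
      then have "2 ^ (z - k) \<le> n" using z(2)[of "z - k"] \<open>k \<le> z\<close> by simp
      then show False using n by simp
    qed
    then show "I 0 s1" using I by simp
  next
    fix k s1 assume I: "I k s1" and go: "fst s1 32 > 0"
    then have "2 ^ (z - k) \<le> int n" "k \<le> z" by (auto simp: I_def)
    then have n: "2 ^ (z - k) \<le> n" by simp
    then have "k \<noteq> 0" using z(1) by (cases k) auto
    then obtain k' where k': "k = Suc k'" by (cases k) auto
    define l where "l = z - k"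
    have l: "z - k' = Suc l" "k' \<le> z" "l < z" using k' \<open>k \<le> z\<close> by (auto simp: l_def)
    note I' = I[unfolded I_def, folded l_def]
    obtain R where s1: "s1 = (R, snd s)" using I by (metis I_def prod.collapse)
    have R: "R 33 = 2 ^ l" "R 3 = int (e + l)" "R 2 = 1" "R 0 = int n" and R': "\<And>q. q \<notin> {3, 32, 33} \<Longrightarrow> R q = fst s q"
      using I' assms by (auto simp: s1)
    have bits: "bits (int n) \<le> z" "bits (2 ^ l) \<le> z" "bits (int (e + l)) \<le> e + z" "bits 1 \<le> 1"
    proof -
      have "int n < 2 ^ z" using z(1) by simp
      then show "bits (int n) \<le> z" by (simp add: bits_le_iff)
      show "bits (2 ^ l) \<le> z" using l(3) by (simp add: bits_le_iff)
      have "e + l < 2 ^ (e + l)" by (rule less_exp)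
      also have "\<dots> \<le> 2 ^ (e + z)" using l(3) by (intro power_increasing) auto
      finally show "bits (int (e + l)) \<le> e + z" by (rule bits_of_nat)
      show "bits 1 \<le> 1" by (simp add: bits_le_iff)
    qed
    have W': "5 * (e + z) + 20 \<le> W" using W z_def by simp
    have b2: "bits (2 ^ l + 2 ^ l) \<le> z + 1" "bits (int n - (2 ^ l + 2 ^ l)) \<le> z + 2"
    proof -
      show 1: "bits (2 ^ l + 2 ^ l) \<le> z + 1" using bits_add[OF bits(2,2)] by simp
      show "bits (int n - (2 ^ l + 2 ^ l)) \<le> z + 2" using bits_diff[OF bits(1) 1] by simp
    qed
    have cost: "Suc (bits (2 ^ l) + bits (2 ^ l)) \<le> W" "Suc (bits (int (e + l)) + bits 1) \<le> W"
      "Suc (bits (int n) + bits (2 ^ l + 2 ^ l)) \<le> W" "Suc (bits (int n - (2 ^ l + 2 ^ l)) + bits 1) \<le> W"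
      using bits b2 W' by simp_all
    have "I k' (R(33 := 2 ^ l + 2 ^ l, 3 := int (e + l) + 1, 32 := int n - (2 ^ l + 2 ^ l) + 1), snd s)"
      using R' l by (simp add: I_def)
    then have "wp x W (block [Add 33 33 33, Add 3 3 2, Sub 32 0 33, Add 32 32 2]) (\<lambda>t s'. t \<le> 5 \<and> I k' s') (R, snd s)"
      using cost by (simp add: cost_simps effect_simps R)
    then show "\<exists>j. k = Suc j \<and> wp x W (block [Add 33 33 33, Add 3 3 2, Sub 32 0 33, Add 32 32 2]) (\<lambda>t s'. t \<le> 5 \<and> I j s') s1"
      using k' s1 by simp
  qed
  then show ?thesis by (rule wp_weaken) (auto simp: I_def z_def)
qed

lemma choose_precision_correct:
  assumes "fst s 0 = int n" "x Eps > 0" and W: "W \<ge> 5 * (eps_exp (x Eps) + size_exp n) + 20"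
  shows "wp x W choose_precision (\<lambda>t s'. t \<le> 6 * (eps_exp (x Eps) + size_exp n) + 20 \<and> snd s' = snd s \<and>
    fst s' 0 = int n \<and> fst s' 2 = 1 \<and> fst s' 3 = int (eps_exp (x Eps) + size_exp n)) s"
proof -
  define e where "e = eps_exp (x Eps)"
  have W': "5 * (e + size_exp n) + 20 \<le> W" using W e_def by simp
  obtain R where s: "s = (R, snd s)" by (metis prod.collapse)
  have R0: "R 0 = int n" using assms(1) s by (metis fst_conv)
  define mm where "mm = snd s"
  define s1 where "s1 = (R(2 := 1, 3 := 1, 32 := 1), mm)"
  have 1: "wp x W (block [Const 2 1, Const 3 1, Const 32 1]) (\<lambda>t s'. t \<le> 3 \<and> s' = s1) s"
    unfolding s1_def by (subst s, fold mm_def) (use W' in \<open>simp add: cost_simps effect_simps\<close>)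
  have 2: "wp x W (WhilePos 32 (Ins (Query 33 Eps 3) ;; IfPos 33 (Ins (Const 32 0)) (Ins (Add 3 3 2))))
    (\<lambda>t s'. t \<le> 6 * e + 2 \<and> snd s' = mm \<and> fst s' 3 = int e \<and> fst s' 0 = int n \<and> fst s' 2 = 1) s'" if "s' = s1" for s'
    unfolding that e_def
    by (rule wp_mono[OF eps_loop[of s1]]) (use assms W' R0 in \<open>auto simp: s1_def e_def\<close>)
  have 3: "wp x W (block [Const 33 1, Sub 32 0 33, Add 32 32 2] ;; WhilePos 32 (block [Add 33 33 33, Add 3 3 2, Sub 32 0 33, Add 32 32 2]))
    (\<lambda>t s'. t \<le> 3 + (6 * size_exp n + 2) \<and> snd s' = mm \<and> fst s' 0 = int n \<and> fst s' 2 = 1 \<and> fst s' 3 = int (e + size_exp n)) s2"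
    if s2: "snd s2 = mm \<and> fst s2 3 = int e \<and> fst s2 0 = int n \<and> fst s2 2 = 1" for s2
  proof -
    obtain R2 where s2R: "s2 = (R2, mm)" using s2 by (metis prod.collapse)
    have R2: "R2 3 = int e" "R2 0 = int n" "R2 2 = 1" using s2 s2R by auto
    define s3 where "s3 = (R2(33 := 1, 32 := int n), mm)"
    have bn: "bits (int n) \<le> size_exp n" "bits 1 \<le> 1"
      using size_exp(1)[of n] by (simp_all add: bits_le_iff)
    have bn1: "bits (int n - 1) \<le> size_exp n + 2"
      using bits_diff[OF bn] by (simp add: max_def split: if_splits)
    have a: "wp x W (block [Const 33 1, Sub 32 0 33, Add 32 32 2]) (\<lambda>t s'. t \<le> 3 \<and> s' = s3) s2"
      unfolding s2R s3_def using bn bn1 W' by (simp add: cost_simps effect_simps R2)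
    have b: "wp x W (WhilePos 32 (block [Add 33 33 33, Add 3 3 2, Sub 32 0 33, Add 32 32 2]))
      (\<lambda>t s'. t \<le> 6 * size_exp n + 2 \<and> snd s' = mm \<and> fst s' 0 = int n \<and> fst s' 2 = 1 \<and> fst s' 3 = int (e + size_exp n)) s'" if "s' = s3" for s'
      unfolding that
      by (rule wp_mono[OF size_loop[of s3 n e]]) (use W' R2 in \<open>auto simp: s3_def\<close>)
    show ?thesis by (rule wp_seq[OF a b]) auto
  qed
  have "wp x W (WhilePos 32 (Ins (Query 33 Eps 3) ;; IfPos 33 (Ins (Const 32 0)) (Ins (Add 3 3 2))) ;;
     block [Const 33 1, Sub 32 0 33, Add 32 32 2] ;; WhilePos 32 (block [Add 33 33 33, Add 3 3 2, Sub 32 0 33, Add 32 32 2]))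
    (\<lambda>t s'. t \<le> 6 * e + 2 + (3 + (6 * size_exp n + 2)) \<and> snd s' = mm \<and> fst s' 0 = int n \<and> fst s' 2 = 1 \<and> fst s' 3 = int (e + size_exp n)) s'"
    if "s' = s1" for s'
    by (rule wp_seq[OF 2[OF that] 3]) auto
  then show ?thesis
    unfolding choose_precision_def e_def[symmetric] mm_def[symmetric] by (rule wp_seq[OF 1]) auto
qed

section \<open>The complete program\<close>

locale spin_run = spin_system +
  fixes L K c \<nu> :: nat
  assumes numbers: "L \<ge> 1" "c \<ge> 1" "\<nu> \<ge> 1" "m = c * L" "N = m * \<nu>" "M = 2 * (m + N)" "K = M + m"
    and reads: "S = 2 ^ K" "B = \<lfloor>2 ^ K * x real_input.Beta\<rfloor>" "G = \<lfloor>2 ^ K * x real_input.Gamma\<rfloor>"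
      "U = (\<lfloor>2 ^ K * x Mu\<rfloor> * S) div (S + 1)" "0 \<le> \<lfloor>2 ^ K * x Mu\<rfloor>" "\<lfloor>2 ^ K * x Mu\<rfloor> \<le> S"
    and eps: "x Eps > 0" "L = eps_exp (x Eps) + size_exp n"
begin

text \<open>As L and the constants of the program are at most N, their bit lengths are covered by
  that of N.\<close>

lemma consts_le: "L \<le> N" "c \<le> N" "\<nu> \<le> N" "m \<le> N" "K + 1 \<le> v"
proof -
  have "m \<ge> 1" using numbers by simp
  have "L * 1 \<le> L * c" "1 * c \<le> L * c" using numbers by (intro mult_left_mono mult_right_mono; simp)+
  then have "L \<le> m" "c \<le> m" using numbers(4) by (simp_all add: mult.commute)
  moreover have "m * 1 \<le> m * \<nu>" "1 * \<nu> \<le> m * \<nu>" using numbers \<open>m \<ge> 1\<close> by (intro mult_left_mono mult_right_mono; simp)+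
  ultimately show "L \<le> N" "c \<le> N" "\<nu> \<le> N" "m \<le> N" unfolding numbers(5) by linarith+
  have "(2::int) ^ K < 2 ^ v" using sizes(1) reads(1) by (simp add: bits_le_iff)
  then show "K + 1 \<le> v" by simp
qed

lemma power_loop:
  assumes "fst s 2 = 1" "fst s 8 = 1" "fst s 32 = int K"
  shows "wp x W (WhilePos 32 (block [Add 8 8 8, Sub 32 32 2]))
    (\<lambda>t s'. t \<le> 3 * K + 2 \<and> snd s' = snd s \<and> fst s' 8 = 2 ^ K \<and> (\<forall>q. q \<notin> {8, 32} \<longrightarrow> fst s' q = fst s q)) s"
proof -
  define I where "I k s' \<longleftrightarrow> snd s' = snd s \<and> (\<forall>q. q \<notin> {8, 32} \<longrightarrow> fst s' q = fst s q) \<and> k \<le> K \<and>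
    fst s' 8 = 2 ^ (K - k) \<and> fst s' 32 = int k" for k s'
  have "wp x W (WhilePos 32 (block [Add 8 8 8, Sub 32 32 2])) (\<lambda>t s'. t \<le> (2 + 1) * K + 2 \<and> I 0 s') s"
  proof (rule wp_while_inv[where I = I])
    show "I K s" using assms by (simp add: I_def)
    show "fst s 2 > 0" using assms by simp
  next
    fix k s1 assume "I k s1" "\<not> fst s1 32 > 0"
    then show "I 0 s1" by (cases "k = 0") (auto simp: I_def)
  next
    fix k s1 assume I: "I k s1" and go: "fst s1 32 > 0"
    then have "k \<noteq> 0" by (auto simp: I_def)
    then obtain k' where k': "k = Suc k'" by (cases k) auto
    define l where "l = K - k"
    have l: "K - k' = Suc l" "k' \<le> K" "l < K" "k \<le> K" using k' I by (auto simp: l_def I_def)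
    obtain R where s1: "s1 = (R, snd s)" using I by (metis I_def prod.collapse)
    have R: "R 8 = 2 ^ l" "R 32 = int k" "R 2 = 1" and R': "\<And>q. q \<notin> {8, 32} \<Longrightarrow> R q = fst s q"
      using I assms by (auto simp: s1 I_def l_def)
    have bits: "bits (2 ^ l) \<le> v" "bits (int k) \<le> v"
    proof -
      have "(2::int) ^ l < 2 ^ v" using l consts_le(5) by (intro power_strict_increasing) auto
      then show "bits (2 ^ l) \<le> v" by (simp add: bits_le_iff)
      have "k < 2 ^ k" by (rule less_exp)
      also have "\<dots> \<le> 2 ^ v" using l consts_le(5) by (intro power_increasing) auto
      finally show "bits (int k) \<le> v" by (simp add: bits_le_iff)
    qed
    have cost: "Suc (bits (2 ^ l) + bits (2 ^ l)) \<le> W" "Suc (bits (int k) + bits 1) \<le> W"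
      using bits operands(3) W_ge by linarith+
    have "I k' (R(8 := 2 ^ l + 2 ^ l, 32 := int k - 1), snd s)" using R' l k' by (simp add: I_def)
    then have "wp x W (block [Add 8 8 8, Sub 32 32 2]) (\<lambda>t s'. t \<le> 2 \<and> I k' s') (R, snd s)"
      using cost by (simp add: cost_simps effect_simps R)
    then show "\<exists>j. k = Suc j \<and> wp x W (block [Add 8 8 8, Sub 32 32 2]) (\<lambda>t s'. t \<le> 2 \<and> I j s') s1"
      using k' s1 by simp
  qed
  then show ?thesis by (rule wp_weaken) (auto simp: I_def)
qed

lemma read_parameters_correct:
  assumes s: "fst s 0 = int n" "fst s 2 = 1" "fst s 3 = int L" "represents_from (snd s) 0"
  shows "wp x W (read_parameters c \<nu>) (\<lambda>t s'. t \<le> 3 * K + 30 \<and> vertex_state 0 1 1 s') s"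
proof -
  obtain R mm where sR: "s = (R, mm)" by fastforce
  have R: "R 0 = int n" "R 2 = 1" "R 3 = int L" and rep: "represents_from mm 0" using s sR by auto
  have bl: "bits (int c) \<le> v" "bits (int L) \<le> v" "bits (int \<nu>) \<le> v" "bits (int N) \<le> v" "bits (int m) \<le> v"
    using consts_le by (auto intro: bits_le_nat)
  have W20: "20 * v + 20 \<le> W" using W_ge by linarith
  have eqs: "int L * int c = int m" "int m * int \<nu> = int N" "int m + int N + (int m + int N) = int M" "int M + int m = int K"
    "2 * int m + 2 * int N = int M" "3 * int m + 2 * int N = int K"
    using numbers by simp_all
  have "K < 2 ^ v" using consts_le(5) less_exp[of v] by linarith
  then have bK: "bits (int K) \<le> v" by (rule bits_of_nat)
  define s1 where "s1 = (R(32 := int K, 4 := int m, 5 := int N, 6 := int M, 7 := int K, 8 := 1, 33 := 0), mm)"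
  have 1: "wp x W (block [Const 32 (int c), Mul 4 3 32, Const 32 (int \<nu>), Mul 5 4 32, Add 6 4 5, Add 6 6 6, Add 7 6 4,
       Const 8 1, Const 33 0, Add 32 7 33]) (\<lambda>t s'. t \<le> 10 \<and> s' = s1) s"
    unfolding s1_def sR
    by (simp add: exec R eqs, intro conjI;
      ((rule cost_bound, (rule bl bK rules)+, use W20 in linarith) | (use W20 in linarith) | (auto simp: fun_eq_iff))?)
  have 2: "wp x W (WhilePos 32 (block [Add 8 8 8, Sub 32 32 2]))
    (\<lambda>t s'. t \<le> 3 * K + 2 \<and> snd s' = mm \<and> fst s' 8 = S \<and> (\<forall>q. q \<notin> {8, 32} \<longrightarrow> fst s' q = fst s1 q)) s'" if "s' = s1" for s'
    unfolding that by (rule wp_mono[OF power_loop[of s1]]) (use R reads in \<open>auto simp: s1_def\<close>)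
  have 3: "wp x W (block [Query 9 real_input.Beta 7, Query 10 real_input.Gamma 7, Query 11 Mu 7, Mul 11 11 8, Add 32 8 2, Div 11 11 32,
       Mul 12 0 0, Const 31 1, Const 1 1, Const 13 0]) (\<lambda>t s'. t \<le> 10 \<and> vertex_state 0 1 1 s') s2"
    if s2: "snd s2 = mm \<and> fst s2 8 = S \<and> (\<forall>q. q \<notin> {8, 32} \<longrightarrow> fst s2 q = fst s1 q)" for s2
  proof -
    obtain R2 where s2R: "s2 = (R2, mm)" using s2 by (metis prod.collapse)
    have R2: "R2 0 = int n" "R2 2 = 1" "R2 4 = int m" "R2 5 = int N" "R2 6 = int M" "R2 7 = int K" "R2 8 = S"
      using s2 R by (auto simp: s2R s1_def)
    have bM: "bits \<lfloor>2 ^ K * x Mu\<rfloor> \<le> v" by (rule bits_between[OF reads(5,6) sizes(1)])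
    have Kc: "Suc K \<le> W" using consts_le(5) W20 by linarith
    show ?thesis
      unfolding s2R
      by (simp add: exec R2, intro conjI;
        ((rule cost_bound, (rule bM rules)+, use W20 in linarith) | (use W20 Kc in linarith) |
         (use R2 rep in \<open>simp add: vertex_state_def reads(2-4)[symmetric]\<close>))?)
  qed
  have "wp x W (WhilePos 32 (block [Add 8 8 8, Sub 32 32 2]) ;; block [Query 9 real_input.Beta 7, Query 10 real_input.Gamma 7, Query 11 Mu 7, Mul 11 11 8, Add 32 8 2, Div 11 11 32,
       Mul 12 0 0, Const 31 1, Const 1 1, Const 13 0]) (\<lambda>t s'. t \<le> 3 * K + 2 + 10 \<and> vertex_state 0 1 1 s') s'" if "s' = s1" for s'
    by (rule wp_seq[OF 2[OF that] 3]) auto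
  then show ?thesis unfolding read_parameters_def by (rule wp_seq[OF 1]) auto
qed

definition total_time :: nat where
  "total_time = 6 * L + 20 + (3 * K + 30) + 1 + ((vertex_time + 1) * n + 2) + 2"

theorem spin_program_correct:
  assumes s: "fst s 0 = int n" "represents_from (snd s) 0"
  shows "wp x W (spin_program c \<nu>) (\<lambda>t s'. t \<le> total_time \<and> (\<exists>Y. (\<forall>r<n. partial_sum r (m + 1) (Y r)) \<and>
    fst s' 0 = (\<Prod>r<n. (S + Y r) * B ^ lower_degree r) \<and> fst s' 1 = (\<Prod>r<n. S * S ^ lower_degree r))) s"
proof -
  define Post where "Post s' \<longleftrightarrow> (\<exists>Y. (\<forall>r<n. partial_sum r (m + 1) (Y r)) \<and>
    fst s' 0 = (\<Prod>r<n. (S + Y r) * B ^ lower_degree r) \<and> fst s' 1 = (\<Prod>r<n. S * S ^ lower_degree r))" for s' :: store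
  have W20: "20 * v + 20 \<le> W" using W_ge by linarith
  have WL: "5 * (eps_exp (x Eps) + size_exp n) + 20 \<le> W"
  proof -
    have "L \<le> K" using consts_le(1) numbers(6,7) by simp
    then show ?thesis using eps(2) consts_le(5) W20 by simp
  qed
  have 1: "wp x W choose_precision (\<lambda>t s'. t \<le> 6 * L + 20 \<and> snd s' = snd s \<and> fst s' 0 = int n \<and> fst s' 2 = 1 \<and> fst s' 3 = int L) s"
    unfolding eps(2) by (rule choose_precision_correct) (use s eps WL in auto)
  have 2: "wp x W (read_parameters c \<nu>) (\<lambda>t s'. t \<le> 3 * K + 30 \<and> vertex_state 0 1 1 s') s1"
    if "snd s1 = snd s \<and> fst s1 0 = int n \<and> fst s1 2 = 1 \<and> fst s1 3 = int L" for s1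
    by (rule read_parameters_correct) (use that s in auto)
  have 3: "wp x W (Ins (Sub 32 0 13)) (\<lambda>t s'. t \<le> 1 \<and> vertex_state 0 1 1 s' \<and> fst s' 32 = int n) s2" if s2: "vertex_state 0 1 1 s2" for s2
  proof -
    obtain R2 m2 where s2R: "s2 = (R2, m2)" by fastforce
    note R2 = vertex_stateD[OF s2[unfolded s2R]]
    show ?thesis
      unfolding s2R using s2 operands W20 by (simp add: exec R2) (simp add: vertex_state_def s2R)
  qed
  have 5: "wp x W (block [Const 33 0, Add 0 31 33]) (\<lambda>t s'. t \<le> 2 \<and> Post s') s4"
    if s4: "\<exists>Y. (\<forall>r<n. partial_sum r (m + 1) (Y r)) \<and>
      vertex_state n (\<Prod>r<n. (S + Y r) * B ^ lower_degree r) (\<Prod>r<n. S * S ^ lower_degree r) s4 \<and>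
      bits (\<Prod>r<n. (S + Y r) * B ^ lower_degree r) + v + 20 \<le> W" for s4
  proof -
    obtain R4 m4 where s4R: "s4 = (R4, m4)" by fastforce
    obtain Y where Y: "\<forall>r<n. partial_sum r (m + 1) (Y r)"
      "vertex_state n (\<Prod>r<n. (S + Y r) * B ^ lower_degree r) (\<Prod>r<n. S * S ^ lower_degree r) (R4, m4)"
      "bits (\<Prod>r<n. (S + Y r) * B ^ lower_degree r) + v + 20 \<le> W" using s4 by (auto simp: s4R)
    note R4 = vertex_stateD[OF Y(2)]
    define num where "num = (\<Prod>r<n. (S + Y r) * B ^ lower_degree r)"
    have "Post (R4(33 := 0, 0 := num), m4)"
      unfolding Post_def using Y(1) R4(13) by (intro exI[of _ Y]) (simp add: num_def)
    moreover have "Suc (bits num + bits 0) \<le> W" "Suc 0 \<le> W" using Y(3) operands(2) unfolding num_def by linarith+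
    ultimately show ?thesis unfolding s4R using R4(12)[folded num_def] by (simp add: exec)
  qed
  have a: "wp x W (WhilePos 32 process_vertex ;; block [Const 33 0, Add 0 31 33]) (\<lambda>t s'. t \<le> (vertex_time + 1) * n + 2 + 2 \<and> Post s') s3"
    if "vertex_state 0 1 1 s3 \<and> fst s3 32 = int n" for s3
    by (rule wp_seq[OF vertex_loop 5]) (use that in auto)
  have b: "wp x W (Ins (Sub 32 0 13) ;; WhilePos 32 process_vertex ;; block [Const 33 0, Add 0 31 33])
     (\<lambda>t s'. t \<le> 1 + ((vertex_time + 1) * n + 2 + 2) \<and> Post s') s2" if "vertex_state 0 1 1 s2" for s2
    by (rule wp_seq[OF 3[OF that] a]) auto
  have c: "wp x W (read_parameters c \<nu> ;; Ins (Sub 32 0 13) ;; WhilePos 32 process_vertex ;; block [Const 33 0, Add 0 31 33])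
     (\<lambda>t s'. t \<le> 3 * K + 30 + (1 + ((vertex_time + 1) * n + 2 + 2)) \<and> Post s') s1"
    if "snd s1 = snd s \<and> fst s1 0 = int n \<and> fst s1 2 = 1 \<and> fst s1 3 = int L" for s1
    by (rule wp_seq[OF 2[OF that] b]) auto
  show ?thesis
    unfolding spin_program_def Post_def[symmetric] by (rule wp_seq[OF 1 c]) (auto simp: total_time_def)
qed

end

section \<open>The partition function\<close>

text \<open>Configurations correspond to their sets of spin-1 vertices; taking \<beta> out of every
  edge leaves the weights 1, 1 / \<beta> and \<gamma> / \<beta>.\<close>

lemma partition_function_spin_sum:
  assumes "\<beta> \<noteq> 0" "finite V" "E \<subseteq> V \<times> V"
  shows "partition_function (interaction \<beta> \<gamma>) \<mu> V E = \<beta> ^ card E * spin_sum (1 / \<beta>) \<gamma> V E (\<lambda>_. \<mu>)"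
proof -
  have "partition_function (interaction \<beta> \<gamma>) \<mu> V E =
    (\<Sum>S\<in>Pow V. \<beta> ^ card E * ((\<Prod>v\<in>S. \<mu>) * (\<Prod>(p, q)\<in>E. edge_wt (1 / \<beta>) \<gamma> (p \<in> S) (q \<in> S))))"
    unfolding partition_function_def
  proof (rule sum.reindex_bij_witness[where i = "\<lambda>S. \<lambda>v\<in>V. if v \<in> S then 1 else 0" and j = "\<lambda>\<sigma>. {v \<in> V. \<sigma> v = 1}"])
    fix \<sigma> :: "nat \<Rightarrow> nat" assume \<sigma>: "\<sigma> \<in> V \<rightarrow>\<^sub>E {0, 1}"
    show "(\<lambda>v\<in>V. if v \<in> {v \<in> V. \<sigma> v = 1} then 1 else 0) = \<sigma>"
    proof
      fix v show "(\<lambda>v\<in>V. if v \<in> {v \<in> V. \<sigma> v = 1} then 1 else 0) v = \<sigma> v"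
        using \<sigma> by (cases "v \<in> V") (auto simp: PiE_def extensional_def Pi_def)
    qed
    show "{v \<in> V. \<sigma> v = 1} \<in> Pow V" by auto
    define S where "S = {v \<in> V. \<sigma> v = 1}"
    have \<sigma>S: "\<sigma> v = (if v \<in> S then 1 else 0)" if "v \<in> V" for v
      using \<sigma> that by (auto simp: S_def PiE_def Pi_def)
    have "(\<Prod>(u, v)\<in>E. interaction \<beta> \<gamma> (\<sigma> u) (\<sigma> v)) = (\<Prod>e\<in>E. \<beta> * (case e of (p, q) \<Rightarrow> edge_wt (1 / \<beta>) \<gamma> (p \<in> S) (q \<in> S)))"
    proof (rule prod.cong[OF refl])
      fix e assume "e \<in> E"
      then obtain p q where "e = (p, q)" "p \<in> V" "q \<in> V" using assms(3) by auto
      then show "(case e of (u, v) \<Rightarrow> interaction \<beta> \<gamma> (\<sigma> u) (\<sigma> v)) = \<beta> * (case e of (p, q) \<Rightarrow> edge_wt (1 / \<beta>) \<gamma> (p \<in> S) (q \<in> S))"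
        using assms(1) by (simp add: \<sigma>S interaction_def edge_wt_def)
    qed
    also have "\<dots> = \<beta> ^ card E * (\<Prod>(p, q)\<in>E. edge_wt (1 / \<beta>) \<gamma> (p \<in> S) (q \<in> S))"
      by (simp add: prod.distrib)
    finally have 1: "(\<Prod>(u, v)\<in>E. interaction \<beta> \<gamma> (\<sigma> u) (\<sigma> v)) = \<beta> ^ card E * (\<Prod>(p, q)\<in>E. edge_wt (1 / \<beta>) \<gamma> (p \<in> S) (q \<in> S))" .
    have 2: "(\<Prod>v\<in>V. \<mu> ^ \<sigma> v) = (\<Prod>v\<in>S. \<mu>)"
    proof -
      have "(\<Prod>v\<in>V. \<mu> ^ \<sigma> v) = (\<Prod>v\<in>V. if v \<in> S then \<mu> else 1)" by (intro prod.cong) (auto simp: \<sigma>S)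
      also have "\<dots> = (\<Prod>v\<in>S. \<mu>)" using assms(2) by (intro prod.mono_neutral_cong_right) (auto simp: S_def)
      finally show ?thesis .
    qed
    show "\<beta> ^ card E * ((\<Prod>v\<in>{v \<in> V. \<sigma> v = 1}. \<mu>) * (\<Prod>(p, q)\<in>E. edge_wt (1 / \<beta>) \<gamma> (p \<in> {v \<in> V. \<sigma> v = 1}) (q \<in> {v \<in> V. \<sigma> v = 1}))) =
      (\<Prod>(u, v)\<in>E. interaction \<beta> \<gamma> (\<sigma> u) (\<sigma> v)) * (\<Prod>v\<in>V. \<mu> ^ \<sigma> v)"
      unfolding S_def[symmetric] 1 2 by simp
  next
    fix S assume "S \<in> Pow V"
    then show "{v \<in> V. (\<lambda>v\<in>V. if v \<in> S then 1 else 0) v = (1::nat)} = S" by auto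
    show "(\<lambda>v\<in>V. if v \<in> S then 1 else 0) \<in> V \<rightarrow>\<^sub>E {0::nat, 1}" by auto
  qed
  then show ?thesis by (simp add: spin_sum_def sum_distrib_left)
qed

lemma simple_graph_edges:
  assumes "simple_graph n E"
  shows "finite E" "(p, q) \<in> E \<Longrightarrow> p < q" "E \<subseteq> {..<n} \<times> {..<n}" "edges_on E {..<n} = E" "card E \<le> n * n"
proof -
  show sub: "E \<subseteq> {..<n} \<times> {..<n}" using assms unfolding simple_graph_def by auto
  then show "finite E" by (rule finite_subset) simp
  show "(p, q) \<in> E \<Longrightarrow> p < q" using assms by (auto simp: simple_graph_def)
  show "edges_on E {..<n} = E" using sub by (auto simp: edges_on_def)
  show "card E \<le> n * n" using card_mono[OF _ sub] by simp
qed

lemma partition_function_tail_sum: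
  assumes "\<beta> \<noteq> 0" "simple_graph n E"
  shows "partition_function (interaction \<beta> \<gamma>) \<mu> {..<n} E = \<beta> ^ card E * tail_sum (1 / \<beta>) \<gamma> \<mu> n E 0"
  using partition_function_spin_sum[OF assms(1), of "{..<n}" E \<gamma> \<mu>] simple_graph_edges[OF assms(2)]
  by (simp add: tail_sum_def atLeast0LessThan)

text \<open>Every edge is counted at its larger end, where the program restores its factor \<beta>;
  so the restored factors form the full power.\<close>

lemma card_edges:
  assumes "simple_graph n E"
  shows "card E = (\<Sum>r<n. card {w. w < r \<and> adj E r w})"
proof -
  define D where "D = (SIGMA r:{..<n}. {w. w < r \<and> adj E r w})"
  have "E = (\<lambda>(r, w). (w, r)) ` D"
  proof (intro equalityI subsetI)
    fix e assume e: "e \<in> E"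
    obtain p q where pq: "e = (p, q)" by fastforce
    then have "p < q" "q < n" using e assms by (auto simp: simple_graph_def)
    then have "(q, p) \<in> D" using e pq by (auto simp: D_def adj_def)
    then show "e \<in> (\<lambda>(r, w). (w, r)) ` D" using pq by force
  next
    fix e assume "e \<in> (\<lambda>(r, w). (w, r)) ` D"
    then show "e \<in> E" using assms by (auto simp: D_def adj_def simple_graph_def)
  qed
  moreover have "inj_on (\<lambda>(r, w). (w, r)) D" by (auto simp: inj_on_def)
  ultimately have "card E = card D" using card_image by metis
  also have "\<dots> = (\<Sum>r<n. card {w. w < r \<and> adj E r w})" by (simp add: D_def)
  finally show ?thesis .
qed

text \<open>Each configuration weighs a monomial in \<beta>, \<gamma>, \<mu> of degree at most |E| +
  |V|. Lowering every parameter by at most the factor 1 - d lowers it by at most the corresponding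
  power, which Bernoulli's inequality bounds. Since all rounding is downwards, the upper bound has
  no loss.\<close>

lemma partition_function_perturb:
  fixes \<beta> \<gamma> \<mu> \<beta>' \<gamma>' \<mu>' d :: real
  assumes d: "0 \<le> d" "d \<le> 1" and p: "0 \<le> \<beta>" "0 \<le> \<gamma>" "0 \<le> \<mu>"
    and lo: "(1 - d) * \<beta> \<le> \<beta>'" "(1 - d) * \<gamma> \<le> \<gamma>'" "(1 - d) * \<mu> \<le> \<mu>'" and up: "\<beta>' \<le> \<beta>" "\<gamma>' \<le> \<gamma>" "\<mu>' \<le> \<mu>"
    and V: "finite V" "E \<subseteq> V \<times> V"
  shows "(1 - (card E + card V) * d) * partition_function (interaction \<beta> \<gamma>) \<mu> V E \<le> partition_function (interaction \<beta>' \<gamma>') \<mu>' V E"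
    "partition_function (interaction \<beta>' \<gamma>') \<mu>' V E \<le> partition_function (interaction \<beta> \<gamma>) \<mu> V E"
    "0 \<le> partition_function (interaction \<beta> \<gamma>) \<mu> V E"
proof -
  let ?t = "\<lambda>\<beta> \<gamma> \<mu> \<sigma>. (\<Prod>(u, v)\<in>E. interaction \<beta> \<gamma> (\<sigma> u) (\<sigma> v)) * (\<Prod>v\<in>V. \<mu> ^ \<sigma> v)"
  have p': "0 \<le> \<beta>'" "0 \<le> \<gamma>'" "0 \<le> \<mu>'" using lo d p by (smt (verit) mult_nonneg_nonneg)+
  have nn: "0 \<le> ?t \<beta> \<gamma> \<mu> \<sigma>" for \<sigma> using p by (auto intro!: mult_nonneg_nonneg prod_nonneg simp: interaction_def)
  have t1: "?t \<beta>' \<gamma>' \<mu>' \<sigma> \<le> ?t \<beta> \<gamma> \<mu> \<sigma>" for \<sigma>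
    using p p' up by (intro mult_mono prod_mono prod_nonneg) (auto simp: interaction_def intro!: power_mono)
  have t2: "(1 - d) ^ (card E + card V) * ?t \<beta> \<gamma> \<mu> \<sigma> \<le> ?t \<beta>' \<gamma>' \<mu>' \<sigma>" if \<sigma>: "\<sigma> \<in> V \<rightarrow>\<^sub>E {0, 1}" for \<sigma>
  proof -
    have "(\<Prod>e\<in>E. (1 - d) * (case e of (u, v) \<Rightarrow> interaction \<beta> \<gamma> (\<sigma> u) (\<sigma> v))) * (\<Prod>v\<in>V. (1 - d) * \<mu> ^ \<sigma> v) \<le> ?t \<beta>' \<gamma>' \<mu>' \<sigma>"
    proof (intro mult_mono prod_mono prod_nonneg conjI ballI)
      fix e show "(1 - d) * (case e of (u, v) \<Rightarrow> interaction \<beta> \<gamma> (\<sigma> u) (\<sigma> v)) \<le> (case e of (u, v) \<Rightarrow> interaction \<beta>' \<gamma>' (\<sigma> u) (\<sigma> v))"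
        using lo d by (auto simp: interaction_def case_prod_unfold)
    next
      fix v assume "v \<in> V"
      then have "\<sigma> v = 0 \<or> \<sigma> v = 1" using \<sigma> by (auto simp: PiE_def Pi_def)
      then show "(1 - d) * \<mu> ^ \<sigma> v \<le> \<mu>' ^ \<sigma> v" using lo d by auto
    qed (use d p p' in \<open>auto simp: interaction_def case_prod_unfold\<close>)
    then show ?thesis by (simp add: prod.distrib power_add mult_ac)
  qed
  show "0 \<le> partition_function (interaction \<beta> \<gamma>) \<mu> V E"
    unfolding partition_function_def using nn by (rule sum_nonneg)
  then have "(1 - (card E + card V) * d) * partition_function (interaction \<beta> \<gamma>) \<mu> V E \<le> (1 - d) ^ (card E + card V) * partition_function (interaction \<beta> \<gamma>) \<mu> V E"
    using Bernoulli_inequality[of "- d" "card E + card V"] d by (intro mult_right_mono) auto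
  also have "\<dots> \<le> partition_function (interaction \<beta>' \<gamma>') \<mu>' V E"
    unfolding partition_function_def sum_distrib_left using t2 by (rule sum_mono)
  finally show "(1 - (card E + card V) * d) * partition_function (interaction \<beta> \<gamma>) \<mu> V E \<le> partition_function (interaction \<beta>' \<gamma>') \<mu>' V E" .
  show "partition_function (interaction \<beta>' \<gamma>') \<mu>' V E \<le> partition_function (interaction \<beta> \<gamma>) \<mu> V E"
    unfolding partition_function_def using t1 by (rule sum_mono)
qed

text \<open>The strict inequality R^2 \<gamma> < \<beta> puts the closed disc of radius R into the
  zero-free region, where the shifted quotient is holomorphic and bounded by 1. At the real nodes it
  is the path ratio that the search computes.\<close>

lemma extrapolated_ratio:
  fixes \<beta> \<gamma> \<mu> R \<eta> :: real
  assumes c: "\<beta> > 0" "\<gamma> > 0" "\<beta> * \<gamma> > 1" "R\<^sup>2 * \<gamma> < \<beta>" and \<mu>: "0 \<le> \<mu>" "\<mu> < 1"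
    and E: "simple_graph n E" and r: "r < n" and R: "R > 1 + \<eta>" "\<eta> < 1" and N: "N > 0" "real m / real N \<le> \<eta>"
  shows "\<bar>tail_sum (1 / \<beta>) \<gamma> \<mu> n E r / tail_sum (1 / \<beta>) \<gamma> \<mu> n E (Suc r) - 1 -
    (\<Sum>j\<le>m. lagrange_at_one m (\<lambda>i. real i / real N) j *
      path_ratio (real j / real N / \<beta>) (\<gamma> * (real j / real N)) \<mu> n E (\<lambda>w. if w < r then 1 else 0) r)\<bar>
    \<le> R / ((R - 1) * (R - \<eta>) ^ Suc m)"
proof -
  note E' = simple_graph_edges(1,2)[OF E]
  define T where "T z q = tail_sum (z / of_real \<beta>) (of_real \<gamma> * z) (of_real \<mu>) n E q" for z :: complex and q
  define f where "f z = T z r / T z (Suc r) - 1" for z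
  have \<eta>: "\<eta> \<ge> 0" using order_trans[OF _ N(2), of 0] by simp
  have sq: "(norm z)\<^sup>2 * \<gamma> < \<beta>" if "norm z \<le> R" for z :: complex
  proof -
    have "(norm z)\<^sup>2 * \<gamma> \<le> R\<^sup>2 * \<gamma>" using that c by (intro mult_right_mono power_mono) auto
    then show ?thesis using c by linarith
  qed
  have nz: "T z q \<noteq> 0" if "norm z \<le> R" for z q
    unfolding T_def by (rule tail_sum_nonzero[OF c(1-3) sq[OF that] \<mu>]) (use E' in auto)
  have hol: "f holomorphic_on cball 0 R"
    unfolding f_def using nz by (auto intro!: holomorphic_intros tail_sum_holomorphic simp: T_def)
  have bound: "norm (f z) \<le> 1" if "norm z \<le> R" for z
    unfolding f_def T_def by (rule tail_ratio_bound[OF c(1-3) sq[OF that] \<mu>]) (use E' r in auto)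
  have real: "f (of_real t) = of_real (tail_sum (t / \<beta>) (\<gamma> * t) \<mu> n E r / tail_sum (t / \<beta>) (\<gamma> * t) \<mu> n E (Suc r) - 1)" for t
  proof -
    have "T (of_real t) q = of_real (tail_sum (t / \<beta>) (\<gamma> * t) \<mu> n E q)" for q
      unfolding T_def tail_sum_of_real[symmetric] by simp
    then show ?thesis by (simp add: f_def)
  qed
  have node: "f (of_real t) = of_real (path_ratio (t / \<beta>) (\<gamma> * t) \<mu> n E (\<lambda>w. if w < r then 1 else 0) r)" if "t \<ge> 0" for t
  proof -
    have nn: "0 \<le> t / \<beta>" "0 \<le> \<gamma> * t" using that c by auto
    have "tail_sum (t / \<beta>) (\<gamma> * t) \<mu> n E r = tail_sum (t / \<beta>) (\<gamma> * t) \<mu> n E (Suc r) *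
      (1 + path_ratio (t / \<beta>) (\<gamma> * t) \<mu> n E (\<lambda>w. if w < r then 1 else 0) r)"
      by (rule tail_sum_path_ratio[OF E'(1) _ nn \<mu>(1) r]) (use E' in auto)
    moreover have "tail_sum (t / \<beta>) (\<gamma> * t) \<mu> n E (Suc r) > 0" by (rule tail_sum_pos[OF nn \<mu>(1)])
    ultimately show ?thesis unfolding real by simp
  qed
  have "norm (f 1 - (\<Sum>j\<le>m. of_real (lagrange_at_one m (\<lambda>i. real i / real N) j) * f (of_real (real j / real N)))) \<le>
    R / ((R - 1) * (R - \<eta>) ^ Suc m)"
  proof (rule lagrange_extrapolation[OF hol bound R])
    show "inj_on (\<lambda>i. real i / real N) {..m}" using N(1) by (auto simp: inj_on_def)
    show "0 \<le> real i / real N \<and> real i / real N \<le> \<eta>" if "i \<le> m" for i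
      using order_trans[OF divide_right_mono N(2), of "real i"] that by simp
  qed auto
  moreover have "f 1 = of_real (tail_sum (1 / \<beta>) \<gamma> \<mu> n E r / tail_sum (1 / \<beta>) \<gamma> \<mu> n E (Suc r) - 1)"
    using real[of 1] by simp
  moreover have "(\<Sum>j\<le>m. of_real (lagrange_at_one m (\<lambda>i. real i / real N) j) * f (of_real (real j / real N))) =
    of_real (\<Sum>j\<le>m. lagrange_at_one m (\<lambda>i. real i / real N) j *
      path_ratio (real j / real N / \<beta>) (\<gamma> * (real j / real N)) \<mu> n E (\<lambda>w. if w < r then 1 else 0) r)"
    unfolding of_real_sum of_real_mult
    by (intro sum.cong refl arg_cong2[where f = times] node) simp
  ultimately show ?thesis by (simp only: of_real_diff[symmetric] norm_of_real)
qed

text \<open>All factors 1 + f r are at least 1, so an absolute error e is also a relative one. Then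
  (1 - e)^n \<ge> 1 - n e, and (1 + e)^n \<le> exp (n e) \<le> 1 + 2 n e as n e \<le> 1.\<close>

lemma product_error:
  fixes y f :: "nat \<Rightarrow> real"
  assumes f: "\<And>r. r < n \<Longrightarrow> f r \<ge> 0" and e: "0 \<le> e" "n * e \<le> 1" and y: "\<And>r. r < n \<Longrightarrow> \<bar>y r - f r\<bar> \<le> e"
  shows "(1 - n * e) * (\<Prod>r<n. 1 + f r) \<le> (\<Prod>r<n. 1 + y r)" "(\<Prod>r<n. 1 + y r) \<le> (1 + 2 * (n * e)) * (\<Prod>r<n. 1 + f r)"
proof -
  have e1: "e \<le> 1" if "n > 0"
  proof -
    have "1 * e \<le> n * e" using that e by (intro mult_right_mono) auto
    then show ?thesis using e by simp
  qed
  have lo: "(1 - e) * (1 + f r) \<le> 1 + y r" and up: "1 + y r \<le> (1 + e) * (1 + f r)" if "r < n" for r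
  proof -
    have "e * 1 \<le> e * (1 + f r)" using e f[OF that] by (intro mult_left_mono) auto
    then show "(1 - e) * (1 + f r) \<le> 1 + y r" "1 + y r \<le> (1 + e) * (1 + f r)"
      using y[OF that] by (auto simp: algebra_simps abs_le_iff)
  qed
  have pos: "0 \<le> (\<Prod>r<n. 1 + f r)" using f by (intro prod_nonneg) (auto intro: add_nonneg_nonneg)
  have "(1 - n * e) * (\<Prod>r<n. 1 + f r) \<le> (1 - e) ^ n * (\<Prod>r<n. 1 + f r)"
  proof (rule mult_right_mono[OF _ pos])
    show "1 - n * e \<le> (1 - e) ^ n"
      using Bernoulli_inequality[of "- e" n] e1 by (cases "n = 0") auto
  qed
  also have "\<dots> = (\<Prod>r<n. (1 - e) * (1 + f r))" by (simp add: prod.distrib)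
  also have "\<dots> \<le> (\<Prod>r<n. 1 + y r)"
    using lo f e1 by (intro prod_mono conjI mult_nonneg_nonneg) (auto intro: add_nonneg_nonneg)
  finally show "(1 - n * e) * (\<Prod>r<n. 1 + f r) \<le> (\<Prod>r<n. 1 + y r)" .
  have "(\<Prod>r<n. 1 + y r) \<le> (\<Prod>r<n. (1 + e) * (1 + f r))"
  proof (rule prod_mono, rule conjI)
    fix r assume r: "r \<in> {..<n}"
    have "0 \<le> (1 - e) * (1 + f r)" using e1 f[of r] r by (intro mult_nonneg_nonneg) auto
    then show "0 \<le> 1 + y r" using lo[of r] r by auto
    show "1 + y r \<le> (1 + e) * (1 + f r)" using up r by auto
  qed
  also have "\<dots> = (1 + e) ^ n * (\<Prod>r<n. 1 + f r)" by (simp add: prod.distrib)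
  also have "\<dots> \<le> (1 + 2 * (n * e)) * (\<Prod>r<n. 1 + f r)"
  proof (rule mult_right_mono[OF _ pos])
    have "(1 + e) ^ n \<le> exp e ^ n" using e by (intro power_mono) (auto simp: exp_ge_add_one_self)
    also have "\<dots> = exp (n * e)" by (simp add: exp_of_nat_mult)
    also have "\<dots> \<le> 1 + 2 * (n * e)"
    proof -
      have "exp (n * e) \<le> 1 + n * e + (n * e)\<^sup>2" using e by (intro exp_bound) auto
      moreover have "(n * e)\<^sup>2 \<le> n * e * 1" unfolding power2_eq_square using e by (intro mult_left_mono) auto
      ultimately show ?thesis by linarith
    qed
    finally show "(1 + e) ^ n \<le> 1 + 2 * (n * e)" .
  qed
  finally show "(\<Prod>r<n. 1 + y r) \<le> (1 + 2 * (n * e)) * (\<Prod>r<n. 1 + f r)" .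
qed

section \<open>Accuracy and running time\<close>

context spin_run
begin

text \<open>The sum of the extrapolation error for the exact node values and of the errors made at
  the nodes, the latter amplified by the Lagrange weights.\<close>

lemma ratio_accuracy:
  fixes R :: real
  assumes c: "0 < real_of_int G" "real_of_int B / S * (real_of_int G / S) > 1" "R\<^sup>2 * (real_of_int G / S) < real_of_int B / S" "U < S"
    and R: "R > 1 + 1 / real \<nu>" and \<nu>: "\<nu> \<ge> 2" and r: "r < n" and Y: "partial_sum r (m + 1) Y"
  shows "\<bar>Y / S - (tail_sum (1 / (real_of_int B / S)) (real_of_int G / S) (real_of_int U / S) n E r /
      tail_sum (1 / (real_of_int B / S)) (real_of_int G / S) (real_of_int U / S) n E (Suc r) - 1)\<bar> \<le>
    R / ((R - 1) * (R - 1 / real \<nu>) ^ Suc m) + 5 / 2 ^ m"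
proof -
  define e where "e = R / ((R - 1) * (R - 1 / real \<nu>) ^ Suc m)"
  have Sp: "real_of_int S > 0" "real_of_int B > 0" "real N > 0" using pos by simp_all
  have Nm: "real m / real N \<le> 1 / real \<nu>" using numbers(5) Sp \<nu> by (simp add: divide_simps)
  have m1: "m \<ge> 1" using numbers by simp
  have mN: "m < N"
  proof -
    have "m * 2 \<le> m * \<nu>" using \<nu> by (intro mult_left_mono) auto
    then show ?thesis using m1 numbers(5) by linarith
  qed
  have nr: "path_ratio (real j / real N / (real_of_int B / S)) (real_of_int G / S * (real j / real N)) (real_of_int U / S) n E
      (\<lambda>w. if w < r then 1 else 0) r = node_ratio r j" for j
    using Sp by (simp add: node_ratio_def mult.commute)
  have 1: "\<bar>tail_sum (1 / (real_of_int B / S)) (real_of_int G / S) (real_of_int U / S) n E r /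
      tail_sum (1 / (real_of_int B / S)) (real_of_int G / S) (real_of_int U / S) n E (Suc r) - 1 -
      (\<Sum>j\<le>m. node_weight j * node_ratio r j)\<bar> \<le> e"
    unfolding e_def node_weight_def nr[symmetric]
    by (rule extrapolated_ratio) (use c R r Sp Nm E pos \<nu> in \<open>simp_all add: divide_simps\<close>)
  have "(\<Sum>j<m + 1. \<bar>node_weight j\<bar> * ((1/2) ^ M + 3 / S) + 1 / S) = (\<Sum>j\<le>m. \<bar>node_weight j\<bar>) * ((1/2) ^ M + 3 / S) + (m + 1) / S"
    by (simp add: lessThan_Suc_atMost sum.distrib sum_distrib_right add_divide_distrib)
  also have "\<dots> \<le> 2 ^ (m + 2 * N) * ((1/2) ^ M + 3 / S) + 2 ^ m / S"
  proof (intro add_mono mult_right_mono divide_right_mono)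
    show "(\<Sum>j\<le>m. \<bar>node_weight j\<bar>) \<le> 2 ^ (m + 2 * N)"
      unfolding node_weight_def by (rule lagrange_equidistant_sum[OF mN])
    have "m + 1 \<le> 2 ^ m" using less_exp[of m] by linarith
    then show "real (m + 1) \<le> 2 ^ m" by (metis of_nat_le_iff of_nat_numeral of_nat_power)
  qed (use Sp in auto)
  \<comment> \<open>Here M and K are explained: M exceeds the exponent m + 2 N of the amplification
    by m, and K exceeds M by another m.\<close>
  also have "\<dots> \<le> 1 / 2 ^ m + 3 / 2 ^ m + 1 / 2 ^ m"
  proof -
    have a: "2 ^ (m + 2 * N) * (1/2) ^ M = 1 / (2::real) ^ m"
      using numbers(6) by (simp add: power_add power_divide mult_2 distrib_left)
    have S: "real_of_int S = 2 ^ (m + 2 * N) * (2 ^ m * 2 ^ m)"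
    proof -
      have "K = m + 2 * N + (m + m)" using numbers(6,7) by simp
      then show ?thesis unfolding reads(1) by (simp only: power_add of_int_mult of_int_power of_int_numeral)
    qed
    have b: "2 ^ (m + 2 * N) * (3 / real_of_int S) = 3 / (2 ^ m * 2 ^ m)" unfolding S by simp
    have c: "2 ^ m / real_of_int S = 1 / (2 ^ (m + 2 * N) * 2 ^ m)" unfolding S by simp
    have p1: "(1::real) \<le> 2 ^ k" for k by simp
    have "3 / (2 ^ m * 2 ^ m) \<le> 3 / (1 * (2::real) ^ m)" "1 / (2 ^ (m + 2 * N) * 2 ^ m) \<le> 1 / (1 * (2::real) ^ m)"
      using p1 by (intro divide_left_mono mult_right_mono; simp)+
    then show ?thesis unfolding distrib_left a b c by simp
  qed
  finally have "\<bar>Y / S - (\<Sum>j<m + 1. node_weight j * node_ratio r j)\<bar> \<le> 5 / 2 ^ m"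
    using Y unfolding partial_sum_def by simp
  then have 2: "\<bar>Y / S - (\<Sum>j\<le>m. node_weight j * node_ratio r j)\<bar> \<le> 5 / 2 ^ m"
    by (simp add: lessThan_Suc_atMost)
  show ?thesis using 1 2 unfolding e_def by linarith
qed

lemma total_time_eq:
  "total_time = 6 * L + 20 + (3 * K + 30) + 1 +
    ((((51 * (2 * n * 2 ^ M + 1) + 21 * (m + 1) + 30) + 1) * (m + 1) + 13 * n + 20 + 1) * n + 2) + 2"
  by (simp only: total_time_def vertex_time_def node_time_def)

lemma output_quotient:
  "real_of_int (\<Prod>r<n. (S + Y r) * B ^ lower_degree r) / real_of_int (\<Prod>r<n. S * S ^ lower_degree r) =
    (real_of_int B / S) ^ card E * (\<Prod>r<n. 1 + real_of_int (Y r) / S)"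
proof -
  have Sp: "real_of_int S > 0" using pos by simp
  have "real_of_int (\<Prod>r<n. (S + Y r) * B ^ lower_degree r) / real_of_int (\<Prod>r<n. S * S ^ lower_degree r) =
    (\<Prod>r<n. (1 + real_of_int (Y r) / S) * (real_of_int B / S) ^ lower_degree r)"
    unfolding of_int_prod prod_dividef[symmetric]
  proof (intro prod.cong refl)
    fix r
    have "1 + real_of_int (Y r) / S = (S + real_of_int (Y r)) / S" using Sp by (simp add: add_divide_distrib)
    then show "real_of_int ((S + Y r) * B ^ lower_degree r) / real_of_int (S * S ^ lower_degree r) =
      (1 + real_of_int (Y r) / S) * (real_of_int B / S) ^ lower_degree r"
      by (simp add: power_divide)
  qed
  also have "\<dots> = (\<Prod>r<n. 1 + real_of_int (Y r) / S) * (real_of_int B / S) ^ (\<Sum>r<n. lower_degree r)"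
    by (simp add: prod.distrib power_sum)
  finally show ?thesis using card_edges[OF E] by (simp add: lower_degree_def)
qed

end

section \<open>Polynomial bounds for the precision and the time\<close>

definition precision :: "nat \<Rightarrow> real \<Rightarrow> nat" where
  "precision n \<epsilon> = eps_exp \<epsilon> + size_exp n"

text \<open>Nonnegativity is part of the notion, so that upper bounds can be multiplied.\<close>

definition poly_bounded :: "(nat \<Rightarrow> real \<Rightarrow> real) \<Rightarrow> bool" where
  "poly_bounded F \<longleftrightarrow> (\<exists>C d. \<forall>n \<epsilon>. \<epsilon> > 0 \<longrightarrow> 0 \<le> F n \<epsilon> \<and> F n \<epsilon> \<le> C * (1 + real n + 1 / \<epsilon>) ^ d)"

lemma poly_boundedI:
  "(\<And>n \<epsilon>. \<epsilon> > 0 \<Longrightarrow> 0 \<le> F n \<epsilon> \<and> F n \<epsilon> \<le> C * (1 + real n + 1 / \<epsilon>) ^ d) \<Longrightarrow> poly_bounded F"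
  unfolding poly_bounded_def by blast

lemma base_ge_1: "(\<epsilon>::real) > 0 \<Longrightarrow> 1 \<le> 1 + real n + 1 / \<epsilon>"
  by simp

lemma poly_bounded_const: "c \<ge> 0 \<Longrightarrow> poly_bounded (\<lambda>n \<epsilon>. c)"
  by (rule poly_boundedI[of _ c 0]) simp

lemma poly_bounded_size: "poly_bounded (\<lambda>n \<epsilon>. real n)"
  by (rule poly_boundedI[of _ 1 1]) simp

lemma poly_bounded_mult:
  assumes "poly_bounded F" "poly_bounded F'"
  shows "poly_bounded (\<lambda>n \<epsilon>. F n \<epsilon> * F' n \<epsilon>)"
proof -
  obtain C d C' d' where 1: "\<And>n \<epsilon>. \<epsilon> > 0 \<Longrightarrow> 0 \<le> F n \<epsilon> \<and> F n \<epsilon> \<le> C * (1 + real n + 1 / \<epsilon>) ^ d"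
    and 2: "\<And>n \<epsilon>. \<epsilon> > 0 \<Longrightarrow> 0 \<le> F' n \<epsilon> \<and> F' n \<epsilon> \<le> C' * (1 + real n + 1 / \<epsilon>) ^ d'"
    using assms unfolding poly_bounded_def by blast
  show ?thesis
  proof (rule poly_boundedI[of _ "C * C'" "d + d'"])
    fix n and \<epsilon> :: real assume e: "\<epsilon> > 0"
    have "F n \<epsilon> * F' n \<epsilon> \<le> (C * (1 + real n + 1 / \<epsilon>) ^ d) * (C' * (1 + real n + 1 / \<epsilon>) ^ d')"
      using 1[OF e, of n] 2[OF e, of n] by (intro mult_mono) auto
    then show "0 \<le> F n \<epsilon> * F' n \<epsilon> \<and> F n \<epsilon> * F' n \<epsilon> \<le> C * C' * (1 + real n + 1 / \<epsilon>) ^ (d + d')"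
      using 1[OF e, of n] 2[OF e, of n] by (simp add: power_add mult_ac)
  qed
qed

lemma poly_bounded_add:
  assumes "poly_bounded F" "poly_bounded F'"
  shows "poly_bounded (\<lambda>n \<epsilon>. F n \<epsilon> + F' n \<epsilon>)"
proof -
  obtain C d C' d' where 1: "\<And>n \<epsilon>. \<epsilon> > 0 \<Longrightarrow> 0 \<le> F n \<epsilon> \<and> F n \<epsilon> \<le> C * (1 + real n + 1 / \<epsilon>) ^ d"
    and 2: "\<And>n \<epsilon>. \<epsilon> > 0 \<Longrightarrow> 0 \<le> F' n \<epsilon> \<and> F' n \<epsilon> \<le> C' * (1 + real n + 1 / \<epsilon>) ^ d'"
    using assms unfolding poly_bounded_def by blast
  show ?thesis
  proof (rule poly_boundedI[of _ "\<bar>C\<bar> + \<bar>C'\<bar>" "d + d'"])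
    fix n and \<epsilon> :: real assume e: "\<epsilon> > 0"
    let ?q = "1 + real n + 1 / \<epsilon>"
    have "C * ?q ^ d \<le> \<bar>C\<bar> * ?q ^ (d + d')" "C' * ?q ^ d' \<le> \<bar>C'\<bar> * ?q ^ (d + d')"
      using base_ge_1[OF e, of n] by (intro mult_mono power_increasing; simp)+
    then show "0 \<le> F n \<epsilon> + F' n \<epsilon> \<and> F n \<epsilon> + F' n \<epsilon> \<le> (\<bar>C\<bar> + \<bar>C'\<bar>) * ?q ^ (d + d')"
      using 1[OF e, of n] 2[OF e, of n] unfolding distrib_right by linarith
  qed
qed

lemma poly_bounded_power: "poly_bounded F \<Longrightarrow> poly_bounded (\<lambda>n \<epsilon>. F n \<epsilon> ^ k)"
  by (induction k) (auto intro: poly_bounded_const poly_bounded_mult)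

text \<open>The precision is logarithmic: 2^L is at most (2 n + 1) (2 + 2 / \<epsilon>).\<close>

lemma poly_bounded_precision: "poly_bounded (\<lambda>n \<epsilon>. 2 ^ precision n \<epsilon>)"
proof (rule poly_boundedI[of _ 4 2])
  fix n and \<epsilon> :: real assume e: "\<epsilon> > 0"
  have "real (2 ^ size_exp n) \<le> real (2 * n + 1)" using size_exp(3)[of n] of_nat_le_iff by blast
  then have "(2::real) ^ size_exp n \<le> 2 * real n + 1" by simp
  also have "\<dots> \<le> 2 * real n + (2 + 2 * (1 / \<epsilon>))" using e by (intro add_left_mono) simp
  also have "\<dots> = 2 * (1 + real n + 1 / \<epsilon>)" by (simp add: algebra_simps)
  finally have "(2::real) ^ size_exp n \<le> 2 * (1 + real n + 1 / \<epsilon>)" .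
  moreover have "2 ^ eps_exp \<epsilon> \<le> 2 * (1 + real n + 1 / \<epsilon>)" using eps_exp(4)[OF e] by simp
  ultimately have "(2::real) ^ eps_exp \<epsilon> * 2 ^ size_exp n \<le> (2 * (1 + real n + 1 / \<epsilon>)) * (2 * (1 + real n + 1 / \<epsilon>))"
    using e by (intro mult_mono) auto
  then show "0 \<le> (2::real) ^ precision n \<epsilon> \<and> 2 ^ precision n \<epsilon> \<le> 4 * (1 + real n + 1 / \<epsilon>)\<^sup>2"
    by (simp add: precision_def power_add power2_eq_square algebra_simps)
qed

lemma poly_bounded_log: "poly_bounded (\<lambda>n \<epsilon>. real (precision n \<epsilon>))"
proof -
  obtain C d where 1: "\<And>n \<epsilon>. \<epsilon> > 0 \<Longrightarrow> 0 \<le> (2::real) ^ precision n \<epsilon> \<and> 2 ^ precision n \<epsilon> \<le> C * (1 + real n + 1 / \<epsilon>) ^ d"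
    using poly_bounded_precision unfolding poly_bounded_def by blast
  show ?thesis
  proof (rule poly_boundedI[of _ C d])
    fix n and \<epsilon> :: real assume e: "\<epsilon> > 0"
    have "real (precision n \<epsilon>) < 2 ^ precision n \<epsilon>" by (rule of_nat_less_two_power)
    then show "0 \<le> real (precision n \<epsilon>) \<and> real (precision n \<epsilon>) \<le> C * (1 + real n + 1 / \<epsilon>) ^ d"
      using 1[OF e, of n] by linarith
  qed
qed

text \<open>Covers the factor 2^M in the time of a search, as M is a constant multiple of L.\<close>

lemma poly_bounded_power_2: "poly_bounded (\<lambda>n \<epsilon>. 2 ^ (k * precision n \<epsilon>))"
proof -
  have "(2::real) ^ (k * l) = (2 ^ l) ^ k" for l by (simp add: power_mult[symmetric] mult.commute)
  then show ?thesis using poly_bounded_power[OF poly_bounded_precision, of k] by simp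
qed

lemmas poly_bounded_intros = poly_bounded_add poly_bounded_mult poly_bounded_power_2 poly_bounded_size
  poly_bounded_log poly_bounded_const

text \<open>All conditions are strict and survive a loss of t in \<beta> and \<gamma>, which makes
  room for rounding. The nodes will lie in [0, 1 / \<nu>].\<close>

lemma fptas_constants:
  fixes \<beta> \<gamma> \<mu> :: real
  assumes "\<gamma> > 0" "\<gamma> < \<beta>" "\<beta> * \<gamma> > 1"
  obtains R :: real and t :: real and \<nu> :: nat
  where "R\<^sup>2 * \<gamma> < \<beta> - t" "t > 0" "t < \<gamma>" "(\<beta> - t) * (\<gamma> - t) > 1" "\<nu> \<ge> 4" "4 * \<gamma> \<le> real \<nu>" "R > 1 + 1 / real \<nu>"
proof -
  \<comment> \<open>The fourth root makes R^2 the geometric mean of 1 and \<beta> /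
    \<gamma>.\<close>
  define R where "R = sqrt (sqrt (\<beta> / \<gamma>))"
  have q: "\<beta> / \<gamma> > 1" using assms by simp
  have R: "R > 1" using q by (simp add: R_def)
  have R2: "R\<^sup>2 * \<gamma> < \<beta>"
  proof -
    have "R\<^sup>2 = sqrt (\<beta> / \<gamma>)" using q by (simp add: R_def)
    also have "\<dots> < \<beta> / \<gamma>"
    proof (rule real_less_lsqrt)
      have "1 * (\<beta> / \<gamma>) < \<beta> / \<gamma> * (\<beta> / \<gamma>)" using q by (intro mult_strict_right_mono) auto
      then show "\<beta> / \<gamma> < (\<beta> / \<gamma>)\<^sup>2" by (simp only: power2_eq_square mult_1)
    qed (use q in simp)
    finally show ?thesis using assms by (simp add: pos_less_divide_eq)
  qed
  \<comment> \<open>Half of each slack; the last term rests on (\<beta> - t) (\<gamma> - t) >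
    \<beta> \<gamma> - t (\<beta> + \<gamma>).\<close>
  define t where "t = min (\<gamma> / 2) (min ((\<beta> - R\<^sup>2 * \<gamma>) / 2) ((\<beta> * \<gamma> - 1) / (2 * (\<beta> + \<gamma>))))"
  have t: "t > 0" "t < \<gamma>" "R\<^sup>2 * \<gamma> < \<beta> - t"
  proof -
    have "0 < (\<beta> * \<gamma> - 1) / (2 * (\<beta> + \<gamma>))" using assms by (intro divide_pos_pos) auto
    then show "t > 0" using assms R2 unfolding t_def by simp
    have "t \<le> \<gamma> / 2" unfolding t_def by (rule min.cobounded1)
    then show "t < \<gamma>" using assms by simp
    have "t \<le> (\<beta> - R\<^sup>2 * \<gamma>) / 2" unfolding t_def by (intro min.coboundedI2 min.cobounded1)
    then show "R\<^sup>2 * \<gamma> < \<beta> - t" using R2 by simp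
  qed
  have "t \<le> (\<beta> * \<gamma> - 1) / (2 * (\<beta> + \<gamma>))" unfolding t_def by simp
  then have "t * (2 * (\<beta> + \<gamma>)) \<le> \<beta> * \<gamma> - 1" using assms by (simp add: pos_le_divide_eq)
  then have "t * (\<beta> + \<gamma>) < \<beta> * \<gamma> - 1" using assms by (simp add: algebra_simps)
  moreover have "0 < t * t" using t by simp
  ultimately have bg: "(\<beta> - t) * (\<gamma> - t) > 1" by (simp add: algebra_simps)
  \<comment> \<open>The bounds 4 and 4 \<gamma> bring a and g to at most 1/4 at the nodes; 1 / (R -
    1) ensures R - 1 / \<nu> > 1, the base of the geometric decay.\<close>
  obtain \<nu> :: nat where \<nu>: "real \<nu> > max (max 4 (4 * \<gamma>)) (1 / (R - 1))" using reals_Archimedean2 by blast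
  then have "\<nu> \<ge> 4" "4 * \<gamma> \<le> real \<nu>" "1 / (R - 1) < real \<nu>" by auto
  moreover from this(3) have "R > 1 + 1 / real \<nu>" using R \<open>\<nu> \<ge> 4\<close> by (simp add: field_simps)
  ultimately show ?thesis using that t bg by blast
qed

text \<open>c is a constant of the program and must not depend on n or \<epsilon>. From c \<ge> 9
  follows 8 + L \<le> c L for L \<ge> 1, which later absorbs a factor 160 into 2^m.\<close>

lemma precision_constant:
  fixes \<rho> t A C :: real
  assumes "\<rho> > 1" "t > 0"
  obtains c :: nat where "c \<ge> 9" "(1/2) ^ c < t" "A \<le> 2 ^ c" "C \<le> \<rho> ^ c"
proof -
  obtain c1 where c1: "(1/2) ^ c1 < t" using real_arch_pow_inv[of t "1/2"] assms by auto
  obtain c2 where c2: "A < 2 ^ c2" using real_arch_pow[of 2 A] by auto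
  obtain c3 where c3: "C < \<rho> ^ c3" using real_arch_pow[of \<rho> C] assms by auto
  define c where "c = 9 + c1 + c2 + c3"
  have "(1/2 :: real) ^ c \<le> (1/2) ^ c1" by (intro power_decreasing) (auto simp: c_def)
  moreover have "(2::real) ^ c2 \<le> 2 ^ c" by (intro power_increasing) (auto simp: c_def)
  moreover have "\<rho> ^ c3 \<le> \<rho> ^ c" using assms by (intro power_increasing) (auto simp: c_def)
  ultimately have "(1/2) ^ c < t" "A \<le> 2 ^ c" "C \<le> \<rho> ^ c" using c1 c2 c3 by linarith+
  moreover have "c \<ge> 9" by (simp add: c_def)
  ultimately show ?thesis using that by blast
qed

text \<open>\<open>word_size\<close> bounds the bit lengths of the operands of a search, \<open>op_cost\<close> the cost of every
  executed instruction, and \<open>steps\<close> the number of instructions.\<close>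

definition word_size :: "nat \<Rightarrow> nat \<Rightarrow> nat \<Rightarrow> nat \<Rightarrow> nat" where
  "word_size c \<nu> k L = (3 * c + 2 * (c * \<nu>)) * L + 2 * L + k + 2"

definition op_cost :: "nat \<Rightarrow> nat \<Rightarrow> nat \<Rightarrow> nat \<Rightarrow> nat \<Rightarrow> nat" where
  "op_cost c \<nu> k n L = 20 * ((n + 2) * (n + 2) * ((c * L + 5) * (word_size c \<nu> k L + 1)))"

definition steps :: "nat \<Rightarrow> nat \<Rightarrow> nat \<Rightarrow> nat \<Rightarrow> nat" where
  "steps c \<nu> n L = 6 * L + 20 + (3 * ((3 * c + 2 * (c * \<nu>)) * L) + 30) + 1 +
    ((((51 * (2 * n * 2 ^ ((2 * c + 2 * (c * \<nu>)) * L) + 1) + 21 * (c * L + 1) + 30) + 1) * (c * L + 1) + 13 * n + 20 + 1) * n + 2) + 2"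

lemma poly_bounded_time: "poly_bounded (\<lambda>n \<epsilon>. real (op_cost c \<nu> k n (precision n \<epsilon>) * steps c \<nu> n (precision n \<epsilon>)))"
  unfolding op_cost_def steps_def word_size_def of_nat_add of_nat_mult of_nat_power of_nat_numeral of_nat_1
  by (intro poly_bounded_intros) auto

text \<open>\<rho>^(c L) is at least q^L; one of these L factors pays for q, and each of the others
  for a 2.\<close>

lemma geometric_bound:
  fixes \<rho> q :: real
  assumes "\<rho> \<ge> 1" "q \<ge> 2" "q \<le> \<rho> ^ c" "L \<ge> 1"
  shows "q * 2 ^ L \<le> 2 * \<rho> ^ Suc (c * L)"
proof -
  obtain l where l: "L = Suc l" using assms(4) by (cases L) auto
  have "q * 2 ^ l \<le> q * q ^ l" using assms by (intro mult_left_mono power_mono) auto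
  also have "\<dots> = q ^ L" by (simp add: l)
  also have "\<dots> \<le> (\<rho> ^ c) ^ L" using assms by (intro power_mono) auto
  also have "\<dots> = \<rho> ^ (c * L)" by (simp add: power_mult)
  also have "\<dots> \<le> \<rho> ^ Suc (c * L)" using assms by (intro power_increasing) auto
  finally show ?thesis by (simp add: l)
qed

text \<open>D accounts for the rounded parameters and e for the computed ratios. The total loss is
  at most h / 8 in either direction, and the slack up to h makes the inequalities strict.
  \<open>h\<close> will be \<epsilon> capped at 1/2.\<close>

lemma relative_error:
  fixes Z Z\<^sub>1 Z' h D e :: real
  assumes "Z > 0" "h > 0" "h \<le> \<epsilon>" "h \<le> 1/2" "D \<le> h / 16" "0 \<le> e" "e \<le> h / 16"
    and "(1 - D) * Z \<le> Z\<^sub>1" "Z\<^sub>1 \<le> Z" "(1 - e) * Z\<^sub>1 \<le> Z'" "Z' \<le> (1 + 2 * e) * Z\<^sub>1"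
  shows "(1 - \<epsilon>) * Z < Z'" "Z' < (1 + \<epsilon>) * Z"
proof -
  have hZ: "h * Z > 0" "h * Z \<le> \<epsilon> * Z" using assms by auto
  have eZ: "e * Z \<le> h / 16 * Z" "D * Z \<le> h / 16 * Z" using assms by (intro mult_right_mono; simp)+
  have "e * Z\<^sub>1 \<le> e * Z" using assms by (intro mult_left_mono) auto
  then show "(1 - \<epsilon>) * Z < Z'" "Z' < (1 + \<epsilon>) * Z"
    using assms(8-11) hZ eZ by (simp_all add: algebra_simps)
qed

section \<open>One run on the rounded system\<close>

locale fptas_run =
  fixes \<beta> \<gamma> \<mu> \<epsilon> R t A :: real and \<nu> c k n :: nat and E :: "(nat \<times> nat) set"
    and L m N M K v W :: nat and S B G Q U :: int
  assumes weights: "0 < \<gamma>" "1 \<le> \<beta>" "\<gamma> < \<beta>" "0 \<le> \<mu>" "\<mu> \<le> 1"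
    and R: "R\<^sup>2 * \<gamma> < \<beta> - t" "t < \<gamma>" "(\<beta> - t) * (\<gamma> - t) > 1" "\<nu> \<ge> 4" "4 * \<gamma> \<le> real \<nu>" "R > 1 + 1 / real \<nu>"
    and A: "1 \<le> A" "1 \<le> A * \<gamma>" "\<mu> > 0 \<Longrightarrow> 3 \<le> A * \<mu>"
    and c: "c \<ge> 9" "(1/2) ^ c < t" "8 * A \<le> 2 ^ c" "64 * (R / (R - 1)) \<le> (R - 1 / real \<nu>) ^ c"
    and k: "\<beta> < 2 ^ k"
    and graph: "simple_graph n E" and eps_pos: "\<epsilon> > 0"
    and L_eq: "L = precision n \<epsilon>" and m_eq: "m = c * L" and N_eq: "N = m * \<nu>" and M_eq: "M = 2 * (m + N)" and K_eq: "K = M + m"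
    and v_eq: "v = word_size c \<nu> k L" and W_eq: "W = op_cost c \<nu> k n L"
    and S_eq: "S = 2 ^ K" and B_eq: "B = \<lfloor>2 ^ K * \<beta>\<rfloor>" and G_eq: "G = \<lfloor>2 ^ K * \<gamma>\<rfloor>" and Q_eq: "Q = \<lfloor>2 ^ K * \<mu>\<rfloor>"
    and U_eq: "U = (Q * S) div (S + 1)"
begin

lemma exponents: "L \<ge> 1" "c * L \<ge> 9 * L" "c * L \<ge> c" "K \<ge> c + 2 * L" "v = K + 2 * L + k + 2" "M + 1 \<le> K"
proof -
  show L: "L \<ge> 1" using eps_exp(1)[OF eps_pos] by (simp add: L_eq precision_def)
  show 1: "c * L \<ge> 9 * L" using c(1) by (rule mult_right_mono) simp
  have "c * 1 \<le> c * L" using L by (intro mult_left_mono) auto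
  then show 2: "c * L \<ge> c" by simp
  have "K = 2 * (c * L) + 2 * N + c * L" "M = 2 * (c * L) + 2 * N" by (simp_all add: K_eq M_eq m_eq)
  then show "K \<ge> c + 2 * L" "M + 1 \<le> K" using 1 2 L by linarith+
  show "v = K + 2 * L + k + 2" by (simp add: v_eq word_size_def K_eq M_eq N_eq m_eq algebra_simps)
qed

text \<open>2^L exceeds n and n / \<epsilon> at once, so an error of order 2^-L per vertex is
  affordable.\<close>

lemma two_power_L: "2 * (n + 1) \<le> 2 ^ L" "real n + 1 \<le> \<epsilon> * 2 ^ L"
proof -
  have 1: "n + 1 \<le> 2 ^ size_exp n" using size_exp(1)[of n] by simp
  have "(2::nat) ^ 1 \<le> 2 ^ eps_exp \<epsilon>" using eps_exp(1)[OF eps_pos] by (intro power_increasing) auto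
  then have "2 * (n + 1) \<le> 2 ^ eps_exp \<epsilon> * 2 ^ size_exp n" using 1 by (intro mult_mono) auto
  then show "2 * (n + 1) \<le> 2 ^ L" by (simp add: L_eq precision_def power_add)
  have "real (n + 1) \<le> real (2 ^ size_exp n)" using 1 by (simp only: of_nat_le_iff)
  then have "1 * (real n + 1) \<le> (\<epsilon> * 2 ^ eps_exp \<epsilon>) * 2 ^ size_exp n"
    using eps_exp(2)[OF eps_pos] by (intro mult_mono) auto
  then show "real n + 1 \<le> \<epsilon> * 2 ^ L" by (simp add: L_eq precision_def power_add mult.assoc)
qed

lemma real_S: "real_of_int S = 2 ^ K" and S_pos: "S > 0"
  by (simp_all add: S_eq)

lemma rounded_weights:
  "2 ^ K * \<beta> - 1 < B" "B \<le> 2 ^ K * \<beta>" "2 ^ K * \<gamma> - 1 < G" "G \<le> 2 ^ K * \<gamma>" "S \<le> B" "0 \<le> G"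
proof -
  show "2 ^ K * \<beta> - 1 < B" "B \<le> 2 ^ K * \<beta>" "2 ^ K * \<gamma> - 1 < G" "G \<le> 2 ^ K * \<gamma>"
    unfolding B_eq G_eq by linarith+
  have "(2::real) ^ K * 1 \<le> 2 ^ K * \<beta>" using weights(2) by (intro mult_left_mono) auto
  then show "S \<le> B" unfolding B_eq le_floor_iff real_S by simp
  show "0 \<le> G" using weights(1) by (simp add: G_eq)
qed

text \<open>Multiplying by S / (S + 1) before rounding gives U < S even if Q = S, which
  zero-freeness requires, at the price of at most two units.\<close>

lemma rounded_field: "0 \<le> Q" "Q \<le> S" "0 \<le> U" "U < S" "Q - 2 \<le> U" "U \<le> Q"
proof -
  show Q: "0 \<le> Q" using weights(4) by (simp add: Q_eq)
  have "(2::real) ^ K * \<mu> \<le> 2 ^ K * 1" using weights(5) by (intro mult_left_mono) auto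
  then have "real_of_int Q \<le> real_of_int S" unfolding Q_eq real_S by linarith
  then show QS: "Q \<le> S" by simp
  show "0 \<le> U" unfolding U_eq using Q S_pos by (intro pos_imp_zdiv_nonneg_iff[THEN iffD2]) auto
  define \<rho> where "\<rho> = (Q * S) mod (S + 1)"
  have \<rho>: "0 \<le> \<rho>" "\<rho> < S + 1" unfolding \<rho>_def by (rule pos_mod_sign pos_mod_bound, use S_pos in linarith)+
  have U: "U * (S + 1) + \<rho> = Q * S" unfolding U_eq \<rho>_def by (rule div_mult_mod_eq)
  have "Q * S \<le> S * S" using QS S_pos by (intro mult_right_mono) auto
  then have "U * (S + 1) \<le> S * S" using U \<rho> by linarith
  also have "\<dots> < S * (S + 1)" using S_pos by (intro mult_strict_left_mono) auto
  finally have "U * (S + 1) < S * (S + 1)" .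
  then show "U < S" using S_pos by (simp add: mult_less_cancel_right)
  have "(Q - 2) * (S + 1) \<le> U * (S + 1)" using U \<rho> QS by (simp add: algebra_simps)
  then show "Q - 2 \<le> U" using S_pos by (simp add: mult_le_cancel_right)
  have "U * (S + 1) \<le> Q * (S + 1)" using U \<rho> Q by (simp add: algebra_simps)
  then show "U \<le> Q" using S_pos by (simp add: mult_le_cancel_right)
qed

lemma run: "spin_run (real_inputs \<beta> \<gamma> \<mu> \<epsilon>) W v n m N M S B G U E L K c \<nu>"
proof
  show "simple_graph n E" by (rule graph)
  show "S > 0" "G \<ge> 0" "0 \<le> U" "U \<le> S" using rounded_field rounded_weights S_pos by simp_all
  show "B > 0" using rounded_weights(5) S_pos by simp
  have m1: "m \<ge> 1" using exponents(1,2) m_eq by simp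
  show "N > 0" using m1 R(4) N_eq by simp
  show "m \<le> N" using R(4) N_eq by simp
  have Nr: "real N = m * real \<nu>" by (simp add: N_eq)
  show "4 * int m * S \<le> int N * B"
  proof -
    have "m * 4 \<le> m * \<nu>" using R(4) by (intro mult_left_mono) auto
    then have "4 * int m \<le> int N" unfolding N_eq by linarith
    then show ?thesis using rounded_weights(5) S_pos by (intro mult_mono) auto
  qed
  show "4 * G * int m \<le> S * int N"
  proof -
    have "4 * real_of_int G * m \<le> 4 * (2 ^ K * \<gamma>) * m" using rounded_weights(4) by (intro mult_right_mono) auto
    also have "\<dots> = 2 ^ K * (m * (4 * \<gamma>))" by simp
    also have "\<dots> \<le> 2 ^ K * (m * real \<nu>)" using R(5) by (intro mult_left_mono) auto
    finally have "real_of_int (4 * G * int m) \<le> real_of_int (S * int N)" using real_S Nr by simp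
    then show ?thesis by (simp only: of_int_le_iff)
  qed
  have small: "\<bar>z\<bar> < 2 ^ v" if "0 \<le> z" "real_of_int z < 2 ^ K * 2 ^ k" for z :: int
  proof -
    have "(2::real) ^ K * 2 ^ k \<le> 2 ^ v" unfolding power_add[symmetric] using exponents(5) by (intro power_increasing) auto
    then have "real_of_int z < 2 ^ v" using that by linarith
    then have "real_of_int z < real_of_int (2 ^ v)" by (simp only: of_int_power of_int_numeral)
    then show ?thesis using that by (simp only: of_int_less_iff abs_of_nonneg)
  qed
  have "(2::int) ^ K < 2 ^ v" using exponents(5) by (intro power_strict_increasing) auto
  then show "bits S \<le> v" by (simp add: bits_le_iff S_eq)
  have "2 ^ K * \<beta> < 2 ^ K * 2 ^ k" "2 ^ K * \<gamma> < 2 ^ K * 2 ^ k" using k weights by auto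
  then have "real_of_int B < 2 ^ K * 2 ^ k" "real_of_int G < 2 ^ K * 2 ^ k"
    using rounded_weights(2,4) by linarith+
  then show "bits B \<le> v" "bits G \<le> v" unfolding bits_le_iff using small \<open>B > 0\<close> \<open>G \<ge> 0\<close> by simp_all
  show "bits (int N) \<le> v"
  proof (rule bits_of_nat)
    have "N < 2 ^ N" by (rule less_exp)
    also have "(2::nat) ^ N \<le> 2 ^ v" using exponents(5) K_eq M_eq by (intro power_increasing) auto
    finally show "N < 2 ^ v" .
  qed
  have P: "n + 2 \<le> 2 ^ L" using two_power_L(1) by simp
  show "int (n * n + 4 * n + 4) < 2 ^ v"
  proof -
    have "(n + 2) * (n + 2) \<le> 2 ^ L * 2 ^ L" using P by (intro mult_mono) auto
    also have "\<dots> = (2::nat) ^ (L + L)" by (simp add: power_add)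
    also have "\<dots> < 2 ^ v" using exponents(5) by (intro power_strict_increasing) auto
    finally have "n * n + 4 * n + 4 < 2 ^ v" by (simp add: algebra_simps)
    then have "int (n * n + 4 * n + 4) < int (2 ^ v)" by (simp only: of_nat_less_iff)
    then show ?thesis by simp
  qed
  show "int M + int n < 2 ^ v"
  proof -
    have "M < 2 ^ M" by (rule less_exp)
    also have "(2::nat) ^ M \<le> 2 ^ K" using exponents(6) by (intro power_increasing) auto
    finally have 1: "M < 2 ^ K" .
    have "(2::nat) ^ L \<le> 2 ^ K" using exponents(4) by (intro power_increasing) auto
    then have "M + n < 2 ^ K + 2 ^ K" using P 1 by linarith
    then have "M + n < 2 ^ Suc K" by simp
    also have "(2::nat) ^ Suc K \<le> 2 ^ v" using exponents(5) by (intro power_increasing) auto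
    finally have "int (M + n) < int (2 ^ v)" by (simp only: of_nat_less_iff)
    then show ?thesis by simp
  qed
  show "W \<ge> 20 * ((n + 2) * (n + 2) * ((m + 5) * (v + 1)))"
    by (simp add: W_eq op_cost_def v_eq m_eq)
  show "L = eps_exp (real_inputs \<beta> \<gamma> \<mu> \<epsilon> Eps) + size_exp n" by (simp add: L_eq precision_def)
qed (use exponents(1) c(1) R(4) m_eq N_eq M_eq K_eq S_eq B_eq G_eq Q_eq U_eq eps_pos rounded_field in simp_all)

sublocale spin_run "real_inputs \<beta> \<gamma> \<mu> \<epsilon>" W v n m N M S B G U E L K c \<nu>
  by (rule run)

text \<open>The input memory is 0 behind the matrix, and 0 is the state of a free vertex: nothing
  has to be initialised.\<close>

lemma memory_represents: "represents_from (mem (graph_input n E)) 0"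
  unfolding represents_from_def
proof (intro conjI allI impI)
  fix i j assume ij: "i < n" "j < n"
  have "i' = i \<and> j' = j" if "i * n + j = i' * n + j'" "j' < n" for i' j'
  proof -
    have "(a * n + b) div n = a" "(a * n + b) mod n = b" if "b < n" for a b using that by simp_all
    then show ?thesis using that ij by metis
  qed
  then have "(\<exists>i'<n. \<exists>j'<n. i * n + j = i' * n + j' \<and> ((i', j') \<in> E \<or> (j', i') \<in> E)) \<longleftrightarrow> adj E i j"
    using ij unfolding adj_def by metis
  then show "mem (graph_input n E) (i * n + j) = (if adj E i j then 1 else 0)" by (simp add: graph_input_def)
next
  fix w assume "w < n"
  have "n * n + w \<noteq> i * n + j" if "i < n" "j < n" for i j
  proof -
    have "i * n + j < Suc i * n" using that by simp
    also have "\<dots> \<le> n * n" using that by (intro mult_right_mono) auto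
    finally show ?thesis by linarith
  qed
  then show "mem (graph_input n E) (n * n + w) = (if w < 0 then 1 else 0)" by (auto simp: graph_input_def)
qed

text \<open>The rounded weights lie within t of \<beta> and \<gamma>, so they still satisfy the
  strict conditions for the radius R. One half of the error goes to the extrapolation, the other to
  the nodes.\<close>

lemma ratio_error:
  assumes r: "r < n" and Y: "partial_sum r (m + 1) Y"
  shows "\<bar>Y / S - (tail_sum (1 / (real_of_int B / S)) (real_of_int G / S) (real_of_int U / S) n E r /
      tail_sum (1 / (real_of_int B / S)) (real_of_int G / S) (real_of_int U / S) n E (Suc r) - 1)\<bar> \<le> 1 / (16 * 2 ^ L)"
proof -
  define b g where "b = real_of_int B / S" and "g = real_of_int G / S"
  have "(1/2 :: real) ^ K \<le> (1/2) ^ c" using exponents(4) by (intro power_decreasing) auto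
  then have t: "1 / 2 ^ K < t" using c(2) by (simp add: power_divide)
  have "(2 ^ K * \<beta> - 1) / 2 ^ K \<le> b" "b \<le> 2 ^ K * \<beta> / 2 ^ K" "(2 ^ K * \<gamma> - 1) / 2 ^ K \<le> g" "g \<le> 2 ^ K * \<gamma> / 2 ^ K"
    unfolding b_def g_def real_S using rounded_weights(1-4) by (intro divide_right_mono; simp)+
  then have b: "\<beta> - t < b" "b \<le> \<beta>" and g: "\<gamma> - t < g" "g \<le> \<gamma>"
    using t by (simp_all add: diff_divide_distrib)
  have R1: "R - 1 / real \<nu> > 1" "R > 1"
    using R(6) order_trans[of 0 "1 / real \<nu>"] by (simp_all add: algebra_simps) (smt (verit) of_nat_0_le_iff divide_nonneg_nonneg)
  have "(\<beta> - t) * (\<gamma> - t) \<le> b * g" using b g R(2) weights(3) by (intro mult_mono) auto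
  then have bg: "b * g > 1" using R(3) by linarith
  have "R\<^sup>2 * g \<le> R\<^sup>2 * \<gamma>" using g(2) by (intro mult_left_mono) auto
  then have Rg: "R\<^sup>2 * g < b" using R(1) b(1) by linarith
  have "real_of_int G > 0"
  proof -
    have "0 < g" using g(1) R(2) by simp
    then show ?thesis unfolding g_def using S_pos by (simp add: zero_less_divide_iff)
  qed
  then have "\<bar>Y / S - (tail_sum (1 / b) g (real_of_int U / S) n E r / tail_sum (1 / b) g (real_of_int U / S) n E (Suc r) - 1)\<bar> \<le>
    R / ((R - 1) * (R - 1 / real \<nu>) ^ Suc m) + 5 / 2 ^ m"
    unfolding b_def g_def
    by (intro ratio_accuracy) (use bg Rg R(4,6) rounded_field(4) r Y in \<open>simp_all add: b_def g_def\<close>)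
  also have "R / ((R - 1) * (R - 1 / real \<nu>) ^ Suc m) \<le> 1 / (32 * 2 ^ L)"
  proof -
    define q where "q = R / (R - 1)"
    have q: "q \<ge> 1" unfolding q_def using R1 by simp
    have "64 * q * 2 ^ L \<le> 2 * (R - 1 / real \<nu>) ^ Suc (c * L)"
      using geometric_bound[of "R - 1 / real \<nu>" "64 * q" c L] R1(1) q c(4) exponents(1) unfolding q_def by simp
    then have "q * (32 * 2 ^ L) \<le> (R - 1 / real \<nu>) ^ Suc m" unfolding m_eq by simp
    moreover have "y > 0 \<Longrightarrow> q * (32 * 2 ^ L) \<le> y \<Longrightarrow> q / y \<le> 1 / (32 * 2 ^ L)" for y :: real
      by (simp add: field_simps)
    moreover have "(R - 1 / real \<nu>) ^ Suc m > 0" using R1(1) by (intro zero_less_power) simp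
    ultimately have "q / (R - 1 / real \<nu>) ^ Suc m \<le> 1 / (32 * 2 ^ L)" by blast
    then show ?thesis unfolding q_def by simp
  qed
  also have "5 / 2 ^ m \<le> 1 / (32 * (2::real) ^ L)"
  proof -
    \<comment> \<open>5 / 2^m has to stay below 1 / (32 2^L), and 5 times 32 is 160 \<le>
      2^8.\<close>
    have "160 * (2::real) ^ L \<le> 2 ^ (8 + L)" by (simp add: power_add)
    also have "\<dots> \<le> 2 ^ m"
    proof (rule power_increasing)
      show "8 + L \<le> m" using exponents(1,2) unfolding m_eq by linarith
    qed simp
    finally show ?thesis by (simp add: field_simps)
  qed
  also have "1 / (32 * 2 ^ L) + 1 / (32 * (2::real) ^ L) = 1 / (16 * 2 ^ L)" by simp
  finally show ?thesis unfolding b_def g_def by simp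
qed

text \<open>Two comparisons: the given system with the rounded one, at a relative loss of at most
  (|E| + n) A / S, and the rounded one with the output, vertex by vertex at a loss of e each. Both
  sums are at most h / 16.\<close>

lemma run_accuracy:
  assumes Y: "\<And>r. r < n \<Longrightarrow> partial_sum r (m + 1) (Y r)"
  defines "Z \<equiv> partition_function (interaction \<beta> \<gamma>) \<mu> {..<n} E"
  defines "Z' \<equiv> (real_of_int B / S) ^ card E * (\<Prod>r<n. 1 + real_of_int (Y r) / S)"
  shows "(1 - \<epsilon>) * Z < Z'" "Z' < (1 + \<epsilon>) * Z"
proof -
  define b g u where "b = real_of_int B / S" and "g = real_of_int G / S" and "u = real_of_int U / S"
  define h where "h = min \<epsilon> (1/2)"
  define e where "e = 1 / (16 * (2::real) ^ L)"
  define d where "d = A / S"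
  define f where "f r = tail_sum (1 / b) g u n E r / tail_sum (1 / b) g u n E (Suc r) - 1" for r
  note E' = simple_graph_edges[OF graph]
  have Sp: "real_of_int S > 0" using S_pos by simp
  have h: "h > 0" "h \<le> \<epsilon>" "h \<le> 1/2" using eps_pos by (auto simp: h_def)
  have nh: "(real n + 1) / 2 ^ L \<le> h"
  proof -
    have "real (2 * (n + 1)) \<le> real (2 ^ L)" using two_power_L(1) by (simp only: of_nat_le_iff)
    then have "2 * (real n + 1) \<le> 2 ^ L" by simp
    then show ?thesis using two_power_L(2) unfolding h_def by (simp add: divide_le_eq)
  qed
  have "real n / 2 ^ L \<le> (real n + 1) / 2 ^ L" by (intro divide_right_mono) auto
  then have nh': "real n / 2 ^ L \<le> h" using nh by linarith
  have b0: "b > 0" and g0: "g \<ge> 0" and u0: "u \<ge> 0"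
    unfolding b_def g_def u_def using Sp rounded_weights(5,6) rounded_field(3) S_pos by simp_all
  have Zpos: "tail_sum (1 / b') g' u' n E r > 0" if "b' > 0" "g' \<ge> 0" "u' \<ge> 0" for b' g' u' :: real and r
    using that by (intro tail_sum_pos) auto
  have d: "0 \<le> d" "d \<le> 1" "(real (card E) + real n) * d \<le> h / 16"
  proof -
    show "0 \<le> d" using A(1) Sp by (simp add: d_def)
    have "2 ^ c * ((2::real) ^ L * 2 ^ L) = 2 ^ (c + 2 * L)" by (simp add: power_add mult_2)
    also have "\<dots> \<le> real_of_int S" unfolding real_S using exponents(4) by (intro power_increasing) auto
    finally have S: "2 ^ c * (2 ^ L * 2 ^ L) \<le> real_of_int S" .
    have "8 * A * (2 ^ L * 2 ^ L) \<le> 2 ^ c * (2 ^ L * 2 ^ L)" using c(3) by (intro mult_right_mono) auto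
    then have AS: "8 * A * (2 ^ L * 2 ^ L) \<le> real_of_int S" using S by linarith
    then have dl: "d \<le> 1 / (8 * (2 ^ L * 2 ^ L))" unfolding d_def using Sp by (simp add: field_simps)
    also have "\<dots> \<le> 1 / (8 * (1 * 1))" by (intro divide_left_mono mult_left_mono mult_mono) auto
    finally show "d \<le> 1" by simp
    have "real (card E) \<le> real n * real n" using E'(5) by (metis of_nat_le_iff of_nat_mult)
    then have "(real (card E) + real n) * d \<le> (real n * (real n + 1)) * (1 / (8 * (2 ^ L * 2 ^ L)))"
      using dl \<open>0 \<le> d\<close> by (intro mult_mono) (auto simp: algebra_simps)
    \<comment> \<open>One of the two quotients is bounded by 1/2 and the other by h.\<close>
    also have "\<dots> = (real n / 2 ^ L) * ((real n + 1) / 2 ^ L) / 8" by simp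
    also have "\<dots> \<le> 1/2 * h / 8"
      using nh h order_trans[OF nh' h(3)] by (intro divide_right_mono mult_mono) auto
    finally show "(real (card E) + real n) * d \<le> h / 16" by simp
  qed
  \<comment> \<open>A loss of one unit 1 / S on y is a relative loss of at most d = A / S, because A
    y \<ge> 1.\<close>
  have near: "(1 - d) * y \<le> z / S" if "1 \<le> A * y" "2 ^ K * y - 1 \<le> z" for y z :: real
  proof -
    have "(1 - d) * y = (2 ^ K * y - A * y) / S" using Sp unfolding real_S d_def by (simp add: field_simps)
    also have "\<dots> \<le> z / S" using that Sp by (intro divide_right_mono) auto
    finally show ?thesis .
  qed
  have lo: "(1 - d) * \<beta> \<le> b" "(1 - d) * \<gamma> \<le> g" "(1 - d) * \<mu> \<le> u"
  proof -
    have "1 * 1 \<le> A * \<beta>" using A(1) weights(2) by (intro mult_mono) auto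
    then show "(1 - d) * \<beta> \<le> b" unfolding b_def using rounded_weights(1) by (intro near) auto
    show "(1 - d) * \<gamma> \<le> g" unfolding g_def using rounded_weights(3) A(2) by (intro near) auto
    show "(1 - d) * \<mu> \<le> u"
    proof (cases "\<mu> > 0")
      case True
      \<comment> \<open>Three units are lost on the field: one by the query, two by keeping it below
        1.\<close>
      have "2 ^ K * \<mu> - 3 \<le> U" using rounded_field(5) unfolding Q_eq by linarith
      then have "(2 ^ K * \<mu> - A * \<mu>) / S \<le> U / S" using A(3)[OF True] Sp by (intro divide_right_mono) auto
      moreover have "(1 - d) * \<mu> = (2 ^ K * \<mu> - A * \<mu>) / S" using Sp unfolding real_S d_def by (simp add: field_simps)
      ultimately show ?thesis unfolding u_def by simp
    qed (use weights(4) u0 in simp)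
  qed
  have up: "b \<le> \<beta>" "g \<le> \<gamma>" "u \<le> \<mu>"
  proof -
    have "real_of_int U \<le> 2 ^ K * \<mu>" using rounded_field(6) unfolding Q_eq by linarith
    then show "b \<le> \<beta>" "g \<le> \<gamma>" "u \<le> \<mu>"
      unfolding b_def g_def u_def real_S using rounded_weights(2,4) by (simp_all add: divide_le_eq mult.commute)
  qed
  define Z\<^sub>1 where "Z\<^sub>1 = partition_function (interaction b g) u {..<n} E"
  have Z1: "(1 - (real (card E) + real n) * d) * Z \<le> Z\<^sub>1" "Z\<^sub>1 \<le> Z"
    using partition_function_perturb[OF d(1,2) _ _ _ lo up _ E'(3)] weights unfolding Z_def Z\<^sub>1_def by auto
  have prod: "Z\<^sub>1 = b ^ card E * (\<Prod>r<n. 1 + f r)"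
    unfolding Z\<^sub>1_def f_def using partition_function_tail_sum[OF _ graph, of b g u] tail_sum_prod[of "1 / b" g u n E] b0 g0 u0
    by simp
  have f0: "f r \<ge> 0" if "r < n" for r
  proof -
    have "tail_sum (1 / b) g u n E r = tail_sum (1 / b) g u n E (Suc r) *
      (1 + path_ratio (1 / b) g u n E (\<lambda>w. if w < r then 1 else 0) r)"
      by (rule tail_sum_path_ratio[OF E'(1,2)]) (use that b0 g0 u0 in auto)
    moreover have "path_ratio (1 / b) g u n E (\<lambda>w. if w < r then 1 else 0) r \<ge> 0"
      using that b0 g0 u0 by (intro path_ratio_nonneg) auto
    ultimately show ?thesis using Zpos[OF b0 g0 u0, of "Suc r"] unfolding f_def by simp
  qed
  have e: "0 \<le> e" "n * e \<le> h / 16" using nh' by (simp_all add: e_def)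
  have Yf: "\<bar>real_of_int (Y r) / S - f r\<bar> \<le> e" if "r < n" for r
    using ratio_error[OF that Y[OF that]] unfolding f_def e_def b_def g_def u_def by simp
  have ne: "real n * e \<le> 1" using e h by linarith
  have "b ^ card E * ((1 - n * e) * (\<Prod>r<n. 1 + f r)) \<le> Z'" "Z' \<le> b ^ card E * ((1 + 2 * (n * e)) * (\<Prod>r<n. 1 + f r))"
    unfolding Z'_def b_def[symmetric] using product_error[OF f0 e(1) ne Yf] b0 by (intro mult_left_mono; simp)+
  then have Z': "(1 - n * e) * Z\<^sub>1 \<le> Z'" "Z' \<le> (1 + 2 * (n * e)) * Z\<^sub>1"
    unfolding prod by (simp_all add: mult.left_commute mult.assoc)
  have Zp: "Z > 0"
    unfolding Z_def using partition_function_tail_sum[OF _ graph, of \<beta> \<gamma> \<mu>] Zpos[of \<beta> \<gamma> \<mu> 0] weights by simp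
  show "(1 - \<epsilon>) * Z < Z'" "Z' < (1 + \<epsilon>) * Z"
    by (rule relative_error[OF Zp h d(3) _ e(2) Z1 Z'], use e(1) in simp)+
qed

text \<open>The final state is named first; it fixes the integers Y r, and with them the output Z',
  before accuracy and time are stated about it.\<close>

lemma run_outputs:
  "\<exists>Z'. outputs_within (real_inputs \<beta> \<gamma> \<mu> \<epsilon>) (compile 0 (spin_program c \<nu>)) (graph_input n E)
      (real (op_cost c \<nu> k n (precision n \<epsilon>) * steps c \<nu> n (precision n \<epsilon>))) Z' \<and>
    (1 - \<epsilon>) * partition_function (interaction \<beta> \<gamma>) \<mu> {..<n} E < Z' \<and>
    Z' < (1 + \<epsilon>) * partition_function (interaction \<beta> \<gamma>) \<mu> {..<n} E"
proof -
  define s where "s = (regs (graph_input n E), mem (graph_input n E))"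
  have g: "graph_input n E = \<lparr>pc = 0, regs = fst s, mem = snd s\<rparr>" and s0: "fst s 0 = int n"
    by (simp_all add: s_def graph_input_def)
  have "represents_from (snd s) 0" using memory_represents by (simp add: s_def)
  from wp_witness[OF spin_program_correct[OF s0 this]]
  obtain t s' where *: "t \<le> total_time \<and> (\<exists>Y. (\<forall>r<n. partial_sum r (m + 1) (Y r)) \<and>
      fst s' 0 = (\<Prod>r<n. (S + Y r) * B ^ lower_degree r) \<and> fst s' 1 = (\<Prod>r<n. S * S ^ lower_degree r))"
    and wp: "wp (real_inputs \<beta> \<gamma> \<mu> \<epsilon>) W (spin_program c \<nu>) (\<lambda>t' s''. t' = t \<and> s'' = s') s"
    by (elim exE conjE[of "_ \<and> _"])
  from * obtain Y where t: "t \<le> total_time" and Y: "\<And>r. r < n \<Longrightarrow> partial_sum r (m + 1) (Y r)"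
    and s': "fst s' 0 = (\<Prod>r<n. (S + Y r) * B ^ lower_degree r)" "fst s' 1 = (\<Prod>r<n. S * S ^ lower_degree r)"
    by blast
  define Z' where "Z' = (real_of_int B / S) ^ card E * (\<Prod>r<n. 1 + real_of_int (Y r) / S)"
  have Z': "Z' = real_of_int (fst s' 0) / real_of_int (fst s' 1)"
    unfolding s' output_quotient Z'_def ..
  have "fst s' 1 > 0" unfolding s' using S_pos by (intro prod_pos) simp
  then have "wp (real_inputs \<beta> \<gamma> \<mu> \<epsilon>) W (spin_program c \<nu>)
    (\<lambda>t s. t \<le> total_time \<and> fst s 1 > 0 \<and> Z' = real_of_int (fst s 0) / real_of_int (fst s 1)) s"
    by (intro wp_mono[OF wp]) (use t Z' in auto)
  moreover have "W \<ge> 1" by (simp add: W_eq op_cost_def)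
  ultimately have "outputs_within (real_inputs \<beta> \<gamma> \<mu> \<epsilon>) (compile 0 (spin_program c \<nu>)) (graph_input n E) (real (W * total_time)) Z'"
    unfolding g by (intro compile_outputs_within) simp_all
  moreover have "total_time = steps c \<nu> n L"
  proof -
    have "K = (3 * c + 2 * (c * \<nu>)) * L" "M = (2 * c + 2 * (c * \<nu>)) * L"
      by (simp_all add: K_eq M_eq N_eq m_eq algebra_simps)
    then show ?thesis unfolding total_time_eq steps_def by (simp only: m_eq)
  qed
  ultimately show ?thesis
    using run_accuracy[of Y, folded Z'_def, OF Y] unfolding W_eq L_eq by metis
qed

end

section \<open>Existence of the scheme below the diagonal\<close>

lemma outputs_within_mono:
  assumes "outputs_within x P s T z" "T \<le> T'"
  shows "outputs_within x P s T' z"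
proof -
  obtain k where "halted P (run x P s k)" "real (run_time x P s k) \<le> T" "regs (run x P s k) 1 > 0"
    "z = real_of_int (regs (run x P s k) 0) / real_of_int (regs (run x P s k) 1)"
    using assms(1) unfolding outputs_within_def by auto
  then show ?thesis unfolding outputs_within_def using assms(2) by (intro exI[of _ k] conjI) auto
qed

text \<open>Only c and \<nu> enter the program text, while the weights and \<epsilon> are read by
  queries. All constants, those of the time bound included, are chosen before n, E and
  \<epsilon>.\<close>

theorem has_fptas_below_diagonal:
  assumes "0 < \<gamma>" "\<gamma> < \<beta>" "\<beta> * \<gamma> > 1" "0 \<le> \<mu>" "\<mu> \<le> 1"
  shows "has_fptas \<beta> \<gamma> \<mu>"
proof -
  have \<beta>: "1 \<le> \<beta>"
  proof (rule ccontr)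
    assume "\<not> 1 \<le> \<beta>"
    then have "\<beta> * \<gamma> \<le> 1 * 1" using assms by (intro mult_mono) auto
    then show False using assms(3) by simp
  qed
  obtain R t :: real and \<nu> where R: "R\<^sup>2 * \<gamma> < \<beta> - t" "t > 0" "t < \<gamma>" "(\<beta> - t) * (\<gamma> - t) > 1" "\<nu> \<ge> 4" "4 * \<gamma> \<le> real \<nu>" "R > 1 + 1 / real \<nu>"
    using fptas_constants[OF assms(1-3)] by metis
  \<comment> \<open>A turns absolute losses into relative ones: one unit for \<beta> and \<gamma>,
    three for a positive \<mu>. A field 0 suffers no loss.\<close>
  define A where "A = 1 + 1 / \<gamma> + (if \<mu> = 0 then 0 else 3 / \<mu>)"
  have A: "1 \<le> A" "1 \<le> A * \<gamma>" "\<mu> > 0 \<Longrightarrow> 3 \<le> A * \<mu>"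
    using assms by (auto simp: A_def distrib_right)
  have "R - 1 / real \<nu> > 1" using R(7) by simp
  then obtain c where c: "c \<ge> 9" "(1/2) ^ c < t" "8 * A \<le> 2 ^ c" "64 * (R / (R - 1)) \<le> (R - 1 / real \<nu>) ^ c"
    using precision_constant[OF _ R(2)] by metis
  obtain k where k: "\<beta> < 2 ^ k" using real_arch_pow[of 2 \<beta>] by auto
  obtain C d where Cd: "\<And>n \<epsilon>. \<epsilon> > 0 \<Longrightarrow> real (op_cost c \<nu> k n (precision n \<epsilon>) * steps c \<nu> n (precision n \<epsilon>)) \<le> C * (1 + real n + 1 / \<epsilon>) ^ d"
    using poly_bounded_time[of c \<nu> k] unfolding poly_bounded_def by blast
  have "is_fptas (compile 0 (spin_program c \<nu>)) \<beta> \<gamma> \<mu>"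
    unfolding is_fptas_def
  proof (rule exI[of _ C], rule exI[of _ d], intro allI impI)
    fix n E and \<epsilon> :: real assume E: "simple_graph n E" and \<epsilon>: "\<epsilon> > 0"
    define L m N M K where defs: "L = precision n \<epsilon>" "m = c * L" "N = m * \<nu>" "M = 2 * (m + N)" "K = M + m"
    interpret fptas_run \<beta> \<gamma> \<mu> \<epsilon> R t A \<nu> c k n E L m N M K "word_size c \<nu> k L" "op_cost c \<nu> k n L"
      "2 ^ K" "\<lfloor>2 ^ K * \<beta>\<rfloor>" "\<lfloor>2 ^ K * \<gamma>\<rfloor>" "\<lfloor>2 ^ K * \<mu>\<rfloor>" "(\<lfloor>2 ^ K * \<mu>\<rfloor> * 2 ^ K) div (2 ^ K + 1)"
      by unfold_locales (use assms \<beta> R A c k E \<epsilon> defs in auto)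
    from run_outputs obtain Z' where Z': "outputs_within (real_inputs \<beta> \<gamma> \<mu> \<epsilon>) (compile 0 (spin_program c \<nu>)) (graph_input n E)
        (real (op_cost c \<nu> k n (precision n \<epsilon>) * steps c \<nu> n (precision n \<epsilon>))) Z'"
      "(1 - \<epsilon>) * partition_function (interaction \<beta> \<gamma>) \<mu> {..<n} E < Z'"
      "Z' < (1 + \<epsilon>) * partition_function (interaction \<beta> \<gamma>) \<mu> {..<n} E" by blast
    have "outputs_within (real_inputs \<beta> \<gamma> \<mu> \<epsilon>) (compile 0 (spin_program c \<nu>)) (graph_input n E) (C * (1 + real n + 1 / \<epsilon>) ^ d) Z'"
      by (rule outputs_within_mono[OF Z'(1) Cd[OF \<epsilon>]])
    then show "\<exists>Z'. outputs_within (real_inputs \<beta> \<gamma> \<mu> \<epsilon>) (compile 0 (spin_program c \<nu>)) (graph_input n E) (C * (1 + real n + 1 / \<epsilon>) ^ d) Z' \<and>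
      (1 - \<epsilon>) * partition_function (interaction \<beta> \<gamma>) \<mu> {..<n} E < Z' \<and>
      Z' < (1 + \<epsilon>) * partition_function (interaction \<beta> \<gamma>) \<mu> {..<n} E" using Z'(2,3) by blast
  qed
  then show ?thesis unfolding has_fptas_def ..
qed

theorem theorem3p4:
  "\<exists>\<Gamma> :: real \<Rightarrow> real.
     continuous_on {1..} \<Gamma> \<and>
     \<Gamma> 1 = 1 \<and>
     (\<forall>\<beta>>1. 1 < \<Gamma> \<beta> \<and> \<Gamma> \<beta> < \<beta>) \<and>
     ((\<lambda>\<beta>. \<Gamma> \<beta> / \<beta>) \<longlongrightarrow> 1) at_top \<and>
     (\<forall>\<beta> \<gamma> \<mu> :: real. \<beta> \<ge> 1 \<longrightarrow> \<gamma> \<ge> 0 \<longrightarrow> 0 \<le> \<mu> \<longrightarrow> \<mu> \<le> 1 \<longrightarrow>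
        \<beta> * \<gamma> > 1 \<longrightarrow> \<gamma> \<le> \<Gamma> \<beta> \<longrightarrow> has_fptas \<beta> \<gamma> \<mu>)"
proof (intro exI[of _ "\<lambda>\<beta>. \<beta> - 1 + 1 / \<beta>"] conjI allI impI)
  show "continuous_on {1..} (\<lambda>\<beta>::real. \<beta> - 1 + 1 / \<beta>)" by (auto intro!: continuous_intros)
  show "(1::real) - 1 + 1 / 1 = 1" by simp
  show less: "\<beta> - 1 + 1 / \<beta> < \<beta>" if "1 < \<beta>" for \<beta> :: real using that by simp
  show "1 < \<beta> - 1 + 1 / \<beta>" if "1 < \<beta>" for \<beta> :: real
  proof -
    have "0 < (\<beta> - 1)\<^sup>2 / \<beta>" using that by simp
    also have "\<dots> = \<beta> - 1 + 1 / \<beta> - 1" using that by (simp add: power2_eq_square field_simps)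
    finally show ?thesis by simp
  qed
  have "((\<lambda>\<beta>::real. 1 - inverse \<beta> + inverse \<beta> * inverse \<beta>) \<longlongrightarrow> 1 - 0 + 0 * 0) at_top"
    by (intro tendsto_intros tendsto_inverse_0_at_top filterlim_ident)
  moreover have "\<forall>\<^sub>F \<beta>::real in at_top. 1 - inverse \<beta> + inverse \<beta> * inverse \<beta> = (\<beta> - 1 + 1 / \<beta>) / \<beta>"
    using eventually_gt_at_top[of "0::real"] by eventually_elim (simp add: field_simps)
  ultimately show "((\<lambda>\<beta>::real. (\<beta> - 1 + 1 / \<beta>) / \<beta>) \<longlongrightarrow> 1) at_top"
    by (simp add: filterlim_cong)
  fix \<beta> \<gamma> \<mu> :: real
  assume a: "\<beta> \<ge> 1" "\<gamma> \<ge> 0" "0 \<le> \<mu>" "\<mu> \<le> 1" "\<beta> * \<gamma> > 1" "\<gamma> \<le> \<beta> - 1 + 1 / \<beta>"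
  \<comment> \<open>At \<beta> = 1 the curve admits only \<gamma> \<le> 1, against \<beta> \<gamma>
    > 1.\<close>
  then have "\<beta> \<noteq> 1" by auto
  then have "1 < \<beta>" using a(1) by simp
  then have "\<gamma> < \<beta>" using less[of \<beta>] a(6) by linarith
  moreover have "\<gamma> \<noteq> 0" using a(5) by auto
  ultimately show "has_fptas \<beta> \<gamma> \<mu>" using a by (intro has_fptas_below_diagonal) auto
qed

end
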